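(* Let $$f(w,x_1,\ldots,x_{k-1},z)=z^k+a_1(w,x)z^{k-1}+\cdots+a_k(w,x),$$ where $w$ is a single variable, $x=(x_1,\dots,x_{k-1})$, and the coefficients $a_i(w,x)$ are regular (or analytic) functions in a neighbourhood of $0$. If $f$ is $\mathrm{nc}(k)$ at every point of $\{z=x=0,\ w\ne 0\}$, then, after a finite number of blowings-up of $0$, $f$ splits over $\mathbb{C}[[w^{1/p},x]]$, for some positive integer $p$.
   Context: $f$ is $\mathrm{nc}(k)$ at a point if the hypersurface $\{f=0\}$ has normal crossings of order $k$ there, i.e., in suitable étale (or local analytic, or formal) coordinates $(y_1,\dots,y_{k+1})$ at the point, the ideal $(f)$ is generated by $y_1\cdots y_k$. "After a finite number of blowings-up of $0$": at each step, the blown-up point is the point of the strict transform of the $w$-axis $\{x=z=0\}$ lying over $0$; this is the origin of the $w$-chart of the blowing-up, in which one substitutes $(w,wx,wz)$ for $(w,x,z)$, and $f$ is replaced by its strict transform $w^{-k}f(w,wx,wz)$. The assertion is that the strict transform of $f$ after finitely many steps splits at the origin of the last $w$-chart. A monic polynomial $g(w,x,z)$ of degree $k$ in $z$ splits over $\mathbb{C}[[w^{1/p},x]]$ if $g=\prod_{j=1}^k(z-b_j)$ with $b_j\in\mathbb{C}[[w^{1/p},x]]$, each $b_j$ vanishing at the origin. *)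

theory Defs
  imports "HOL-Analysis.Analysis" "HOL-Computational_Algebra.Polynomial"
begin

section \<open>Formal power series in finitely many variables\<close>

text \<open>The ring of formal power series over \<open>'a\<close> in variables indexed by the finite type \<open>'v\<close>;
  a series is the family of its coefficients, indexed by multi-indices.\<close>

typedef ('a, 'v) mps = "UNIV :: (nat ^ 'v \<Rightarrow> 'a) set"
  morphisms mps_coeff Abs_mps ..

lemmas mps_coeff_Abs [simp] = Abs_mps_inverse [OF UNIV_I]

lemma mps_eqI: "(\<And>\<alpha>. mps_coeff F \<alpha> = mps_coeff G \<alpha>) \<Longrightarrow> F = G"
  by (metis ext mps_coeff_inject)

lemma finite_multiindex_le: "finite {\<beta> :: nat ^ 'v::finite. \<forall>i. \<beta> $ i \<le> B i}"
proof -
  have "finite (PiE (UNIV :: 'v set) (\<lambda>i. {..B i}))"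
    by (intro finite_PiE) auto
  moreover have "{\<beta> :: nat ^ 'v. \<forall>i. \<beta> $ i \<le> B i} \<subseteq> vec_lambda ` PiE UNIV (\<lambda>i. {..B i})"
  proof
    fix \<beta> :: "nat ^ 'v" assume "\<beta> \<in> {\<beta>. \<forall>i. \<beta> $ i \<le> B i}"
    then have "vec_nth \<beta> \<in> PiE UNIV (\<lambda>i. {..B i})" "\<beta> = vec_lambda (vec_nth \<beta>)"
      by auto
    then show "\<beta> \<in> vec_lambda ` PiE UNIV (\<lambda>i. {..B i})" by blast
  qed
  ultimately show ?thesis by (meson finite_imageI finite_subset)
qed

lemma finite_multiindex_pairs [simp]:
  "finite {p. fst p + snd p = (\<alpha> :: nat ^ 'v::finite)}"
proof -
  let ?A = "{\<beta> :: nat ^ 'v. \<forall>i. \<beta> $ i \<le> \<alpha> $ i}"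
  have "{p. fst p + snd p = \<alpha>} \<subseteq> ?A \<times> ?A" by auto
  moreover have "finite (?A \<times> ?A)"
    by (intro finite_cartesian_product finite_multiindex_le)
  ultimately show ?thesis by (rule finite_subset)
qed

instantiation mps :: (comm_ring_1, finite) comm_ring_1
begin

definition zero_mps :: "('a, 'b) mps" where
  "0 = Abs_mps (\<lambda>\<alpha>. 0)"

definition one_mps :: "('a, 'b) mps" where
  "1 = Abs_mps (\<lambda>\<alpha>. if \<alpha> = 0 then 1 else 0)"

definition plus_mps :: "('a, 'b) mps \<Rightarrow> ('a, 'b) mps \<Rightarrow> ('a, 'b) mps" where
  "F + G = Abs_mps (\<lambda>\<alpha>. mps_coeff F \<alpha> + mps_coeff G \<alpha>)"

definition uminus_mps :: "('a, 'b) mps \<Rightarrow> ('a, 'b) mps" where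
  "- F = Abs_mps (\<lambda>\<alpha>. - mps_coeff F \<alpha>)"

definition minus_mps :: "('a, 'b) mps \<Rightarrow> ('a, 'b) mps \<Rightarrow> ('a, 'b) mps" where
  "F - G = Abs_mps (\<lambda>\<alpha>. mps_coeff F \<alpha> - mps_coeff G \<alpha>)"

definition times_mps :: "('a, 'b) mps \<Rightarrow> ('a, 'b) mps \<Rightarrow> ('a, 'b) mps" where
  "F * G = Abs_mps (\<lambda>\<alpha>. \<Sum>(\<beta>, \<gamma>) | \<beta> + \<gamma> = \<alpha>. mps_coeff F \<beta> * mps_coeff G \<gamma>)"

lemma mps_coeff_mult:
  "mps_coeff (F * G) \<alpha> = (\<Sum>p | fst p + snd p = \<alpha>. mps_coeff F (fst p) * mps_coeff G (snd p))"
  for F G :: "('a, 'b) mps"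
  by (auto simp: times_mps_def intro!: sum.cong)

instance
proof
  fix F G H :: "('a, 'b) mps"
  show "F * G = G * F"
  proof (rule mps_eqI)
    fix \<alpha> show "mps_coeff (F * G) \<alpha> = mps_coeff (G * F) \<alpha>"
      unfolding mps_coeff_mult
      by (rule sum.reindex_bij_witness[where i = prod.swap and j = prod.swap])
         (auto simp: add.commute mult.commute)
  qed
  show "F * G * H = F * (G * H)"
  proof (rule mps_eqI)
    fix \<alpha>
    have "mps_coeff (F * G * H) \<alpha> =
      (\<Sum>(p, q) \<in> Sigma {p. fst p + snd p = \<alpha>} (\<lambda>p. {q. fst q + snd q = fst p}).
         mps_coeff F (fst q) * mps_coeff G (snd q) * mps_coeff H (snd p))"
      unfolding mps_coeff_mult sum_distrib_right by (subst sum.Sigma) auto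
    also have "\<dots> = (\<Sum>(p, q) \<in> Sigma {p. fst p + snd p = \<alpha>} (\<lambda>p. {q. fst q + snd q = snd p}).
         mps_coeff F (fst p) * (mps_coeff G (fst q) * mps_coeff H (snd q)))"
      by (rule sum.reindex_bij_witness[where
            i = "\<lambda>(p, q). ((fst p + fst q, snd q), (fst p, fst q))" and
            j = "\<lambda>(p, q). ((fst q, snd q + snd p), (snd q, snd p))"])
         (auto simp: add.assoc mult.assoc)
    also have "\<dots> = mps_coeff (F * (G * H)) \<alpha>"
      unfolding mps_coeff_mult sum_distrib_left by (subst sum.Sigma) auto
    finally show "mps_coeff (F * G * H) \<alpha> = mps_coeff (F * (G * H)) \<alpha>" .
  qed
  show "1 * F = F"
  proof (rule mps_eqI)
    fix \<alpha>
    have "mps_coeff (1 * F) \<alpha> =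
      (\<Sum>p | fst p + snd p = \<alpha>. if p = (0, \<alpha>) then mps_coeff F \<alpha> else 0)"
      unfolding mps_coeff_mult one_mps_def by (intro sum.cong) auto
    then show "mps_coeff (1 * F) \<alpha> = mps_coeff F \<alpha>" by (simp add: sum.delta)
  qed
  show "(F + G) * H = F * H + G * H"
    by (rule mps_eqI) (simp add: mps_coeff_mult plus_mps_def distrib_right sum.distrib)
  show "(0 :: ('a, 'b) mps) \<noteq> 1"
  proof
    assume "(0 :: ('a, 'b) mps) = 1"
    then have "mps_coeff (0 :: ('a, 'b) mps) 0 = mps_coeff 1 0" by simp
    then show False by (simp add: zero_mps_def one_mps_def)
  qed
qed (auto intro!: mps_eqI simp: plus_mps_def zero_mps_def uminus_mps_def minus_mps_def algebra_simps)

end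

definition mps_var :: "'v::finite \<Rightarrow> ('a::comm_ring_1, 'v) mps" where
  "mps_var i = Abs_mps (\<lambda>\<alpha>. if \<alpha> = axis i 1 then 1 else 0)"

definition mdeg :: "nat ^ 'v::finite \<Rightarrow> nat" where
  "mdeg \<alpha> = (\<Sum>i\<in>UNIV. \<alpha> $ i)"

text \<open>Substitution of the series \<open>G i\<close> for the variables of \<open>F\<close>. It is meant for \<open>G i\<close> without
  constant term: then the coefficient of a monomial of degree \<open>d\<close> in the composite only involves
  the monomials of degree at most \<open>d\<close> of \<open>F\<close>, so that the sum below is the full one.\<close>

definition mps_subst ::
    "('a::comm_ring_1, 'v::finite) mps \<Rightarrow> ('v \<Rightarrow> ('a, 'u::finite) mps) \<Rightarrow> ('a, 'u) mps" where
  "mps_subst F G = Abs_mps (\<lambda>\<gamma>. \<Sum>\<alpha> | mdeg \<alpha> \<le> mdeg \<gamma>.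
     mps_coeff F \<alpha> * mps_coeff (\<Prod>i\<in>UNIV. G i ^ (\<alpha> $ i)) \<gamma>)"


section \<open>Analytic functions of several complex variables\<close>

definition has_mps_expansion ::
    "(complex ^ 'v::finite \<Rightarrow> complex) \<Rightarrow> complex ^ 'v \<Rightarrow> (complex, 'v) mps \<Rightarrow> bool" where
  "has_mps_expansion f c F \<longleftrightarrow>
     (\<forall>\<^sub>F h in nhds 0. ((\<lambda>\<alpha>. mps_coeff F \<alpha> * (\<Prod>i\<in>UNIV. (h $ i) ^ (\<alpha> $ i))) has_sum f (c + h)) UNIV)"

definition mv_analytic_on ::
    "(complex ^ 'v::finite \<Rightarrow> complex) \<Rightarrow> (complex ^ 'v) set \<Rightarrow> bool" where
  "mv_analytic_on f U \<longleftrightarrow> (\<forall>c\<in>U. \<exists>F. has_mps_expansion f c F)"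

text \<open>The Taylor series of a function analytic at \<open>c\<close>.\<close>

definition mps_expansion ::
    "(complex ^ 'v::finite \<Rightarrow> complex) \<Rightarrow> complex ^ 'v \<Rightarrow> (complex, 'v) mps" where
  "mps_expansion f c = (SOME F. has_mps_expansion f c F)"


section \<open>Normal crossings\<close>

definition formal_coordinates :: "('v::finite \<Rightarrow> (complex, 'v) mps) \<Rightarrow> bool" where
  "formal_coordinates y \<longleftrightarrow>
     (\<forall>i. mps_coeff (y i) 0 = 0) \<and> det (\<chi> i j. mps_coeff (y i) (axis j 1)) \<noteq> 0"

text \<open>\<open>f\<close> is nc(\<open>k\<close>) at \<open>c\<close>: in formal coordinates at \<open>c\<close>, the ideal generated by \<open>f\<close> is generated by
  the product of \<open>k\<close> distinct coordinates.\<close>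

definition nc_at :: "nat \<Rightarrow> (complex ^ 'v::finite \<Rightarrow> complex) \<Rightarrow> complex ^ 'v \<Rightarrow> bool" where
  "nc_at k f c \<longleftrightarrow> (\<exists>F y S. has_mps_expansion f c F \<and> formal_coordinates y \<and> card S = k \<and>
     range (\<lambda>g. F * g) = range (\<lambda>g. (\<Prod>i\<in>S. y i) * g))"


section \<open>Blowing-up and splitting\<close>

text \<open>In what follows the variables \<open>(w, x)\<close> are indexed by \<open>'v\<close>, \<open>w\<close> being a distinguished index
  and the remaining indices being those of \<open>x\<close>. A polynomial over \<open>(complex, 'v) mps\<close> is a
  polynomial in \<open>z\<close> with coefficients in \<open>\<complex>[[w, x]]\<close>.

  \<open>strict_transform w k g g'\<close> says that \<open>g' = w\<^sup>-\<^sup>k g(w, wx, wz)\<close>.\<close>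

definition strict_transform ::
    "'v::finite \<Rightarrow> nat \<Rightarrow> (complex, 'v) mps poly \<Rightarrow> (complex, 'v) mps poly \<Rightarrow> bool" where
  "strict_transform w k g g' \<longleftrightarrow>
     pcompose
       (map_poly (\<lambda>c. mps_subst c (\<lambda>i. if i = w then mps_var w else mps_var w * mps_var i)) g)
       [:0, mps_var w:]
     = smult (mps_var w ^ k) g'"

text \<open>The ring \<open>\<complex>[[w\<^sup>1\<^sup>/\<^sup>p, x]]\<close> is again represented by \<open>(complex, 'v) mps\<close>, the variable of index \<open>w\<close>
  now standing for \<open>w\<^sup>1\<^sup>/\<^sup>p\<close>; the inclusion of \<open>\<complex>[[w, x]]\<close> is then the substitution of the \<open>p\<close>-th power
  of that variable for \<open>w\<close>.\<close>

definition splits_over_root ::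
    "'v::finite \<Rightarrow> nat \<Rightarrow> nat \<Rightarrow> (complex, 'v) mps poly \<Rightarrow> bool" where
  "splits_over_root w p k g \<longleftrightarrow> (\<exists>b. (\<forall>j<k. mps_coeff (b j) 0 = 0) \<and>
     map_poly (\<lambda>c. mps_subst c (\<lambda>i. if i = w then mps_var w ^ p else mps_var i)) g
       = (\<Prod>j<k. [:- b j, 1:]))"

end

theory Submission
  imports Defs "HOL-Complex_Analysis.Complex_Analysis"
begin

text \<open>
  Let \<open>c \<noteq> 0\<close> be small and fix \<open>w = c\<close>. At the point \<open>c\<close> of the \<open>w\<close>-axis, \<open>f\<close> is a multiple of a product
  of \<open>k\<close> formal coordinates \<open>y i\<close>. Comparing orders, all the coefficients of \<open>f\<close> vanish at that
  point; this being so all along the axis, \<open>f\<close> restricts to \<open>z ^ k\<close> on the \<open>(w, z)\<close>-plane. Hence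
  the linear part of each \<open>y i\<close> involves \<open>z\<close> and does not involve \<open>w\<close>, and the formal implicit function
  theorem solves \<open>y i = 0\<close> for \<open>z\<close>. So \<open>f(c, x, z)\<close> is a product of factors \<open>z - b(x)\<close>, where the \<open>k\<close>
  series \<open>b\<close> vanish at \<open>0\<close> and have pairwise distinct linear parts (\<open>splitting_along_punctured_axis\<close>).
  What remains is to follow the roots \<open>b\<close> as \<open>c\<close> moves and tends to \<open>0\<close>.

  The values at \<open>u\<close> of the linear parts are the roots of \<open>z ^ k + (\<Sum>i. p i c u * z ^ (k - i))\<close>, where
  \<open>p i c u\<close>, the value at \<open>u\<close> of the part of degree \<open>i\<close> of the \<open>i\<close>-th coefficient of \<open>f\<close>, is holomorphic
  in \<open>c\<close> even at \<open>c = 0\<close>. As there are exactly \<open>k\<close> linear parts for each \<open>c \<noteq> 0\<close>, they form a covering of the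
  punctured disc (\<open>covering_roots\<close>). They are bounded, so Puiseux' argument applies: for a suitable
  \<open>p\<close> they are convergent power series in \<open>t\<close> when \<open>c = t ^ p\<close>
  (\<open>puiseux_parametrization_of_root_vectors\<close>).

  The higher coefficients of the roots may have poles at \<open>t = 0\<close>. The differences of the linear parts
  vanish there only to a finite order. So, along a line \<open>x = s u\<close> in a general direction \<open>u\<close>, each root
  divided by \<open>s\<close> is a root of a polynomial that is simple up to a power of \<open>t\<close>, and the substitution of
  Newton and Tougeron shows that the coefficient of \<open>s ^ (m + 1)\<close> in the root has a pole of order at
  most \<open>M m\<close>, with \<open>M\<close> independent of \<open>m\<close> (\<open>simple_root_rescaled_regular\<close>). The coefficients of a
  series are linear combinations of those of its restrictions to lines in general directions
  (\<open>coeff_from_generic_slices\<close>). Therefore all the coefficients of \<open>b(q x) / q\<close> are regular at \<open>t = 0\<close>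
  if \<open>q = t ^ M\<close> and \<open>M\<close> is large (\<open>rescaled_roots_regular\<close>).

  Blowing up \<open>N\<close> times has exactly this effect: it replaces the \<open>i\<close>-th coefficient \<open>a(w, x)\<close> by
  \<open>a(w, w ^ N x) / w ^ (N i)\<close> (\<open>iterated_strict_transform\<close>), hence the roots \<open>b(x)\<close> by
  \<open>b(q x) / q\<close> with \<open>q = w ^ N = t ^ (p N)\<close>. The Taylor expansions in \<open>t\<close> of the coefficients of the
  rescaled roots then form series in \<open>w\<^sup>1\<^sup>/\<^sup>p\<close> and \<open>x\<close>, and the factorization, valid for every small
  \<open>t \<noteq> 0\<close>, passes to Taylor expansions (\<open>mps_has_germ_blowup\<close>, \<open>poly_has_germ_unique\<close>).
\<close>

(* The dollar sign is reserved for the components of vectors and multi-indices. *)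
no_notation fps_nth (infixl \<open>$\<close> 75)

section \<open>Coefficients, degrees and monomials\<close>

lemma mps_coeff_0 [simp]: "mps_coeff 0 \<alpha> = 0"
  by (simp add: zero_mps_def)

lemma mps_coeff_1: "mps_coeff 1 \<alpha> = (if \<alpha> = 0 then 1 else 0)"
  by (simp add: one_mps_def)

lemma mps_coeff_add [simp]: "mps_coeff (F + G) \<alpha> = mps_coeff F \<alpha> + mps_coeff G \<alpha>"
  by (simp add: plus_mps_def)

lemma mps_coeff_uminus [simp]: "mps_coeff (- F) \<alpha> = - mps_coeff F \<alpha>"
  by (simp add: uminus_mps_def)

lemma mps_coeff_diff [simp]: "mps_coeff (F - G) \<alpha> = mps_coeff F \<alpha> - mps_coeff G \<alpha>"
  by (simp add: minus_mps_def)

lemma mps_coeff_sum: "mps_coeff (sum F A) \<alpha> = (\<Sum>i\<in>A. mps_coeff (F i) \<alpha>)"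
  by (induction A rule: infinite_finite_induct) auto

definition mps_const :: "'a::comm_ring_1 \<Rightarrow> ('a, 'v::finite) mps" where
  "mps_const a = Abs_mps (\<lambda>\<alpha>. if \<alpha> = 0 then a else 0)"

lemma mps_coeff_const_mult [simp]: "mps_coeff (mps_const a * F) \<alpha> = a * mps_coeff F \<alpha>"
proof -
  have "mps_coeff (mps_const a * F) \<alpha> =
      (\<Sum>p | fst p + snd p = \<alpha>. if p = (0, \<alpha>) then a * mps_coeff F \<alpha> else 0)"
    unfolding mps_coeff_mult mps_const_def by (intro sum.cong) auto
  then show ?thesis by (simp add: sum.delta)
qed

lemma mps_coeff_mult_0: "mps_coeff (F * G) 0 = mps_coeff F 0 * mps_coeff G 0"
proof -
  have "{p :: (nat ^ 'b) \<times> (nat ^ 'b). fst p + snd p = 0} = {(0, 0)}"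
    by (auto simp: vec_eq_iff)
  then show ?thesis by (simp add: mps_coeff_mult)
qed

lemma mdeg_0 [simp]: "mdeg 0 = 0"
  by (simp add: mdeg_def)

lemma mdeg_add: "mdeg (\<alpha> + \<beta>) = mdeg \<alpha> + mdeg \<beta>"
  by (simp add: mdeg_def sum.distrib)

lemma mdeg_eq_0_iff [simp]: "mdeg \<alpha> = 0 \<longleftrightarrow> \<alpha> = 0"
  by (auto simp: mdeg_def vec_eq_iff)

lemma mdeg_axis [simp]: "mdeg (axis i n) = n"
  by (simp add: mdeg_def axis_def)

lemma component_le_mdeg: "\<alpha> $ i \<le> mdeg \<alpha>"
  unfolding mdeg_def by (rule member_le_sum) auto

lemma mdeg_eq_1D:
  assumes "mdeg \<alpha> = 1" obtains i where "\<alpha> = axis i 1"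
proof -
  obtain i where i: "\<alpha> $ i \<noteq> 0"
    using assms by (metis mdeg_0 vec_eq_iff zero_index zero_neq_one)
  have "mdeg \<alpha> = \<alpha> $ i + (\<Sum>j\<in>UNIV - {i}. \<alpha> $ j)"
    unfolding mdeg_def by (subst sum.remove[of _ i]) auto
  then have "\<alpha> $ i = 1" "(\<Sum>j\<in>UNIV - {i}. \<alpha> $ j) = 0" using i assms by linarith+
  then have "\<alpha> $ i = 1" "\<And>j. j \<noteq> i \<Longrightarrow> \<alpha> $ j = 0" by auto
  then have "\<alpha> = axis i 1"
    by (simp add: vec_eq_iff axis_def)
  then show ?thesis by (rule that)
qed

lemma finite_mdeg_le [simp]: "finite {\<alpha> :: nat ^ 'v::finite. mdeg \<alpha> \<le> n}"
proof (rule finite_subset)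
  show "{\<alpha> :: nat ^ 'v. mdeg \<alpha> \<le> n} \<subseteq> {\<alpha>. \<forall>i. \<alpha> $ i \<le> n}"
    using component_le_mdeg order_trans by blast
  show "finite {\<alpha> :: nat ^ 'v. \<forall>i. \<alpha> $ i \<le> n}" by (rule finite_multiindex_le)
qed

lemma finite_mdeg_eq [simp]: "finite {\<alpha> :: nat ^ 'v::finite. mdeg \<alpha> = n}"
  by (rule finite_subset[OF _ finite_mdeg_le[of n]]) auto

lemma mps_coeff_var: "mps_coeff (mps_var i) \<alpha> = (if \<alpha> = axis i 1 then 1 else 0)"
  by (simp add: mps_var_def)

definition mps_monom :: "nat ^ 'v::finite \<Rightarrow> ('a::comm_ring_1, 'v) mps" where
  "mps_monom \<alpha> = Abs_mps (\<lambda>\<gamma>. if \<gamma> = \<alpha> then 1 else 0)"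

lemma mps_coeff_monom: "mps_coeff (mps_monom \<alpha>) \<gamma> = (if \<gamma> = \<alpha> then 1 else 0)"
  by (simp add: mps_monom_def)

lemma mps_coeff_monom_mult_add: "mps_coeff (mps_monom \<delta> * F) (\<delta> + \<gamma>) = mps_coeff F \<gamma>"
proof -
  have "mps_coeff (mps_monom \<delta> * F) (\<delta> + \<gamma>) =
      (\<Sum>p | fst p + snd p = \<delta> + \<gamma>. if p = (\<delta>, \<gamma>) then mps_coeff F \<gamma> else 0)"
    unfolding mps_coeff_mult by (rule sum.cong) (auto simp: mps_coeff_monom)
  then show ?thesis by simp
qed

lemma mps_coeff_monom_mult_not:
  "(\<And>\<eta>. \<gamma> \<noteq> \<delta> + \<eta>) \<Longrightarrow> mps_coeff (mps_monom \<delta> * F) \<gamma> = 0"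
  unfolding mps_coeff_mult by (intro sum.neutral) (auto simp: mps_coeff_monom)

lemma mps_monom_add: "mps_monom (\<alpha> + \<beta>) = mps_monom \<alpha> * mps_monom \<beta>"
proof (rule mps_eqI)
  fix \<gamma>
  show "mps_coeff (mps_monom (\<alpha> + \<beta>)) \<gamma> = mps_coeff (mps_monom \<alpha> * mps_monom \<beta>) \<gamma>"
  proof (cases "\<exists>\<eta>. \<gamma> = \<alpha> + \<eta>")
    case True
    then show ?thesis by (auto simp: mps_coeff_monom_mult_add mps_coeff_monom)
  next
    case False
    then show ?thesis by (subst mps_coeff_monom_mult_not) (auto simp: mps_coeff_monom)
  qed
qed

lemma mps_monom_0: "mps_monom 0 = 1"
  by (simp add: mps_monom_def one_mps_def)

lemma mps_var_eq_monom: "mps_var i = mps_monom (axis i 1)"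
  by (simp add: mps_var_def mps_monom_def)

lemma mps_monom_power: "mps_monom \<alpha> ^ n = mps_monom (\<chi> i. n * \<alpha> $ i)"
proof (induction n)
  case 0
  have "(\<chi> i. 0) = (0 :: nat ^ 'b)" by (simp add: vec_eq_iff)
  then show ?case by (simp add: mps_monom_0)
next
  case (Suc n)
  have "(\<chi> i. Suc n * \<alpha> $ i) = \<alpha> + (\<chi> i. n * \<alpha> $ i)" by (simp add: vec_eq_iff)
  then show ?case using Suc by (simp add: mps_monom_add)
qed

lemma mps_monom_prod: "(\<Prod>i\<in>I. mps_monom (\<alpha> i)) = mps_monom (\<Sum>i\<in>I. \<alpha> i)"
  by (induction I rule: infinite_finite_induct) (auto simp: mps_monom_0 mps_monom_add)

lemma prod_var_power: "(\<Prod>i\<in>UNIV. mps_var i ^ (\<beta> $ i)) = mps_monom \<beta>"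
proof -
  have "(\<Sum>i\<in>UNIV. \<chi> j. \<beta> $ i * axis i 1 $ j) = \<beta>"
    by (simp add: vec_eq_iff axis_def if_distrib cong: if_cong)
  then show ?thesis by (simp only: mps_var_eq_monom mps_monom_power mps_monom_prod)
qed

section \<open>Restriction of a series to the lines through the origin\<close>

definition mpow :: "'a::comm_semiring_1 ^ 'v::finite \<Rightarrow> nat ^ 'v \<Rightarrow> 'a" where
  "mpow u \<alpha> = (\<Prod>i\<in>UNIV. u $ i ^ \<alpha> $ i)"

lemma mpow_0 [simp]: "mpow u 0 = 1"
  by (simp add: mpow_def)

lemma mpow_add: "mpow u (\<alpha> + \<beta>) = mpow u \<alpha> * mpow u \<beta>"
  by (simp add: mpow_def power_add prod.distrib)

lemma mpow_axis [simp]: "mpow u (axis i n) = u $ i ^ n"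
proof -
  have "mpow u (axis i n) = (\<Prod>j\<in>UNIV. if j = i then u $ i ^ n else 1)"
    unfolding mpow_def by (intro prod.cong) (auto simp: axis_def)
  then show ?thesis by simp
qed

lemma mpow_scale: "mpow (t *s u) \<alpha> = t ^ mdeg \<alpha> * mpow u \<alpha>"
  by (simp add: mpow_def mdeg_def power_mult_distrib prod.distrib power_sum)

text \<open>The series \<open>F(t u)\<close> in one variable \<open>t\<close>. Restriction to a line is a ring homomorphism, and questions
  on series in several variables reduce to series in one variable by testing on enough lines.\<close>

definition slice :: "'a::comm_ring_1 ^ 'v::finite \<Rightarrow> ('a, 'v) mps \<Rightarrow> 'a fps" where
  "slice u F = Abs_fps (\<lambda>n. \<Sum>\<alpha> | mdeg \<alpha> = n. mps_coeff F \<alpha> * mpow u \<alpha>)"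

lemma slice_nth: "fps_nth (slice u F) n = (\<Sum>\<alpha> | mdeg \<alpha> = n. mps_coeff F \<alpha> * mpow u \<alpha>)"
  by (simp add: slice_def)

lemma slice_nth_0 [simp]: "fps_nth (slice u F) 0 = mps_coeff F 0"
  by (simp add: slice_nth)

lemma slice_0 [simp]: "slice u 0 = 0"
  by (simp add: fps_eq_iff slice_nth)

lemma slice_add [simp]: "slice u (F + G) = slice u F + slice u G"
  by (simp add: fps_eq_iff slice_nth algebra_simps sum.distrib)

lemma slice_uminus [simp]: "slice u (- F) = - slice u F"
  by (simp add: fps_eq_iff slice_nth sum_negf)

lemma slice_diff [simp]: "slice u (F - G) = slice u F - slice u G"
  by (simp add: fps_eq_iff slice_nth algebra_simps sum_subtractf)

lemma slice_sum [simp]: "slice u (sum F A) = (\<Sum>i\<in>A. slice u (F i))"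
  by (induction A rule: infinite_finite_induct) auto

lemma slice_mult [simp]: "slice u (F * G) = slice u F * slice u G"
proof (rule fps_ext)
  fix n
  let ?f = "\<lambda>p. mps_coeff F (fst p) * mpow u (fst p) * (mps_coeff G (snd p) * mpow u (snd p))"
  have "fps_nth (slice u (F * G)) n = (\<Sum>\<alpha> | mdeg \<alpha> = n. \<Sum>p | fst p + snd p = \<alpha>. ?f p)"
    unfolding slice_nth mps_coeff_mult sum_distrib_right
    by (intro sum.cong) (auto simp: mpow_add)
  also have "\<dots> = (\<Sum>(\<alpha>, p) \<in> Sigma {\<alpha>. mdeg \<alpha> = n} (\<lambda>\<alpha>. {p. fst p + snd p = \<alpha>}). ?f p)"
    by (subst sum.Sigma) auto
  also have "\<dots> = (\<Sum>(i, p) \<in> Sigma {0..n} (\<lambda>i. {\<alpha>. mdeg \<alpha> = i} \<times> {\<alpha>. mdeg \<alpha> = n - i}). ?f p)"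
    by (rule sum.reindex_bij_witness[where i = "\<lambda>(i, p). (fst p + snd p, p)"
          and j = "\<lambda>(\<alpha>, p). (mdeg (fst p), p)"]) (auto simp: mdeg_add)
  also have "\<dots> = (\<Sum>i=0..n. \<Sum>p\<in>{\<alpha>. mdeg \<alpha> = i} \<times> {\<alpha>. mdeg \<alpha> = n - i}. ?f p)"
    by (subst sum.Sigma) auto
  also have "\<dots> = fps_nth (slice u F * slice u G) n"
    unfolding fps_mult_nth slice_nth sum_product sum.cartesian_product
    by (intro sum.cong) (auto simp: case_prod_beta)
  finally show "fps_nth (slice u (F * G)) n = fps_nth (slice u F * slice u G) n" .
qed

lemma slice_1 [simp]: "slice u 1 = 1" for u :: "'a::comm_ring_1 ^ 'v::finite"
proof (rule fps_ext)
  fix n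
  have "fps_nth (slice u 1) n = (\<Sum>\<alpha> :: nat ^ 'v | mdeg \<alpha> = n. if \<alpha> = 0 then 1 else (0 :: 'a))"
    unfolding slice_nth by (rule sum.cong) (auto simp: mps_coeff_1)
  also have "\<dots> = (if n = 0 then 1 else 0)" by (subst sum.delta) auto
  finally show "fps_nth (slice u 1) n = fps_nth 1 n" by simp
qed

lemma slice_prod [simp]: "slice u (prod F A) = (\<Prod>i\<in>A. slice u (F i))"
  by (induction A rule: infinite_finite_induct) auto

lemma slice_power [simp]: "slice u (F ^ n) = slice u F ^ n"
  by (induction n) auto

definition linear_part :: "('a::comm_ring_1, 'v::finite) mps \<Rightarrow> 'a ^ 'v" where
  "linear_part F = (\<chi> i. mps_coeff F (axis i 1))"

definition form :: "'a::comm_ring_1 ^ 'v::finite \<Rightarrow> 'a ^ 'v \<Rightarrow> 'a" where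
  "form l u = (\<Sum>i\<in>UNIV. l $ i * u $ i)"

lemma form_simps [simp]:
  "form (l + l') u = form l u + form l' u" "form (l - l') u = form l u - form l' u"
  "form l (u + u') = form l u + form l u'" "form l (u - u') = form l u - form l u'"
  "form l 0 = 0" "form 0 u = 0" "form l (axis i a) = l $ i * a"
  "form l (a *s u) = a * form l u" "form (- l) u = - form l u"
  by (auto simp: form_def algebra_simps sum.distrib sum_subtractf sum_distrib_left axis_def sum_negf
      if_distrib cong: if_cong)

lemma slice_nth_1: "fps_nth (slice u F) 1 = form (linear_part F) u"
proof -
  have "{\<alpha> :: nat ^ 'b. mdeg \<alpha> = 1} = (\<lambda>i. axis i 1) ` UNIV"
    using mdeg_eq_1D by force
  moreover have "inj (\<lambda>i::'b. axis i (1::nat))"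
    by (auto simp: inj_def axis_eq_axis)
  ultimately show ?thesis
    by (simp add: slice_nth form_def linear_part_def sum.reindex)
qed

text \<open>Kronecker's substitution: along the curve of points \<open>s ^ (B ^ e i)\<close>, with \<open>e\<close> numbering the
  variables, a monomial becomes the power of \<open>s\<close> whose digits in base \<open>B\<close> are its exponents. So monomials
  with exponents less than \<open>B\<close> can be told apart.\<close>

definition curve :: "('v::finite \<Rightarrow> nat) \<Rightarrow> nat \<Rightarrow> 'a::comm_ring_1 \<Rightarrow> 'a ^ 'v" where
  "curve e B s = (\<chi> i. s ^ (B ^ e i))"

definition curve_exp :: "('v::finite \<Rightarrow> nat) \<Rightarrow> nat \<Rightarrow> nat ^ 'v \<Rightarrow> nat" where
  "curve_exp e B \<alpha> = (\<Sum>i\<in>UNIV. \<alpha> $ i * B ^ e i)"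

lemma mpow_curve: "mpow (curve e B s) \<alpha> = s ^ curve_exp e B \<alpha>"
  by (simp add: mpow_def curve_def curve_exp_def power_sum mult.commute flip: power_mult)

lemma base_expansion_unique:
  fixes a b :: "nat \<Rightarrow> nat"
  assumes "\<And>i. i < n \<Longrightarrow> a i < B" "\<And>i. i < n \<Longrightarrow> b i < B"
    and "(\<Sum>i<n. a i * B ^ i) = (\<Sum>i<n. b i * B ^ i)"
  shows "\<forall>i<n. a i = b i"
  using assms
proof (induction n arbitrary: a b)
  case 0
  then show ?case by simp
next
  case (Suc n)
  have split: "(\<Sum>i<Suc n. f i * B ^ i) = f 0 + B * (\<Sum>i<n. f (Suc i) * B ^ i)" for f :: "nat \<Rightarrow> nat"
    by (subst sum.lessThan_Suc_shift) (simp add: sum_distrib_left algebra_simps)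
  have eq: "a 0 + B * (\<Sum>i<n. a (Suc i) * B ^ i) = b 0 + B * (\<Sum>i<n. b (Suc i) * B ^ i)"
    using Suc.prems(3) unfolding split .
  have lt: "a 0 < B" "b 0 < B" using Suc.prems by auto
  have 0: "a 0 = b 0"
    using arg_cong[OF eq, of "\<lambda>x. x mod B"] lt by simp
  then have "(\<Sum>i<n. a (Suc i) * B ^ i) = (\<Sum>i<n. b (Suc i) * B ^ i)"
    using eq lt by simp
  then have "\<forall>i<n. a (Suc i) = b (Suc i)"
    using Suc.prems by (intro Suc.IH) auto
  with 0 show ?case by (auto simp: less_Suc_eq_0_disj)
qed

lemma curve_exp_inj:
  assumes e: "bij_betw e (UNIV :: 'v::finite set) {..<n}"
    and "\<And>i. \<alpha> $ i < B" "\<And>i. \<beta> $ i < B" and eq: "curve_exp e B \<alpha> = curve_exp e B \<beta>"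
  shows "\<alpha> = \<beta>"
proof -
  let ?d = "inv_into UNIV e"
  have d: "e j < n" "?d (e j) = j" for j using e by (auto simp: bij_betw_def)
  have conv: "curve_exp e B \<gamma> = (\<Sum>i<n. \<gamma> $ (?d i) * B ^ i)" for \<gamma>
    using sum.reindex_bij_betw[OF e, of "\<lambda>i. \<gamma> $ (?d i) * B ^ i"] by (simp add: curve_exp_def d)
  have "\<forall>i<n. \<alpha> $ (?d i) = \<beta> $ (?d i)"
    using assms eq unfolding conv by (intro base_expansion_unique) auto
  then show ?thesis using d by (metis vec_eq_iff)
qed

text \<open>The coefficients of the Lagrange interpolation formula: they depend on the nodes only, and not on the
  polynomial.\<close>

lemma poly_coeff_interpolation:
  fixes G :: "'a::field set"
  assumes "finite G"
  shows "\<exists>\<mu>. \<forall>q. degree q < card G \<longrightarrow> coeff q d = (\<Sum>s\<in>G. \<mu> s * poly q s)"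
proof -
  define L where "L s = (\<Prod>t\<in>G - {s}. [:- t, 1:])" for s
  have L0: "poly (L s) t = 0 \<longleftrightarrow> t \<noteq> s" if "s \<in> G" "t \<in> G" for s t
    using that assms by (auto simp: L_def poly_prod)
  have degL: "degree (L s) < card G" if "s \<in> G" for s
  proof -
    have "degree (L s) \<le> (\<Sum>t\<in>G - {s}. degree [:- t, 1:])"
      unfolding L_def using degree_prod_sum_le[of "G - {s}" "\<lambda>t. [:- t, 1:]"] assms
      by (simp add: o_def)
    also have "\<dots> < card G" using card_Diff1_less[OF assms that] by simp
    finally show ?thesis .
  qed
  define \<mu> where "\<mu> s = coeff (L s) d / poly (L s) s" for s
  have "coeff q d = (\<Sum>s\<in>G. \<mu> s * poly q s)" if q: "degree q < card G" for q
  proof -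
    define r where "r = (\<Sum>s\<in>G. smult (poly q s / poly (L s) s) (L s))"
    have "poly r t = poly q t" if "t \<in> G" for t
    proof -
      have "poly r t = (\<Sum>s\<in>G. if s = t then poly q t else 0)"
        unfolding r_def poly_sum using that L0[OF that that] L0[OF _ that]
        by (intro sum.cong) auto
      then show ?thesis using that assms by simp
    qed
    moreover have "degree r < card G"
      unfolding r_def using q by (intro degree_sum_less) (auto simp: degL intro: le_less_trans[OF degree_smult_le])
    ultimately have "q = r"
      using q by (intro poly_eqI_degree[of G]) auto
    then have "coeff q d = coeff r d" by simp
    also have "\<dots> = (\<Sum>s\<in>G. \<mu> s * poly q s)"
      by (simp add: r_def coeff_sum \<mu>_def algebra_simps)
    finally show ?thesis .
  qed
  then show ?thesis by blast
qed

text \<open>The coefficients of \<open>t ^ n\<close> in the slices of \<open>F\<close> are the values of the homogeneous part of degree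
  \<open>n\<close> of \<open>F\<close>. Along Kronecker's curve that part becomes a polynomial in one variable \<open>s\<close> which has the same
  coefficients, and Lagrange interpolation recovers these from finitely many values of \<open>s\<close>. A
  nonzero linear form does not vanish identically along the curve, so finitely many such forms exclude
  finitely many \<open>s\<close> only. It is essential below that the weights \<open>\<mu>\<close> do not depend on \<open>F\<close>.\<close>

lemma coeff_from_generic_slices:
  fixes \<Lambda> :: "(complex ^ 'v::finite) set" and \<beta> :: "nat ^ 'v"
  assumes "finite \<Lambda>" "0 \<notin> \<Lambda>"
  shows "\<exists>(G :: (complex ^ 'v) set) \<mu>. finite G \<and> (\<forall>u\<in>G. \<forall>l\<in>\<Lambda>. form l u \<noteq> 0) \<and>
    (\<forall>F. mps_coeff F \<beta> = (\<Sum>u\<in>G. \<mu> u * fps_nth (slice u F) (mdeg \<beta>)))"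
proof -
  obtain e where e: "bij_betw e (UNIV :: 'v set) {..<CARD('v)}"
    using ex_bij_betw_finite_nat[of "UNIV :: 'v set"] by (auto simp: atLeast0LessThan)
  define n where "n = mdeg \<beta>"
  define B where "B = n + 2"
  define c where "c = (curve e B :: complex \<Rightarrow> complex ^ 'v)"
  define x where "x = curve_exp e B"
  have x_inj: "\<alpha> = \<gamma>" if "mdeg \<alpha> \<le> n + 1" "mdeg \<gamma> \<le> n + 1" "x \<alpha> = x \<gamma>" for \<alpha> \<gamma>
  proof (rule curve_exp_inj[OF e])
    show "\<alpha> $ i < B" "\<gamma> $ i < B" for i
      using that component_le_mdeg[of \<alpha> i] component_le_mdeg[of \<gamma> i] by (auto simp: B_def)
  qed (use that in \<open>simp add: x_def\<close>)
  define ql where "ql l = (\<Sum>i\<in>UNIV. monom (l $ i) (x (axis i 1)))" for l :: "complex ^ 'v"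
  have poly_ql: "poly (ql l) s = form l (c s)" for l s
    by (simp add: ql_def poly_sum poly_monom form_def c_def x_def flip: mpow_curve)
  have ql_nz: "ql l \<noteq> 0" if "l \<in> \<Lambda>" for l
  proof -
    have "l \<noteq> 0" using that assms by auto
    then obtain i where i: "l $ i \<noteq> 0" by (auto simp: vec_eq_iff)
    have "x (axis j 1) = x (axis i 1) \<longleftrightarrow> j = i" for i j
      using x_inj[of "axis j 1" "axis i 1"] by (auto simp: axis_eq_axis)
    then have "coeff (ql l) (x (axis i 1)) = l $ i"
      by (simp add: ql_def coeff_sum coeff_monom)
    with i show ?thesis by auto
  qed
  define M where "M = Suc (Max (x ` {\<alpha>. mdeg \<alpha> = n}))"
  define bad where "bad = {s. poly (\<Prod>l\<in>\<Lambda>. ql l) s = 0}"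
  have "finite bad"
    unfolding bad_def using ql_nz assms by (intro poly_roots_finite) auto
  then have "infinite (- bad - {0})"
    by (simp add: infinite_UNIV_char_0 Diff_infinite_finite Compl_eq_Diff_UNIV)
  then have "infinite (- bad)" by auto
  then obtain G where G: "finite G" "card G = M" "G \<subseteq> - bad"
    using infinite_arbitrarily_large by metis
  obtain \<mu> where \<mu>: "\<And>q. degree q < card G \<Longrightarrow> coeff q (x \<beta>) = (\<Sum>s\<in>G. \<mu> s * poly q s)"
    using poly_coeff_interpolation[OF G(1)] by blast
  have inj: "inj c"
  proof
    fix s t :: complex assume "c s = c t"
    have "0 \<in> {..<CARD('v)}" by (simp add: card_gt_0_iff)
    then obtain i where "e i = 0" using e by (metis bij_betw_iff_bijections)
    then show "s = t" using arg_cong[OF \<open>c s = c t\<close>, of "\<lambda>v. v $ i"] by (simp add: c_def curve_def)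
  qed
  show ?thesis
  proof (intro exI conjI allI ballI)
    show "finite (c ` G)" using G by simp
    fix u l assume "u \<in> c ` G" "l \<in> \<Lambda>"
    then obtain s where "s \<in> G" "u = c s" by auto
    then have "poly (\<Prod>l\<in>\<Lambda>. ql l) s \<noteq> 0" using G by (auto simp: bad_def)
    then show "form l u \<noteq> 0"
      using \<open>l \<in> \<Lambda>\<close> assms \<open>u = c s\<close> by (auto simp: poly_prod poly_ql)
  next
    fix F :: "(complex, 'v) mps"
    define q where "q = (\<Sum>\<alpha> | mdeg \<alpha> = n. monom (mps_coeff F \<alpha>) (x \<alpha>))"
    have "degree (monom a (x \<alpha>)) < M" if "mdeg \<alpha> = n" for a :: complex and \<alpha>
      using that unfolding M_def by (intro le_less_trans[OF degree_monom_le] le_imp_less_Suc Max_ge) auto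
    then have "degree q < M"
      unfolding q_def by (intro degree_sum_less) (auto simp: M_def)
    moreover have "poly q s = fps_nth (slice (c s) F) n" for s
      by (simp add: q_def poly_sum poly_monom slice_nth c_def x_def mpow_curve)
    moreover have "coeff q (x \<beta>) = (\<Sum>\<alpha> | mdeg \<alpha> = n. if \<alpha> = \<beta> then mps_coeff F \<beta> else 0)"
      unfolding q_def coeff_sum using x_inj by (intro sum.cong) (auto simp: n_def coeff_monom)
    then have "coeff q (x \<beta>) = mps_coeff F \<beta>" by (simp add: n_def)
    ultimately have "mps_coeff F \<beta> = (\<Sum>s\<in>G. \<mu> s * fps_nth (slice (c s) F) n)"
      using \<mu>[of q] G by simp
    also have "\<dots> = (\<Sum>u\<in>c ` G. \<mu> (inv c u) * fps_nth (slice u F) n)"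
      using inj by (subst sum.reindex) (auto simp: inj_on_def inj_def)
    finally show "mps_coeff F \<beta> = (\<Sum>u\<in>c ` G. (\<mu> \<circ> inv c) u * fps_nth (slice u F) (mdeg \<beta>))"
      by (simp add: n_def)
  qed
qed

lemma mps_eqI_generic_slices:
  fixes F G :: "(complex, 'v::finite) mps"
  assumes "finite \<Lambda>" "0 \<notin> \<Lambda>"
    and "\<And>u. (\<And>l. l \<in> \<Lambda> \<Longrightarrow> form l u \<noteq> 0) \<Longrightarrow> slice u F = slice u G"
  shows "F = G"
proof (rule mps_eqI)
  fix \<beta>
  obtain U :: "(complex ^ 'v) set" and \<mu> where "\<forall>u\<in>U. \<forall>l\<in>\<Lambda>. form l u \<noteq> 0"
    and "\<And>F. mps_coeff F \<beta> = (\<Sum>u\<in>U. \<mu> u * fps_nth (slice u F) (mdeg \<beta>))"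
    using coeff_from_generic_slices[OF assms(1,2), of \<beta>] by blast
  then show "mps_coeff F \<beta> = mps_coeff G \<beta>" using assms(3) by simp
qed

lemma generic_direction:
  fixes \<Lambda> :: "(complex ^ 'v::finite) set"
  assumes "finite \<Lambda>" "0 \<notin> \<Lambda>"
  obtains u where "\<And>l. l \<in> \<Lambda> \<Longrightarrow> form l u \<noteq> 0"
  using mps_eqI_generic_slices[OF assms, of 0 1] by (metis zero_neq_one)

section \<open>Substitution and implicit functions\<close>

definition ordge :: "nat \<Rightarrow> ('a::comm_ring_1, 'v::finite) mps \<Rightarrow> bool" where
  "ordge n F \<longleftrightarrow> (\<forall>\<gamma>. mdeg \<gamma> < n \<longrightarrow> mps_coeff F \<gamma> = 0)"

lemma ordge_D: "ordge n F \<Longrightarrow> mdeg \<gamma> < n \<Longrightarrow> mps_coeff F \<gamma> = 0"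
  by (simp add: ordge_def)

lemma ordge_0 [simp]: "ordge 0 F" and ordge_zero [simp]: "ordge n 0"
  by (auto simp: ordge_def)

lemma ordge_1_iff: "ordge 1 F \<longleftrightarrow> mps_coeff F 0 = 0" "ordge (Suc 0) F \<longleftrightarrow> mps_coeff F 0 = 0"
  by (auto simp: ordge_def)

lemma ordge_mono: "ordge n F \<Longrightarrow> m \<le> n \<Longrightarrow> ordge m F"
  by (auto simp: ordge_def)

lemma ordge_add: "ordge n F \<Longrightarrow> ordge n G \<Longrightarrow> ordge n (F + G)"
  and ordge_diff: "ordge n F \<Longrightarrow> ordge n G \<Longrightarrow> ordge n (F - G)"
  and ordge_uminus: "ordge n F \<Longrightarrow> ordge n (- F)"
  and ordge_const_mult: "ordge n F \<Longrightarrow> ordge n (mps_const a * F)"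
  by (auto simp: ordge_def)

lemma ordge_mult:
  assumes "ordge m F" "ordge n G"
  shows "ordge (m + n) (F * G)"
  unfolding ordge_def
proof (intro allI impI)
  fix \<gamma> :: "nat ^ 'b" assume "mdeg \<gamma> < m + n"
  then have "mdeg (fst p) < m \<or> mdeg (snd p) < n" if "fst p + snd p = \<gamma>" for p
    using that by (auto simp: mdeg_add)
  then show "mps_coeff (F * G) \<gamma> = 0"
    unfolding mps_coeff_mult using assms by (intro sum.neutral) (fastforce simp: ordge_def)
qed

lemma ordge_prod:
  "(\<And>i. i \<in> A \<Longrightarrow> ordge (n i) (F i)) \<Longrightarrow> ordge (sum n A) (prod F A)"
  by (induction A rule: infinite_finite_induct) (auto intro: ordge_mult)

lemma ordge_power: "ordge m F \<Longrightarrow> ordge (n * m) (F ^ n)"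
  by (induction n) (auto intro: ordge_mult)

lemma ordge_all_imp_zero: "(\<And>n. ordge n F) \<Longrightarrow> F = 0"
  by (rule mps_eqI) (auto intro: ordge_D[of "Suc _"])

text \<open>Without constant terms, only finitely many monomials of \<open>F\<close> contribute to a given coefficient of the
  composite, and substitution is a ring homomorphism.\<close>

locale mps_substitution =
  fixes G :: "'v::finite \<Rightarrow> ('a::comm_ring_1, 'u::finite) mps"
  assumes no_const: "\<And>i. mps_coeff (G i) 0 = 0"
begin

definition pw :: "nat ^ 'v \<Rightarrow> ('a, 'u) mps" where
  "pw \<alpha> = (\<Prod>i\<in>UNIV. G i ^ (\<alpha> $ i))"

lemma pw_add: "pw (\<alpha> + \<beta>) = pw \<alpha> * pw \<beta>"
  by (simp add: pw_def power_add prod.distrib)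

lemma ordge_pw: "ordge (mdeg \<alpha>) (pw \<alpha>)"
proof -
  have "ordge (\<alpha> $ i * 1) (G i ^ (\<alpha> $ i))" for i
    by (intro ordge_power) (simp only: ordge_1_iff no_const)
  then show ?thesis unfolding pw_def mdeg_def by (intro ordge_prod) simp
qed

lemma coeff_pw: "mdeg \<gamma> < mdeg \<alpha> \<Longrightarrow> mps_coeff (pw \<alpha>) \<gamma> = 0"
  using ordge_pw ordge_D by blast

lemma coeff_subst:
  assumes "mdeg \<gamma> \<le> M"
  shows "mps_coeff (mps_subst F G) \<gamma> = (\<Sum>\<alpha> | mdeg \<alpha> \<le> M. mps_coeff F \<alpha> * mps_coeff (pw \<alpha>) \<gamma>)"
  unfolding mps_subst_def mps_coeff_Abs pw_def[symmetric]
  by (rule sum.mono_neutral_left) (use assms coeff_pw in \<open>auto simp: not_le\<close>)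

lemma subst_add: "mps_subst (F + F') G = mps_subst F G + mps_subst F' G"
  by (rule mps_eqI) (simp add: mps_subst_def sum.distrib algebra_simps)

lemma subst_0: "mps_subst 0 G = 0"
  by (rule mps_eqI) (simp add: mps_subst_def)

lemma subst_sum: "mps_subst (sum F A) G = (\<Sum>i\<in>A. mps_subst (F i) G)"
  by (induction A rule: infinite_finite_induct) (auto simp: subst_add subst_0)

lemma subst_mult: "mps_subst (F * F') G = mps_subst F G * mps_subst F' G"
proof (rule mps_eqI)
  fix \<gamma> :: "nat ^ 'u"
  define n where "n = mdeg \<gamma>"
  define D :: "(nat ^ 'v) set" where "D = {\<alpha>. mdeg \<alpha> \<le> n}"
  have [simp]: "finite D" by (simp add: D_def)
  let ?f = "\<lambda>p. mps_coeff F (fst p) * mps_coeff F' (snd p)"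
  let ?g = "\<lambda>p. ?f p * mps_coeff (pw (fst p) * pw (snd p)) \<gamma>"
  have "mps_coeff (mps_subst (F * F') G) \<gamma> = (\<Sum>\<alpha>\<in>D. \<Sum>p | fst p + snd p = \<alpha>. ?g p)"
    unfolding D_def n_def coeff_subst[OF order_refl] mps_coeff_mult[of F] sum_distrib_right
    by (intro sum.cong) (auto simp flip: pw_add)
  also have "\<dots> = (\<Sum>(\<alpha>, p) \<in> Sigma D (\<lambda>\<alpha>. {p. fst p + snd p = \<alpha>}). ?g p)"
    by (subst sum.Sigma) auto
  also have "\<dots> = (\<Sum>p | mdeg (fst p) + mdeg (snd p) \<le> n. ?g p)"
    by (rule sum.reindex_bij_witness[where i = "\<lambda>p. (fst p + snd p, p)" and j = snd])
       (auto simp: mdeg_add D_def)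
  also have "\<dots> = (\<Sum>p\<in>D \<times> D. ?g p)"
    by (rule sum.mono_neutral_left)
       (auto simp: D_def n_def not_le mdeg_add coeff_pw simp flip: pw_add)
  also have "\<dots> = (\<Sum>p\<in>D \<times> D. \<Sum>q | fst q + snd q = \<gamma>.
      (mps_coeff F (fst p) * mps_coeff (pw (fst p)) (fst q)) *
      (mps_coeff F' (snd p) * mps_coeff (pw (snd p)) (snd q)))"
    unfolding mps_coeff_mult sum_distrib_left by (simp add: algebra_simps)
  also have "\<dots> = (\<Sum>q | fst q + snd q = \<gamma>. \<Sum>p\<in>D \<times> D.
      (mps_coeff F (fst p) * mps_coeff (pw (fst p)) (fst q)) *
      (mps_coeff F' (snd p) * mps_coeff (pw (snd p)) (snd q)))"
    by (rule sum.swap)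
  also have "\<dots> = (\<Sum>q | fst q + snd q = \<gamma>.
      mps_coeff (mps_subst F G) (fst q) * mps_coeff (mps_subst F' G) (snd q))"
  proof (intro sum.cong refl)
    fix q assume "q \<in> {q. fst q + snd q = \<gamma>}"
    then have "mdeg (fst q) \<le> n" "mdeg (snd q) \<le> n" by (auto simp: n_def mdeg_add)
    then show "(\<Sum>p\<in>D \<times> D.
        (mps_coeff F (fst p) * mps_coeff (pw (fst p)) (fst q)) *
        (mps_coeff F' (snd p) * mps_coeff (pw (snd p)) (snd q))) =
      mps_coeff (mps_subst F G) (fst q) * mps_coeff (mps_subst F' G) (snd q)"
      by (simp add: coeff_subst[of _ n] sum_product sum.cartesian_product case_prod_beta flip: D_def)
  qed
  also have "\<dots> = mps_coeff (mps_subst F G * mps_subst F' G) \<gamma>"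
    by (simp add: mps_coeff_mult)
  finally show "mps_coeff (mps_subst (F * F') G) \<gamma> = mps_coeff (mps_subst F G * mps_subst F' G) \<gamma>" .
qed

lemma subst_1: "mps_subst 1 G = 1"
proof (rule mps_eqI)
  fix \<gamma> :: "nat ^ 'u"
  have "mps_coeff (mps_subst 1 G) \<gamma> = (\<Sum>\<alpha> :: nat ^ 'v | mdeg \<alpha> \<le> mdeg \<gamma>. if \<alpha> = 0 then mps_coeff (1 :: ('a, 'u) mps) \<gamma> else 0)"
    unfolding coeff_subst[OF order_refl] by (intro sum.cong) (auto simp: mps_coeff_1 pw_def)
  then show "mps_coeff (mps_subst 1 G) \<gamma> = mps_coeff 1 \<gamma>" by simp
qed

lemma subst_prod: "mps_subst (prod F A) G = (\<Prod>i\<in>A. mps_subst (F i) G)"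
  by (induction A rule: infinite_finite_induct) (auto simp: subst_mult subst_1)

lemma subst_power: "mps_subst (F ^ n) G = mps_subst F G ^ n"
  by (induction n) (auto simp: subst_mult subst_1)

lemma pw_axis: "pw (axis i 1) = G i"
proof -
  have "pw (axis i 1) = (\<Prod>j\<in>UNIV. if j = i then G i else 1)"
    unfolding pw_def by (intro prod.cong) (auto simp: axis_def)
  then show ?thesis by simp
qed

lemma subst_var: "mps_subst (mps_var i) G = G i"
proof (rule mps_eqI)
  fix \<gamma> :: "nat ^ 'u"
  have "mps_coeff (mps_subst (mps_var i) G) \<gamma> =
      (\<Sum>\<alpha> | mdeg \<alpha> \<le> Suc (mdeg \<gamma>). mps_coeff (mps_var i) \<alpha> * mps_coeff (pw \<alpha>) \<gamma>)"
    by (rule coeff_subst) simp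
  also have "\<dots> = (\<Sum>\<alpha> | mdeg \<alpha> \<le> Suc (mdeg \<gamma>). if \<alpha> = axis i 1 then mps_coeff (G i) \<gamma> else 0)"
    by (rule sum.cong) (auto simp: mps_var_def simp flip: pw_axis)
  finally have "mps_coeff (mps_subst (mps_var i) G) \<gamma> =
      (\<Sum>\<alpha> | mdeg \<alpha> \<le> Suc (mdeg \<gamma>). if \<alpha> = axis i 1 then mps_coeff (G i) \<gamma> else 0)" .
  then show "mps_coeff (mps_subst (mps_var i) G) \<gamma> = mps_coeff (G i) \<gamma>" by simp
qed

end

lemma (in mps_substitution) linear_coeff_subst:
  "mps_coeff (mps_subst F G) (axis j 1) = (\<Sum>i\<in>UNIV. mps_coeff F (axis i 1) * mps_coeff (G i) (axis j 1))"
proof -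
  have inj: "inj (\<lambda>i::'v. axis i (1::nat))" by (auto simp: inj_def axis_eq_axis)
  have "mps_coeff (mps_subst F G) (axis j 1) =
      (\<Sum>\<alpha> | mdeg \<alpha> \<le> 1. mps_coeff F \<alpha> * mps_coeff (pw \<alpha>) (axis j 1))"
    by (rule coeff_subst) simp
  also have "\<dots> = (\<Sum>\<alpha>\<in>range (\<lambda>i. axis i 1). mps_coeff F \<alpha> * mps_coeff (pw \<alpha>) (axis j 1))"
  proof (rule sum.mono_neutral_right)
    show "\<forall>\<alpha>\<in>{\<alpha>. mdeg \<alpha> \<le> 1} - range (\<lambda>i. axis i 1). mps_coeff F \<alpha> * mps_coeff (pw \<alpha>) (axis j 1) = 0"
    proof
      fix \<alpha> :: "nat ^ 'v" assume \<alpha>: "\<alpha> \<in> {\<alpha>. mdeg \<alpha> \<le> 1} - range (\<lambda>i. axis i 1)"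
      have "mdeg \<alpha> \<noteq> 1" using \<alpha> mdeg_eq_1D by blast
      moreover have "mdeg \<alpha> \<le> 1" using \<alpha> by simp
      ultimately have "mdeg \<alpha> = 0" by linarith
      then have "\<alpha> = 0" by simp
      then show "mps_coeff F \<alpha> * mps_coeff (pw \<alpha>) (axis j 1) = 0"
        by (simp add: pw_def mps_coeff_1)
    qed
  qed auto
  also have "\<dots> = (\<Sum>i\<in>UNIV. mps_coeff F (axis i 1) * mps_coeff (G i) (axis j 1))"
    by (subst sum.reindex[OF inj]) (simp add: pw_axis[unfolded One_nat_def])
  finally show ?thesis .
qed

text \<open>A substitution of monomials for the variables moves exponents by an additive map \<open>\<sigma>\<close>. Where \<open>\<sigma>\<close> is
  injective, a coefficient of the composite is a single coefficient of \<open>A\<close> or zero, the condition \<open>P\<close> telling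
  whether the exponent \<open>\<gamma>\<close> is in the image of \<open>\<sigma>\<close>, and \<open>\<rho>\<close> being its preimage.\<close>

lemma coeff_monomial_subst:
  fixes G :: "'v::finite \<Rightarrow> ('a::comm_ring_1, 'u::finite) mps"
  assumes G: "\<And>i. G i = mps_monom (g i)" and \<sigma>: "\<And>\<alpha>. (\<Sum>i\<in>UNIV. \<chi> j. \<alpha> $ i * g i $ j) = \<sigma> \<alpha>"
    and inv: "\<And>\<alpha>. \<sigma> \<alpha> = \<gamma> \<longleftrightarrow> P \<and> \<alpha> = \<rho>" and deg: "P \<Longrightarrow> mdeg \<rho> \<le> mdeg \<gamma>"
  shows "mps_coeff (mps_subst A G) \<gamma> = (if P then mps_coeff A \<rho> else 0)"
proof -
  have "mps_coeff (mps_subst A G) \<gamma> =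
      (\<Sum>\<alpha> | mdeg \<alpha> \<le> mdeg \<gamma>. mps_coeff A \<alpha> * (if \<gamma> = \<sigma> \<alpha> then 1 else 0))"
    unfolding mps_subst_def mps_coeff_Abs
    by (simp only: G mps_monom_power mps_monom_prod \<sigma> mps_coeff_monom)
  also have "\<dots> = (\<Sum>\<alpha> | mdeg \<alpha> \<le> mdeg \<gamma>. if \<alpha> = \<rho> then if P then mps_coeff A \<rho> else 0 else 0)"
    by (rule sum.cong) (auto simp: inv eq_commute[of \<gamma>])
  also have "\<dots> = (if P then mps_coeff A \<rho> else 0)" using deg by simp
  finally show ?thesis .
qed

text \<open>The substitution of \<open>b\<close> for \<open>z\<close> (the variable \<open>None\<close>) and \<open>0\<close> for \<open>w\<close>. The variable \<open>w\<close> stays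
  among those of \<open>b\<close>, so that series in \<open>(w, x)\<close> and in \<open>x\<close> have the same type.\<close>

definition graph_map :: "'v::finite \<Rightarrow> ('a::comm_ring_1, 'v) mps \<Rightarrow> 'v option \<Rightarrow> ('a, 'v) mps" where
  "graph_map w b i = (case i of None \<Rightarrow> b | Some j \<Rightarrow> if j = w then 0 else mps_var j)"

lemma mps_substitution_graph_map:
  "mps_coeff b 0 = 0 \<Longrightarrow> mps_substitution (graph_map w b)"
  by unfold_locales (auto simp: graph_map_def mps_var_def split: option.split)

lemma prod_UNIV_option:
  "(\<Prod>i\<in>UNIV. f i) = f None * (\<Prod>j\<in>UNIV. f (Some j))" for f :: "'v::finite option \<Rightarrow> 'a::comm_monoid_mult"
  by (simp add: UNIV_option_conv prod.reindex)

lemma sum_UNIV_option: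
  "(\<Sum>i\<in>UNIV. f i) = f None + (\<Sum>j\<in>UNIV. f (Some j))" for f :: "'v::finite option \<Rightarrow> 'a::comm_monoid_add"
  by (simp add: UNIV_option_conv sum.reindex)

lemma ordge_power_diff:
  assumes "ordge 1 b" "ordge 1 b'" "ordge (n + 1) (b - b')"
  shows "ordge (n + j) (b ^ j - b' ^ j)"
proof (induction j)
  case (Suc j)
  have "b ^ Suc j - b' ^ Suc j = b * (b ^ j - b' ^ j) + (b - b') * b' ^ j"
    by (simp add: algebra_simps)
  moreover have "ordge (1 + (n + j)) (b * (b ^ j - b' ^ j))"
    by (intro ordge_mult Suc assms)
  moreover have "ordge ((n + 1) + j * 1) ((b - b') * b' ^ j)"
    by (intro ordge_mult ordge_power assms)
  ultimately show ?case by (simp add: ordge_add)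
qed auto

text \<open>A monomial of \<open>Y\<close> of degree at least 2 contributes to \<open>Y(b) - Y(b')\<close> the difference \<open>b - b'\<close> multiplied
  by something of positive order, or nothing if it does not contain \<open>z\<close>. So, up to one more order, only
  the term linear in \<open>z\<close> remains.\<close>

lemma graph_subst_diff:
  assumes "ordge 1 b" "ordge 1 b'" "ordge (n + 1) (b - b')"
  shows "ordge (n + 2) (mps_subst Y (graph_map w b) - mps_subst Y (graph_map w b')
     - mps_const (mps_coeff Y (axis None 1)) * (b - b'))"
  unfolding ordge_def
proof (intro allI impI)
  fix \<gamma> :: "nat ^ 'b" assume \<gamma>: "mdeg \<gamma> < n + 2"
  interpret b: mps_substitution "graph_map w b"
    using assms by (intro mps_substitution_graph_map) (simp only: ordge_1_iff)
  interpret b': mps_substitution "graph_map w b'"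
    using assms by (intro mps_substitution_graph_map) (simp only: ordge_1_iff)
  let ?e = "axis None 1 :: nat ^ 'b option" and ?M = "Suc (mdeg \<gamma>)"
  define d where "d \<alpha> = mps_coeff (b.pw \<alpha> - b'.pw \<alpha>) \<gamma>" for \<alpha>
  have d0: "d \<alpha> = 0" if "\<alpha> \<noteq> ?e" for \<alpha>
  proof (cases "\<alpha> $ None = 0")
    case True
    then show ?thesis by (simp add: d_def b.pw_def b'.pw_def graph_map_def prod_UNIV_option)
  next
    case False
    have "mdeg \<alpha> \<noteq> 1"
    proof
      assume "mdeg \<alpha> = 1"
      then obtain i where "\<alpha> = axis i 1" by (rule mdeg_eq_1D)
      with that False show False by (auto simp: axis_def split: if_splits)
    qed
    then have 2: "mdeg \<alpha> \<ge> 2" using component_le_mdeg[of \<alpha> None] False by linarith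
    let ?R = "\<Prod>j\<in>UNIV. graph_map w b (Some j) ^ \<alpha> $ Some j"
    have "ordge (\<Sum>j\<in>UNIV. \<alpha> $ Some j) ?R"
    proof (rule ordge_prod)
      fix j show "ordge (\<alpha> $ Some j) (graph_map w b (Some j) ^ \<alpha> $ Some j)"
        using ordge_power[of 1 "graph_map w b (Some j)" "\<alpha> $ Some j"] b.no_const
        by (simp add: ordge_1_iff)
    qed
    then have "ordge ((n + \<alpha> $ None) + (\<Sum>j\<in>UNIV. \<alpha> $ Some j)) ((b ^ \<alpha> $ None - b' ^ \<alpha> $ None) * ?R)"
      by (intro ordge_mult ordge_power_diff assms)
    also have "(b ^ \<alpha> $ None - b' ^ \<alpha> $ None) * ?R = b.pw \<alpha> - b'.pw \<alpha>"
      by (simp add: b.pw_def b'.pw_def graph_map_def prod_UNIV_option algebra_simps)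
    also have "(n + \<alpha> $ None) + (\<Sum>j\<in>UNIV. \<alpha> $ Some j) = n + mdeg \<alpha>"
      by (simp add: mdeg_def sum_UNIV_option)
    finally show ?thesis unfolding d_def using \<gamma> 2 by (auto dest!: ordge_D)
  qed
  have "mps_coeff (mps_subst Y (graph_map w b)) \<gamma> - mps_coeff (mps_subst Y (graph_map w b')) \<gamma>
      = (\<Sum>\<alpha> | mdeg \<alpha> \<le> ?M. mps_coeff Y \<alpha> * d \<alpha>)"
    by (simp add: b.coeff_subst[of _ ?M] b'.coeff_subst[of _ ?M] d_def algebra_simps sum_subtractf)
  also have "\<dots> = (\<Sum>\<alpha> | mdeg \<alpha> \<le> ?M. if \<alpha> = ?e then mps_coeff Y ?e * d ?e else 0)"
    by (intro sum.cong) (auto simp: d0)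
  also have "\<dots> = mps_coeff Y ?e * d ?e" by simp
  also have "d ?e = mps_coeff (b - b') \<gamma>"
    unfolding d_def b.pw_axis b'.pw_axis by (simp add: graph_map_def)
  finally show "mps_coeff (mps_subst Y (graph_map w b) - mps_subst Y (graph_map w b')
     - mps_const (mps_coeff Y (axis None 1)) * (b - b')) \<gamma> = 0" by simp
qed

lemma mps_subst_const_term: "mps_coeff (mps_subst F G) 0 = mps_coeff F 0"
proof -
  have "{\<alpha> :: nat ^ 'c. mdeg \<alpha> \<le> 0} = {0}" by auto
  then show ?thesis by (simp add: mps_subst_def mps_coeff_1)
qed

text \<open>Newton's iteration with the fixed slope \<open>a\<close>: by \<open>graph_subst_diff\<close>, \<open>b \<mapsto> b - Y(b) / a\<close> gains one order of
  agreement in each step, so the iterates stabilize coefficientwise.\<close>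

lemma implicit_function:
  fixes Y :: "('a::field, 'v::finite option) mps"
  assumes Y0: "mps_coeff Y 0 = 0" and Y1: "mps_coeff Y (axis None 1) \<noteq> 0"
  obtains b where "mps_coeff b 0 = 0" "mps_subst Y (graph_map w b) = 0"
proof -
  define a where "a = mps_coeff Y (axis None 1)"
  have a: "a \<noteq> 0" using Y1 by (simp add: a_def)
  define S where "S b = mps_subst Y (graph_map w b)" for b
  define step where "step b = b - mps_const (1 / a) * S b" for b
  define B where "B n = (step ^^ n) 0" for n
  have B_Suc: "B (Suc n) = step (B n)" for n by (simp add: B_def)
  have S0: "mps_coeff (S b) 0 = 0" for b
    by (simp add: S_def mps_subst_const_term Y0)
  have B1: "ordge 1 (B n)" for n
    by (induction n) (auto simp: B_def step_def ordge_1_iff S0)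
  have step_diff: "ordge (n + 2) (step b - step b')"
    if "ordge 1 b" "ordge 1 b'" "ordge (n + 1) (b - b')" for b b' n
  proof -
    have "step b - step b' = - (mps_const (1 / a) * (S b - S b' - mps_const a * (b - b')))"
      using a by (intro mps_eqI, unfold step_def mps_coeff_diff mps_coeff_uminus mps_coeff_const_mult)
        (simp add: field_simps)
    then show ?thesis
      using graph_subst_diff[OF that, of Y w] by (auto simp: S_def a_def intro: ordge_uminus ordge_const_mult)
  qed
  have diff: "ordge (n + 1) (B (Suc n) - B n)" for n
  proof (induction n)
    case 0
    then show ?case using B1[of 1] by (simp add: B_def)
  next
    case (Suc n)
    from step_diff[OF B1 B1 Suc] show ?case by (simp add: B_Suc)
  qed
  have stable: "mps_coeff (B (mdeg \<gamma> + m)) \<gamma> = mps_coeff (B (mdeg \<gamma>)) \<gamma>" for \<gamma> m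
  proof (induction m)
    case (Suc m)
    then show ?case using ordge_D[OF diff[of "mdeg \<gamma> + m"], of \<gamma>] by simp
  qed auto
  define b where "b = Abs_mps (\<lambda>\<gamma>. mps_coeff (B (mdeg \<gamma>)) \<gamma>)"
  have b_B: "ordge (n + 1) (b - B n)" for n
    unfolding ordge_def
  proof (intro allI impI)
    fix \<gamma> :: "nat ^ 'v" assume "mdeg \<gamma> < n + 1"
    then show "mps_coeff (b - B n) \<gamma> = 0"
      using stable[of \<gamma> "n - mdeg \<gamma>"] by (simp add: b_def)
  qed
  have b1: "ordge 1 b" using b_B[of 0] by (simp add: B_def)
  have "ordge (n + 1) (S b)" for n
  proof -
    have eq: "S b = (S b - S (B n) - mps_const a * (b - B n)) + mps_const a * (b - B n)
       - mps_const a * (B (Suc n) - B n)"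
      using a by (intro mps_eqI, unfold B_Suc step_def mps_coeff_add mps_coeff_diff mps_coeff_const_mult)
        (simp add: field_simps)
    have "ordge (n + 2) (S b - S (B n) - mps_const a * (b - B n))"
      using graph_subst_diff[OF b1 B1 b_B] by (simp add: S_def a_def)
    then have "ordge (n + 1) (S b - S (B n) - mps_const a * (b - B n))"
      by (rule ordge_mono) simp
    then show ?thesis
      by (subst eq, intro ordge_diff[OF ordge_add[OF _ ordge_const_mult[OF b_B]] ordge_const_mult[OF diff]])
  qed
  then have "ordge n (S b)" for n by (rule ordge_mono[of "n + 1"]) simp
  then have "S b = 0" by (rule ordge_all_imp_zero)
  with b1 show ?thesis by (intro that[of b]) (auto simp: S_def ordge_1_iff)
qed

section \<open>Monic polynomials over power series\<close>

definition weierstrass :: "nat \<Rightarrow> (nat \<Rightarrow> 'a::comm_ring_1) \<Rightarrow> 'a poly" where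
  "weierstrass k A = monom 1 k + (\<Sum>i=1..k. monom (A i) (k - i))"

lemma poly_weierstrass: "poly (weierstrass k A) z = z ^ k + (\<Sum>i=1..k. A i * z ^ (k - i))"
  by (simp add: weierstrass_def poly_monom poly_sum)

lemma coeff_weierstrass:
  "coeff (weierstrass k A) j = (if j < k then A (k - j) else if j = k then 1 else 0)"
proof -
  have "coeff (weierstrass k A) j = (if j = k then 1 else 0) + (\<Sum>i=1..k. if i = k - j \<and> j < k then A i else 0)"
    unfolding weierstrass_def coeff_add coeff_monom coeff_sum by (intro arg_cong2[of _ _ _ _ "(+)"] sum.cong) auto
  also have "(\<Sum>i=1..k. if i = k - j \<and> j < k then A i else 0) = (if j < k then A (k - j) else 0)"
    by (cases "j < k") auto
  finally show ?thesis by auto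
qed

lemma degree_weierstrass: "degree (weierstrass k A) = k"
proof (rule antisym)
  show "degree (weierstrass k A) \<le> k" by (rule degree_le) (simp add: coeff_weierstrass)
  show "degree (weierstrass k A) \<ge> k" by (rule le_degree) (simp add: coeff_weierstrass)
qed

lemma coeff_linear_mult:
  "coeff ([:- b, 1:] * P) j = - b * coeff P j + (case j of 0 \<Rightarrow> 0 | Suc i \<Rightarrow> coeff P i)"
  for b :: "'a::comm_ring_1"
  by (simp add: coeff_pCons split: nat.split)

lemma coeff_prod_above:
  assumes "finite I" "j > card I"
  shows "coeff (\<Prod>i\<in>I. [:- b i, 1:]) j = 0"
  using assms
proof (induction I arbitrary: j rule: finite_induct)
  case (insert i I)
  then show ?case
    unfolding prod.insert[OF insert.hyps] card_insert_disjoint[OF insert.hyps] coeff_linear_mult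
    by (cases j) auto
qed (simp add: coeff_pCons split: nat.split)

lemma coeff_prod_top: "finite I \<Longrightarrow> coeff (\<Prod>i\<in>I. [:- b i, 1:]) (card I) = 1"
proof (induction I rule: finite_induct)
  case (insert i I)
  then show ?case
    unfolding prod.insert[OF insert.hyps] card_insert_disjoint[OF insert.hyps] coeff_linear_mult
    using coeff_prod_above[of I "Suc (card I)" b] by simp
qed simp

lemma poly_map_slice: "poly (map_poly (slice u) H) (slice u b) = slice u (poly H b)"
proof -
  have "degree (map_poly (slice u) H) \<le> degree H"
    by (rule degree_le) (auto simp: coeff_map_poly coeff_eq_0)
  then have "{..degree (map_poly (slice u) H)} \<subseteq> {..degree H}" by simp
  then have "poly (map_poly (slice u) H) (slice u b)
      = (\<Sum>i\<le>degree H. coeff (map_poly (slice u) H) i * slice u b ^ i)"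
    unfolding poly_altdef[of "map_poly (slice u) H"]
    by (rule sum.mono_neutral_left[OF finite_atMost]) (simp add: coeff_eq_0)
  then show ?thesis by (simp add: poly_altdef coeff_map_poly)
qed

text \<open>The difference \<open>H\<close> of the two sides has degree less than \<open>card R\<close> and vanishes at every element of \<open>R\<close>.
  On a line in a direction that separates the linear parts, the elements of \<open>R\<close> stay distinct, and \<open>H\<close>
  becomes a polynomial over the integral domain of series in one variable with more roots than its degree
  allows. So \<open>H\<close> vanishes on all such lines, which is enough.\<close>

lemma monic_poly_factorization:
  fixes Q :: "(complex, 'v::finite) mps poly"
  assumes "finite R" "inj_on linear_part R" and Q: "degree Q = card R" "lead_coeff Q = 1"
    and roots: "\<And>b. b \<in> R \<Longrightarrow> poly Q b = 0"
  shows "Q = (\<Prod>b\<in>R. [:- b, 1:])"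
proof -
  define T where "T = (\<Prod>b\<in>R. [:- b, 1:])"
  define H where "H = Q - T"
  have deg: "coeff H i = 0" if "i \<ge> card R" for i
  proof (cases "i = card R")
    case True
    then show ?thesis
      using Q coeff_prod_top[OF \<open>finite R\<close>, of "\<lambda>b. b"] by (simp add: H_def T_def)
  next
    case False
    with that show ?thesis
      using Q coeff_prod_above[OF \<open>finite R\<close>, of i "\<lambda>b. b"] by (simp add: H_def T_def coeff_eq_0)
  qed
  have rootsH: "poly H b = 0" if "b \<in> R" for b
  proof -
    have "poly T b = 0"
      unfolding T_def poly_prod by (rule prod_zero[OF \<open>finite R\<close>]) (use that in auto)
    with roots[OF that] show ?thesis by (simp add: H_def)
  qed
  define \<Lambda> where "\<Lambda> = (\<lambda>(b, b'). linear_part b - linear_part b') ` {(b, b'). b \<in> R \<and> b' \<in> R \<and> b \<noteq> b'}"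
  have "finite {(b, b'). b \<in> R \<and> b' \<in> R \<and> b \<noteq> b'}"
    by (rule finite_subset[of _ "R \<times> R"]) (use \<open>finite R\<close> in auto)
  then have \<Lambda>1: "finite \<Lambda>" unfolding \<Lambda>_def by (rule finite_imageI)
  have \<Lambda>2: "0 \<notin> \<Lambda>"
  proof
    assume "0 \<in> \<Lambda>"
    then obtain b b' where "b \<in> R" "b' \<in> R" "b \<noteq> b'" "linear_part b = linear_part b'"
      unfolding \<Lambda>_def by auto
    with assms(2) show False by (meson inj_onD)
  qed
  have "coeff H i = 0" for i
  proof (rule mps_eqI_generic_slices[OF \<Lambda>1 \<Lambda>2])
    fix u assume u: "\<And>l. l \<in> \<Lambda> \<Longrightarrow> form l u \<noteq> 0"
    define h where "h = map_poly (slice u) H"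
    have "inj_on (slice u) R"
    proof (rule inj_onI, rule ccontr)
      fix b b' assume b: "b \<in> R" "b' \<in> R" "slice u b = slice u b'" "b \<noteq> b'"
      then have "linear_part b - linear_part b' \<in> \<Lambda>" 
        unfolding \<Lambda>_def by (intro image_eqI[of _ _ "(b, b')"]) auto
      from u[OF this] b(3) show False by (simp flip: slice_nth_1)
    qed
    then have card: "card (slice u ` R) = card R" by (rule card_image)
    have "h = 0"
    proof (rule ccontr)
      assume "h \<noteq> 0"
      have "slice u ` R \<subseteq> {x. poly h x = 0}"
        by (auto simp: h_def poly_map_slice rootsH)
      then have "card R \<le> card {x. poly h x = 0}"
        unfolding card[symmetric] by (intro card_mono poly_roots_finite \<open>h \<noteq> 0\<close>)
      also have "\<dots> \<le> degree h" by (rule card_poly_roots_bound[OF \<open>h \<noteq> 0\<close>])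
      finally have "coeff H (degree h) = 0" by (rule deg)
      then have "lead_coeff h = 0" by (simp add: h_def coeff_map_poly)
      with \<open>h \<noteq> 0\<close> show False by simp
    qed
    then have "coeff h i = 0" by simp
    then show "slice u (coeff H i) = slice u 0" by (simp add: h_def coeff_map_poly)
  qed
  then have "H = 0" by (simp add: poly_eq_iff)
  then show ?thesis by (simp add: H_def T_def)
qed

section \<open>Analytic functions along lines\<close>

lemma has_sum_fibers:
  fixes f :: "'a \<Rightarrow> complex"
  assumes "(f has_sum S) UNIV" and "\<And>n. (f has_sum g n) {x. q x = n}"
  shows "(g has_sum S) (UNIV :: 'b set)"
proof (rule has_sum_SigmaD)
  let ?\<Sigma> = "Sigma (UNIV :: 'b set) (\<lambda>n. {x. q x = n})"
  have "bij_betw snd ?\<Sigma> (UNIV :: 'a set)"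
    by (rule bij_betw_byWitness[where f' = "\<lambda>x. (q x, x)"]) auto
  from has_sum_reindex_bij_betw[OF this, of f S] assms(1)
  show "((\<lambda>p. f (snd p)) has_sum S) ?\<Sigma>" by simp
  show "((\<lambda>y. f (snd (n, y))) has_sum g n) {x. q x = n}" for n using assms(2) by simp
qed

lemma scale_tendsto_zero:
  "filterlim (\<lambda>t. t *s u) (nhds 0) (nhds (0::complex))" for u :: "complex ^ 'v::finite"
proof -
  have "((\<lambda>t. t *s u) \<longlongrightarrow> 0 *s u) (nhds (0::complex))"
    unfolding vector_scalar_mult_def
    by (intro tendsto_vec_lambda tendsto_intros) (rule filterlim_ident)
  then show ?thesis by simp
qed

lemma slice_has_fps_expansion:
  assumes "has_mps_expansion f c F"
  shows "(\<lambda>t. f (c + t *s u)) has_fps_expansion slice u F"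
proof (rule has_fps_expansionI)
  have "\<forall>\<^sub>F t in nhds 0. ((\<lambda>\<alpha>. mps_coeff F \<alpha> * (\<Prod>i\<in>UNIV. ((t *s u) $ i) ^ (\<alpha> $ i))) has_sum f (c + t *s u)) UNIV"
    using assms scale_tendsto_zero[of u]
    unfolding has_mps_expansion_def filterlim_iff by blast
  then show "\<forall>\<^sub>F t in nhds 0. (\<lambda>n. fps_nth (slice u F) n * t ^ n) sums f (c + t *s u)"
  proof eventually_elim
    case (elim t)
    then have *: "((\<lambda>\<alpha>. mps_coeff F \<alpha> * mpow (t *s u) \<alpha>) has_sum f (c + t *s u)) UNIV"
      by (simp add: mpow_def)
    have "((\<lambda>n. fps_nth (slice u F) n * t ^ n) has_sum f (c + t *s u)) UNIV"
    proof (rule has_sum_fibers[where q = mdeg, OF *])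
      show "((\<lambda>\<alpha>. mps_coeff F \<alpha> * mpow (t *s u) \<alpha>) has_sum fps_nth (slice u F) n * t ^ n) {x. mdeg x = n}" for n
        unfolding slice_nth sum_distrib_right
        by (rule has_sum_finiteI) (auto simp: mpow_scale intro!: sum.cong)
    qed
    then show ?case by (rule has_sum_imp_sums)
  qed
qed

text \<open>For \<open>\<beta>\<close> with \<open>\<beta> $ w = 0\<close>: the coefficient of \<open>x ^ \<beta>\<close> in \<open>A\<close>, as a power series in \<open>w\<close>.\<close>

definition axis_coeffs :: "'v::finite \<Rightarrow> ('a::comm_ring_1, 'v) mps \<Rightarrow> nat ^ 'v \<Rightarrow> 'a fps" where
  "axis_coeffs w A \<beta> = Abs_fps (\<lambda>m. mps_coeff A (\<beta> + axis w m))"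

text \<open>The series \<open>A(c, x)\<close>, for \<open>c\<close> within the radii of convergence of the coefficients.\<close>

definition restrict_at :: "'v::finite \<Rightarrow> (complex, 'v) mps \<Rightarrow> complex \<Rightarrow> (complex, 'v) mps" where
  "restrict_at w A c = Abs_mps (\<lambda>\<beta>. if \<beta> $ w = 0 then eval_fps (axis_coeffs w A \<beta>) c else 0)"

lemma norm_axis_complex: "norm (axis w c :: complex ^ 'v::finite) = norm c"
proof -
  have "norm (axis w c :: complex ^ 'v) = L2_set (\<lambda>i. if i = w then norm c else 0) UNIV"
    unfolding norm_vec_def by (intro L2_set_cong) (auto simp: axis_def)
  also have "\<dots> = sqrt (\<Sum>i\<in>UNIV. if i = w then (norm c)\<^sup>2 else 0)"
    unfolding L2_set_def by (intro arg_cong[of _ _ sqrt] sum.cong) auto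
  also have "\<dots> = norm c" by simp
  finally show ?thesis .
qed

text \<open>Near the point \<open>c\<close> of the axis, sum the absolutely convergent series of \<open>a\<close> at \<open>0\<close> by powers of \<open>w\<close>
  first, and then by degree in \<open>x\<close>.\<close>

lemma restrict_at_expansion:
  fixes a :: "complex ^ 'v::finite \<Rightarrow> complex"
  assumes "has_mps_expansion a 0 A"
  obtains r where "r > 0" "\<And>\<beta>. fps_conv_radius (axis_coeffs w A \<beta>) \<ge> ereal r"
    "\<And>c u. norm c < r \<Longrightarrow> u $ w = 0 \<Longrightarrow>
       (\<lambda>t. a (axis w c + t *s u)) has_fps_expansion slice u (restrict_at w A c)"
proof -
  obtain \<delta> where \<delta>: "\<delta> > 0"
    and sumA: "\<And>h. norm h < \<delta> \<Longrightarrow> ((\<lambda>\<alpha>. mps_coeff A \<alpha> * mpow h \<alpha>) has_sum a h) UNIV"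
    using assms unfolding has_mps_expansion_def eventually_nhds_metric mpow_def[symmetric]
    by (auto simp: dist_norm)
  define r where "r = \<delta> / (2 * real CARD('v))"
  have card: "real CARD('v) \<ge> 1" by (simp add: Suc_leI card_gt_0_iff)
  then have r: "r > 0" "r \<le> \<delta> / 2" using \<delta> by (auto simp: r_def field_simps)
  (* All components of h0 have modulus r, so convergence at h0 bounds the coefficients of every
    power series in w by a geometric sequence of ratio 1 / r. *)
  define h0 :: "complex ^ 'v" where "h0 = (\<chi> i. of_real r)"
  have "norm h0 \<le> (\<Sum>i\<in>(UNIV :: 'v set). norm (h0 $ i))" 
    unfolding norm_vec_def by (rule L2_set_le_sum) simp
  also have "\<dots> = real CARD('v) * r" using r by (simp add: h0_def)
  also have "\<dots> = \<delta> / 2" by (simp add: r_def)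
  also have "\<dots> < \<delta>" using \<delta> by simp
  finally have h0: "norm h0 < \<delta>" .
  have mpow_h0: "mpow h0 \<alpha> = of_real r ^ mdeg \<alpha>" for \<alpha>
    by (simp add: mpow_def h0_def mdeg_def power_sum)
  have inj: "inj (\<lambda>m. \<beta> + axis w m)" for \<beta> :: "nat ^ 'v"
    by (auto simp: inj_def axis_eq_axis)
  have radius: "fps_conv_radius (axis_coeffs w A \<beta>) \<ge> ereal r" for \<beta>
  proof -
    have "(\<lambda>\<alpha>. mps_coeff A \<alpha> * mpow h0 \<alpha>) summable_on range (\<lambda>m. \<beta> + axis w m)"
      by (rule summable_on_subset_banach[OF has_sum_imp_summable[OF sumA[OF h0]]]) simp
    then have "((\<lambda>\<alpha>. mps_coeff A \<alpha> * mpow h0 \<alpha>) \<circ> (\<lambda>m. \<beta> + axis w m)) summable_on UNIV"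
      by (rule summable_on_reindex[OF inj, THEN iffD1])
    then have "(\<lambda>m. mps_coeff A (\<beta> + axis w m) * of_real r ^ (mdeg \<beta> + m)) summable_on UNIV"
      by (simp add: mpow_h0 mdeg_add o_def)
    then have "summable (\<lambda>m. mps_coeff A (\<beta> + axis w m) * of_real r ^ (mdeg \<beta> + m))"
      by (rule summable_on_imp_summable)
    then have "summable (\<lambda>m. of_real r ^ mdeg \<beta> * (fps_nth (axis_coeffs w A \<beta>) m * of_real r ^ m))"
      by (simp add: axis_coeffs_def power_add mult_ac)
    then have "summable (\<lambda>m. fps_nth (axis_coeffs w A \<beta>) m * (of_real r :: complex) ^ m)"
      by (rule summable_mult_D) (use r in simp)
    from conv_radius_geI[OF this] show ?thesis using r by (simp add: fps_conv_radius_def)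
  qed
  show ?thesis
  proof (rule that[OF r(1) radius])
    fix c :: complex and u :: "complex ^ 'v"
    assume c: "norm c < r" and u: "u $ w = 0"
    show "(\<lambda>t. a (axis w c + t *s u)) has_fps_expansion slice u (restrict_at w A c)"
    proof (rule has_fps_expansionI)
      have "\<forall>\<^sub>F t in nhds 0. norm (t *s u) < \<delta> / 2"
      proof (rule eventually_compose_filterlim[OF _ scale_tendsto_zero])
        show "\<forall>\<^sub>F x in nhds (0 :: complex ^ 'v). norm x < \<delta> / 2"
          using eventually_nhds_in_open[of "ball (0 :: complex ^ 'v) (\<delta> / 2)" 0] \<delta> by simp
      qed
      then show "\<forall>\<^sub>F t in nhds 0. (\<lambda>n. fps_nth (slice u (restrict_at w A c)) n * t ^ n) sums a (axis w c + t *s u)"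
      proof eventually_elim
        case (elim t)
        define h where "h = axis w c + t *s u"
        have "norm h \<le> norm c + norm (t *s u)"
          unfolding h_def by (rule order.trans[OF norm_triangle_ineq]) (simp add: norm_axis_complex)
        then have "norm h < \<delta>" using c r elim by linarith
        from sumA[OF this] have sum_h: "((\<lambda>\<alpha>. mps_coeff A \<alpha> * mpow h \<alpha>) has_sum a h) UNIV" .
        have mpow_h: "mpow h (\<beta> + axis w m) = t ^ mdeg \<beta> * mpow u \<beta> * c ^ m" if "\<beta> $ w = 0" for \<beta> m
        proof -
          have "mpow h \<beta> = mpow (t *s u) \<beta>"
            unfolding mpow_def h_def using that by (intro prod.cong) (auto simp: axis_def)
          then show ?thesis using u by (simp add: mpow_add mpow_scale) (simp add: h_def axis_def)
        qed
        define q where "q \<alpha> = mdeg \<alpha> - \<alpha> $ w" for \<alpha> :: "nat ^ 'v"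
        have "((\<lambda>n. fps_nth (slice u (restrict_at w A c)) n * t ^ n) has_sum a h) UNIV"
        proof (rule has_sum_fibers[where q = q, OF sum_h])
          fix n
          define D where "D = {\<beta> :: nat ^ 'v. mdeg \<beta> = n \<and> \<beta> $ w = 0}"
          have fin: "finite D" by (rule finite_subset[OF _ finite_mdeg_eq[of n]]) (auto simp: D_def)
          have bij: "bij_betw (\<lambda>(\<beta>, m). \<beta> + axis w m) (D \<times> UNIV) {\<alpha>. q \<alpha> = n}"
          proof (rule bij_betw_byWitness[where f' = "\<lambda>\<alpha>. (\<alpha> - axis w (\<alpha> $ w), \<alpha> $ w)"])
            show "\<forall>p\<in>D \<times> UNIV. (case case p of (\<beta>, m) \<Rightarrow> \<beta> + axis w m of \<alpha> \<Rightarrow> (\<alpha> - axis w (\<alpha> $ w), \<alpha> $ w)) = p"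
              by (auto simp: D_def vec_eq_iff axis_def)
            show "\<forall>\<alpha>\<in>{\<alpha>. q \<alpha> = n}. (case (\<alpha> - axis w (\<alpha> $ w), \<alpha> $ w) of (\<beta>, m) \<Rightarrow> \<beta> + axis w m) = \<alpha>"
              by (auto simp: vec_eq_iff axis_def)
            have "(\<beta> + axis w m) $ w = \<beta> $ w + m" for \<beta> and m :: nat by (simp add: axis_def)
            then show "(\<lambda>(\<beta>, m). \<beta> + axis w m) ` (D \<times> UNIV) \<subseteq> {\<alpha>. q \<alpha> = n}"
              by (auto simp: D_def q_def mdeg_add simp del: vector_add_component)
            have "mdeg (\<alpha> - axis w (\<alpha> $ w)) = mdeg \<alpha> - \<alpha> $ w" for \<alpha>
            proof -
              have "\<alpha> = (\<alpha> - axis w (\<alpha> $ w)) + axis w (\<alpha> $ w)" by (auto simp: vec_eq_iff axis_def)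
              then have "mdeg \<alpha> = mdeg (\<alpha> - axis w (\<alpha> $ w)) + \<alpha> $ w" by (metis mdeg_add mdeg_axis)
              then show ?thesis by simp
            qed
            then show "(\<lambda>\<alpha>. (\<alpha> - axis w (\<alpha> $ w), \<alpha> $ w)) ` {\<alpha>. q \<alpha> = n} \<subseteq> D \<times> UNIV"
              by (auto simp: D_def q_def axis_def)
          qed
          let ?f = "\<lambda>\<alpha>. mps_coeff A \<alpha> * mpow h \<alpha>"
          have "?f summable_on {\<alpha>. q \<alpha> = n}"
            by (rule summable_on_subset_banach[OF has_sum_imp_summable[OF sum_h]]) simp
          then obtain s where s: "(?f has_sum s) {\<alpha>. q \<alpha> = n}" by (auto simp: summable_on_def)
          then have "((\<lambda>p. ?f (case p of (\<beta>, m) \<Rightarrow> \<beta> + axis w m)) has_sum s) (D \<times> UNIV)"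
            by (rule has_sum_reindex_bij_betw[OF bij, of ?f s, THEN iffD2])
          then have "((\<lambda>\<beta>. t ^ n * mpow u \<beta> * eval_fps (axis_coeffs w A \<beta>) c) has_sum s) D"
          proof (rule has_sum_SigmaD)
            fix \<beta> assume \<beta>: "\<beta> \<in> D"
            let ?g = "\<lambda>m. fps_nth (axis_coeffs w A \<beta>) m * c ^ m"
            have lt: "ereal (norm c) < fps_conv_radius (axis_coeffs w A \<beta>)"
              using c radius[of \<beta>] by (meson less_ereal.simps(1) less_le_trans)
            have "(?g has_sum eval_fps (axis_coeffs w A \<beta>) c) UNIV"
              unfolding eval_fps_def
              by (intro norm_summable_imp_has_sum norm_summable_fps summable_sums summable_fps lt)
            from has_sum_cmult_right[OF this, of "t ^ n * mpow u \<beta>"]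
            show "((\<lambda>m. ?f (case (\<beta>, m) of (\<beta>, m) \<Rightarrow> \<beta> + axis w m)) has_sum
                t ^ n * mpow u \<beta> * eval_fps (axis_coeffs w A \<beta>) c) UNIV"
              using \<beta> by (simp add: D_def mpow_h axis_coeffs_def mult_ac)
          qed
          then have "s = (\<Sum>\<beta>\<in>D. t ^ n * mpow u \<beta> * eval_fps (axis_coeffs w A \<beta>) c)"
            using has_sum_unique has_sum_finite[OF fin] by blast
          also have "\<dots> = (\<Sum>\<beta> | mdeg \<beta> = n. mps_coeff (restrict_at w A c) \<beta> * mpow u \<beta> * t ^ n)"
            by (rule sum.mono_neutral_cong_left) (auto simp: D_def restrict_at_def)
          also have "\<dots> = fps_nth (slice u (restrict_at w A c)) n * t ^ n"
            by (simp add: slice_nth sum_distrib_right)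
          finally show "(?f has_sum fps_nth (slice u (restrict_at w A c)) n * t ^ n) {\<alpha>. q \<alpha> = n}"
            using s by simp
        qed
        then show ?case unfolding h_def by (rule has_sum_imp_sums)
      qed
    qed
  qed
qed

section \<open>Splitting at a normal crossings point\<close>

text \<open>A product of \<open>card S\<close> series without constant term has order at least \<open>card S\<close>, and only the linear
  coefficients count in degree \<open>card S\<close>. The last branch is a tautology that makes this one rewrite rule
  for all \<open>n\<close>.\<close>

lemma fps_nth_prod_linear:
  fixes F :: "'i \<Rightarrow> 'a::comm_ring_1 fps"
  assumes "finite S" "\<And>i. i \<in> S \<Longrightarrow> fps_nth (F i) 0 = 0"
  shows "fps_nth ((\<Prod>i\<in>S. F i) * G) n =
    (if n < card S then 0 else if n = card S then (\<Prod>i\<in>S. fps_nth (F i) 1) * fps_nth G 0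
     else fps_nth ((\<Prod>i\<in>S. F i) * G) n)"
proof -
  have X: "F i = fps_X * fps_shift 1 (F i)" if "i \<in> S" for i
    using assms(2)[OF that] by (auto simp: fps_eq_iff fps_X_mult_nth)
  have "(\<Prod>i\<in>S. F i) = (\<Prod>i\<in>S. fps_X * fps_shift 1 (F i))"
    by (rule prod.cong[OF refl]) (rule X)
  then have "(\<Prod>i\<in>S. F i) = fps_X ^ card S * (\<Prod>i\<in>S. fps_shift 1 (F i))"
    by (simp add: prod.distrib)
  moreover have "fps_nth (\<Prod>i\<in>S. fps_shift 1 (F i)) 0 = (\<Prod>i\<in>S. fps_nth (F i) 1)"
    using assms(1) by (induction S rule: finite_induct) auto
  ultimately show ?thesis by (auto simp: mult.assoc fps_X_power_mult_nth)
qed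

lemma slice_var: "slice u (mps_var i) = fps_const (u $ i) * fps_X"
proof (rule fps_ext)
  fix n
  have "fps_nth (slice u (mps_var i)) n = (\<Sum>\<alpha> | mdeg \<alpha> = n. if \<alpha> = axis i 1 then u $ i else 0)"
    unfolding slice_nth by (rule sum.cong) (auto simp: mps_coeff_var)
  then show "fps_nth (slice u (mps_var i)) n = fps_nth (fps_const (u $ i) * fps_X) n"
    by (auto simp: fps_X_def)
qed

text \<open>The inclusion of the series in \<open>(w, x)\<close> into those in \<open>(w, x, z)\<close>, with \<open>None\<close> as index of \<open>z\<close>.\<close>

definition lift :: "('a::comm_ring_1, 'v::finite) mps \<Rightarrow> ('a, 'v option) mps" where
  "lift A = Abs_mps (\<lambda>\<alpha>. if \<alpha> $ None = 0 then mps_coeff A (\<chi> j. \<alpha> $ Some j) else 0)"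

definition extend_index :: "nat ^ 'v::finite \<Rightarrow> nat ^ 'v option" where
  "extend_index \<beta> = (\<chi> i. case i of None \<Rightarrow> 0 | Some j \<Rightarrow> \<beta> $ j)"

lemma extend_index_simps [simp]:
  "extend_index \<beta> $ None = 0" "extend_index \<beta> $ Some j = \<beta> $ j"
  "mdeg (extend_index \<beta>) = mdeg \<beta>" "mps_coeff (lift A) (extend_index \<beta>) = mps_coeff A \<beta>"
  by (simp_all add: extend_index_def mdeg_def sum_UNIV_option lift_def)

lemma sum_lift:
  fixes A :: "('a::comm_ring_1, 'v::finite) mps"
  assumes "\<And>\<beta>. \<beta> \<in> D \<longleftrightarrow> extend_index \<beta> \<in> E" "finite E"
  shows "(\<Sum>\<alpha>\<in>E. mps_coeff (lift A) \<alpha> * g \<alpha>) = (\<Sum>\<beta>\<in>D. mps_coeff A \<beta> * g (extend_index \<beta>))"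
proof -
  have ext: "\<alpha> = extend_index (\<chi> j. \<alpha> $ Some j)" if "\<alpha> $ None = 0" for \<alpha> :: "nat ^ 'v option"
    using that by (simp add: vec_eq_iff extend_index_def split: option.split)
  have inj: "inj_on extend_index D"
  proof (rule inj_onI)
    fix \<beta> \<beta>' :: "nat ^ 'v" assume "extend_index \<beta> = extend_index \<beta>'"
    then have "extend_index \<beta> $ Some j = extend_index \<beta>' $ Some j" for j by simp
    then show "\<beta> = \<beta>'" by (simp add: vec_eq_iff)
  qed
  have "(\<Sum>\<alpha>\<in>E. mps_coeff (lift A) \<alpha> * g \<alpha>) = (\<Sum>\<alpha>\<in>extend_index ` D. mps_coeff (lift A) \<alpha> * g \<alpha>)"
  proof (rule sum.mono_neutral_right[OF assms(2)])
    show "extend_index ` D \<subseteq> E" using assms(1) by auto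
    show "\<forall>\<alpha>\<in>E - extend_index ` D. mps_coeff (lift A) \<alpha> * g \<alpha> = 0"
    proof
      fix \<alpha> assume \<alpha>: "\<alpha> \<in> E - extend_index ` D"
      have "\<alpha> $ None \<noteq> 0"
      proof
        assume "\<alpha> $ None = 0"
        then have eq: "\<alpha> = extend_index (\<chi> j. \<alpha> $ Some j)" by (rule ext)
        with \<alpha> have "extend_index (\<chi> j. \<alpha> $ Some j) \<in> E" by simp
        then have "(\<chi> j. \<alpha> $ Some j) \<in> D" by (simp only: assms(1))
        then have "\<alpha> \<in> extend_index ` D" by (subst eq) (rule imageI)
        with \<alpha> show False by simp
      qed
      then show "mps_coeff (lift A) \<alpha> * g \<alpha> = 0" by (simp add: lift_def)
    qed
  qed
  also have "\<dots> = (\<Sum>\<beta>\<in>D. mps_coeff A \<beta> * g (extend_index \<beta>))"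
    by (simp add: sum.reindex[OF inj])
  finally show ?thesis .
qed

lemma slice_lift: "slice h (lift A) = slice (\<chi> j. h $ Some j) A"
proof (rule fps_ext)
  fix n
  have "mpow h (extend_index \<beta>) = mpow (\<chi> j. h $ Some j) \<beta>" for \<beta>
    by (simp add: mpow_def prod_UNIV_option)
  then show "fps_nth (slice h (lift A)) n = fps_nth (slice (\<chi> j. h $ Some j) A) n"
    unfolding slice_nth by (subst sum_lift[where D = "{\<beta>. mdeg \<beta> = n}"]) auto
qed

lemma graph_subst_lift:
  assumes "mps_coeff b 0 = 0" "\<And>\<beta>. \<beta> $ w \<noteq> 0 \<Longrightarrow> mps_coeff A \<beta> = 0"
  shows "mps_subst (lift A) (graph_map w b) = A"
proof (rule mps_eqI)
  fix \<gamma> :: "nat ^ 'b"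
  interpret mps_substitution "graph_map w b"
    by (rule mps_substitution_graph_map[OF assms(1)])
  have pw: "pw (extend_index \<beta>) = mps_monom \<beta>" if "\<beta> $ w = 0" for \<beta>
  proof -
    have "pw (extend_index \<beta>) = (\<Prod>j\<in>UNIV. mps_var j ^ (\<beta> $ j))"
      using that by (auto simp: pw_def prod_UNIV_option graph_map_def intro!: prod.cong)
    then show ?thesis by (simp only: prod_var_power)
  qed
  have "mps_coeff (mps_subst (lift A) (graph_map w b)) \<gamma>
      = (\<Sum>\<alpha> | mdeg \<alpha> \<le> mdeg \<gamma>. mps_coeff (lift A) \<alpha> * mps_coeff (pw \<alpha>) \<gamma>)"
    by (rule coeff_subst) simp
  also have "\<dots> = (\<Sum>\<beta> | mdeg \<beta> \<le> mdeg \<gamma>. mps_coeff A \<beta> * mps_coeff (pw (extend_index \<beta>)) \<gamma>)"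
    by (rule sum_lift) auto
  also have "\<dots> = (\<Sum>\<beta> | mdeg \<beta> \<le> mdeg \<gamma>. if \<beta> = \<gamma> then mps_coeff A \<gamma> else 0)"
  proof (rule sum.cong[OF refl])
    fix \<beta>
    show "mps_coeff A \<beta> * mps_coeff (pw (extend_index \<beta>)) \<gamma> = (if \<beta> = \<gamma> then mps_coeff A \<gamma> else 0)"
      using assms(2)[of \<beta>] by (cases "\<beta> $ w = 0") (auto simp: pw mps_coeff_monom)
  qed
  finally show "mps_coeff (mps_subst (lift A) (graph_map w b)) \<gamma> = mps_coeff A \<gamma>" by simp
qed

lemma axis_Some_decomp:
  fixes h :: "complex ^ 'v::finite option"
  shows "(\<chi> j. (axis (Some w) c + t *s h) $ Some j) = axis w c + t *s (\<chi> j. h $ Some j)"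
    "(axis (Some w) c + t *s h) $ None = t * h $ None"
  by (simp_all add: vec_eq_iff axis_def)

text \<open>What normal crossings at the point \<open>c\<close> of the \<open>w\<close>-axis are used for: the expansion \<open>F\<close> of \<open>f\<close> there is a
  multiple of the product of \<open>k\<close> of the coordinates \<open>y\<close>.\<close>

locale nc_point =
  fixes w :: "'v::finite" and k :: nat
    and a :: "nat \<Rightarrow> complex ^ 'v \<Rightarrow> complex" and f :: "complex ^ 'v option \<Rightarrow> complex"
    and c :: complex
    and F g :: "(complex, 'v option) mps" and y :: "'v option \<Rightarrow> (complex, 'v option) mps" and S
  assumes k: "CARD('v) = k"
    and f: "\<And>v. f v = (v $ None) ^ k + (\<Sum>i=1..k. a i (\<chi> j. v $ Some j) * (v $ None) ^ (k - i))"
    and F: "has_mps_expansion f (axis (Some w) c) F"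
    and y: "formal_coordinates y" and S: "card S = k" and F_eq: "F = (\<Prod>i\<in>S. y i) * g"
begin

lemma k_pos: "k > 0"
  using k by (simp add: card_gt_0_iff flip: k)

lemma y0: "mps_coeff (y i) 0 = 0"
  using y by (simp add: formal_coordinates_def)

lemma finite_S: "finite S"
  using S k_pos card_gt_0_iff by blast

lemma f_line: "(\<lambda>t. f (axis (Some w) c + t *s h)) = (\<lambda>t. (t * h $ None) ^ k +
    (\<Sum>i=1..k. a i (axis w c + t *s (\<chi> j. h $ Some j)) * (t * h $ None) ^ (k - i)))"
  by (simp only: f axis_Some_decomp)

lemma slice_F_nth:
  "fps_nth (slice h F) n = (if n < k then 0 else if n = k then
     (\<Prod>i\<in>S. form (linear_part (y i)) h) * mps_coeff g 0 else fps_nth (slice h F) n)"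
proof -
  have "fps_nth ((\<Prod>i\<in>S. slice h (y i)) * slice h g) n = (if n < card S then 0 else if n = card S
      then (\<Prod>i\<in>S. fps_nth (slice h (y i)) 1) * fps_nth (slice h g) 0
      else fps_nth ((\<Prod>i\<in>S. slice h (y i)) * slice h g) n)"
    by (rule fps_nth_prod_linear) (use finite_S y0 in auto)
  then show ?thesis unfolding F_eq slice_mult slice_prod S slice_nth_1 slice_nth_0 .
qed

lemma F_line: "(\<lambda>t. f (axis (Some w) c + t *s h)) has_fps_expansion slice h F"
  by (rule slice_has_fps_expansion[OF F])

text \<open>On the \<open>z\<close>-axis through the point, \<open>f\<close> is the polynomial in \<open>z\<close> with coefficients \<open>a i\<close>, and it has
  order at least \<open>k\<close> because \<open>F\<close> does.\<close>

lemma vanishes: "i \<in> {1..k} \<Longrightarrow> a i (axis w c) = 0"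
proof -
  assume i: "i \<in> {1..k}"
  let ?h = "axis None 1 :: complex ^ 'v option"
  have h: "(\<chi> j. ?h $ Some j) = 0" "?h $ None = 1" by (simp_all add: vec_eq_iff axis_def)
  let ?G = "fps_X ^ k + (\<Sum>i=1..k. fps_const (a i (axis w c)) * fps_X ^ (k - i)) :: complex fps"
  have "(\<lambda>t. t ^ k + (\<Sum>i=1..k. a i (axis w c) * t ^ (k - i))) has_fps_expansion ?G"
    by (intro fps_expansion_intros)
  moreover have "(\<lambda>t. t ^ k + (\<Sum>i=1..k. a i (axis w c) * t ^ (k - i))) has_fps_expansion slice ?h F"
    using F_line[of ?h] unfolding f_line h by simp
  ultimately have "slice ?h F = ?G" by (intro fps_expansion_unique_complex)
  moreover have "fps_nth (slice ?h F) (k - i) = 0" using i by (subst slice_F_nth) auto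
  ultimately have "0 = fps_nth ?G (k - i)" by simp
  also have "\<dots> = (\<Sum>j=1..k. a j (axis w c) * (if k - i = k - j then 1 else 0))"
    using i by (auto simp: fps_sum_nth)
  also have "\<dots> = (\<Sum>j=1..k. if j = i then a i (axis w c) else 0)"
    by (rule sum.cong) (use i in auto)
  also have "\<dots> = a i (axis w c)" using i by simp
  finally show ?thesis by simp
qed

context
  assumes van: "\<forall>\<^sub>F c' in nhds c. \<forall>i\<in>{1..k}. a i (axis w c') = 0"
begin

text \<open>Since \<open>f = z ^ k\<close> on the \<open>(w, z)\<close>-plane, the homogeneous part of degree \<open>k\<close> of \<open>F\<close> restricted to that
  plane is \<open>z ^ k\<close>; it is the product of the linear parts of the \<open>y i\<close>, up to the constant term of \<open>g\<close>.\<close>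

lemma linear_parts_plane:
  "(\<Prod>i\<in>S. linear_part (y i) $ None * z + linear_part (y i) $ Some w * d) * mps_coeff g 0 = z ^ k"
proof -
  let ?h = "axis None z + axis (Some w) d :: complex ^ 'v option"
  have h: "(\<chi> j. ?h $ Some j) = axis w d" "?h $ None = z" by (simp_all add: vec_eq_iff axis_def)
  have line: "axis w c + t *s axis w d = axis w (c + t * d)" for t
    by (simp add: vec_eq_iff axis_def)
  have "filterlim (\<lambda>t. c + t * d) (nhds (c + 0 * d)) (nhds 0)"
    by (intro tendsto_intros filterlim_ident)
  then have "\<forall>\<^sub>F t in nhds 0. \<forall>i\<in>{1..k}. a i (axis w (c + t * d)) = 0"
    by (intro eventually_compose_filterlim[OF van]) simp
  then have "\<forall>\<^sub>F t in nhds 0. f (axis (Some w) c + t *s ?h) = z ^ k * t ^ k"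
  proof eventually_elim
    case (elim t)
    then show ?case using fun_cong[OF f_line[of ?h], of t] unfolding h line by (simp add: power_mult_distrib)
  qed
  moreover have "\<forall>\<^sub>F t in nhds 0. eval_fps (slice ?h F) t = f (axis (Some w) c + t *s ?h)"
    using F_line[of ?h] by (simp add: has_fps_expansion_def)
  ultimately have "\<forall>\<^sub>F t in nhds 0. eval_fps (slice ?h F) t = z ^ k * t ^ k"
    by eventually_elim simp
  then have "(\<lambda>t. z ^ k * t ^ k) has_fps_expansion slice ?h F"
    using F_line[of ?h] by (simp add: has_fps_expansion_def)
  moreover have "(\<lambda>t. z ^ k * t ^ k) has_fps_expansion fps_const (z ^ k) * fps_X ^ k"
    by (intro fps_expansion_intros)
  ultimately have "slice ?h F = fps_const (z ^ k) * fps_X ^ k"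
    by (intro fps_expansion_unique_complex)
  then have "fps_nth (slice ?h F) k = z ^ k" by simp
  then show ?thesis by (subst (asm) slice_F_nth) simp
qed

lemma z_coeff: "i \<in> S \<Longrightarrow> linear_part (y i) $ None \<noteq> 0"
proof -
  assume "i \<in> S"
  have eq: "(\<Prod>i\<in>S. linear_part (y i) $ None) * mps_coeff g 0 = 1"
    using linear_parts_plane[of 1 0] by simp
  show ?thesis
  proof
    assume "linear_part (y i) $ None = 0"
    then have "(\<Prod>i\<in>S. linear_part (y i) $ None) = 0"
      using \<open>i \<in> S\<close> finite_S by (intro prod_zero) auto
    with eq show False by simp
  qed
qed

text \<open>A nonzero \<open>w\<close>-coefficient would make the product of the linear parts vanish at a point of the plane with
  \<open>w = 1\<close> and \<open>z \<noteq> 0\<close>.\<close>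

lemma w_coeff: "i \<in> S \<Longrightarrow> linear_part (y i) $ Some w = 0"
proof -
  assume i: "i \<in> S"
  define z where "z = - linear_part (y i) $ Some w / linear_part (y i) $ None"
  have "finite S" using S k_pos card_gt_0_iff by blast
  moreover have "linear_part (y i) $ None * z + linear_part (y i) $ Some w * 1 = 0"
    using z_coeff[OF i] by (simp add: z_def)
  ultimately have 0: "(\<Prod>i\<in>S. linear_part (y i) $ None * z + linear_part (y i) $ Some w * 1) = 0"
    using i by (intro prod_zero) auto
  have "z ^ k = 0" using linear_parts_plane[of z 1] unfolding 0 by simp
  then show ?thesis using z_coeff[OF i] by (simp add: z_def)
qed

text \<open>Coordinates have linearly independent linear parts. After scaling to \<open>z\<close>-coefficient 1 two of them
  therefore still differ, which makes the roots distinct to first order.\<close>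

lemma rows_not_proportional:
  assumes ij: "i \<in> S" "j \<in> S" "i \<noteq> j"
    and eq: "\<And>l. linear_part (y i) $ l * linear_part (y j) $ None = linear_part (y j) $ l * linear_part (y i) $ None"
  shows False
proof -
  define M where "M = (\<chi> i j. mps_coeff (y i) (axis j 1))"
  have M: "M $ p $ q = linear_part (y p) $ q" for p q by (simp add: M_def linear_part_def)
  have "det M \<noteq> 0" using y by (simp add: formal_coordinates_def M_def)
  then have "\<exists>B. M ** B = mat 1" by (metis invertible_det_nz invertible_def)
  then have indep: "\<And>co. (\<Sum>p\<in>UNIV. co p *s row p M) = 0 \<Longrightarrow> \<forall>p. co p = 0"
    unfolding matrix_right_invertible_independent_rows by blast
  define co where "co p = (if p = i then linear_part (y j) $ None else if p = j then - linear_part (y i) $ None else 0)" for p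
  have "(\<Sum>p\<in>UNIV. co p *s row p M) $ l = 0" for l
  proof -
    have "(\<Sum>p\<in>UNIV. co p *s row p M) $ l = (\<Sum>p\<in>UNIV. co p * linear_part (y p) $ l)"
      by (simp add: row_def M)
    also have "\<dots> = (\<Sum>p\<in>{i, j}. co p * linear_part (y p) $ l)"
      by (rule sum.mono_neutral_right) (auto simp: co_def)
    also have "\<dots> = 0" using ij eq[of l] by (simp add: co_def mult.commute)
    finally show ?thesis .
  qed
  then have "\<forall>p. co p = 0" by (intro indep) (simp add: vec_eq_iff)
  then show False using z_coeff[OF ij(2)] by (metis co_def)
qed

text \<open>Both \<open>F\<close> and the polynomial with coefficients \<open>A i\<close> describe \<open>f\<close> on the hyperplane \<open>w = c\<close>. Thus \<open>z = b\<close> is a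
  root of the polynomial whenever it solves one of the equations \<open>y i = 0\<close> on that hyperplane. The linear part
  of such a \<open>b\<close> is minus the \<open>x\<close>-part of the linear part of \<open>y i\<close>, divided by its \<open>z\<close>-coefficient.\<close>

lemma splits:
  fixes A :: "nat \<Rightarrow> (complex, 'v) mps"
  assumes A_free: "\<And>i \<beta>. i \<in> {1..k} \<Longrightarrow> \<beta> $ w \<noteq> 0 \<Longrightarrow> mps_coeff (A i) \<beta> = 0"
    and A: "\<And>i u. i \<in> {1..k} \<Longrightarrow> u $ w = 0 \<Longrightarrow>
      (\<lambda>t. a i (axis w c + t *s u)) has_fps_expansion slice u (A i)"
  obtains R where "finite R" "card R = k" "inj_on linear_part R" "\<And>b. b \<in> R \<Longrightarrow> mps_coeff b 0 = 0"
    "weierstrass k A = (\<Prod>b\<in>R. [:- b, 1:])"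
proof -
  (* the polynomial as a series in (w, x, z) *)
  define Gc where "Gc = mps_var None ^ k + (\<Sum>i=1..k. lift (A i) * mps_var None ^ (k - i))"
  (* the terms free of w *)
  define restr :: "(complex, 'v option) mps \<Rightarrow> (complex, 'v option) mps" where
    "restr G = Abs_mps (\<lambda>\<alpha>. if \<alpha> $ Some w = 0 then mps_coeff G \<alpha> else 0)" for G
  have slice_restr: "slice h (restr G) = slice (h - axis (Some w) (h $ Some w)) G" for h G
  proof -
    have "(if \<alpha> $ Some w = 0 then mpow h \<alpha> else 0) = mpow (h - axis (Some w) (h $ Some w)) \<alpha>" for \<alpha>
    proof (cases "\<alpha> $ Some w = 0")
      case True
      then show ?thesis unfolding mpow_def by (auto simp: axis_def intro!: prod.cong)
    next
      case False
      then have "(h - axis (Some w) (h $ Some w)) $ Some w ^ \<alpha> $ Some w = 0" by (simp add: axis_def)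
      then have "mpow (h - axis (Some w) (h $ Some w)) \<alpha> = 0"
        unfolding mpow_def by (intro prod_zero bexI[of _ "Some w"]) simp_all
      with False show ?thesis by simp
    qed
    note M = this
    have "mps_coeff (restr G) \<alpha> * mpow h \<alpha> = mps_coeff G \<alpha> * mpow (h - axis (Some w) (h $ Some w)) \<alpha>" for \<alpha>
      unfolding M[symmetric] restr_def mps_coeff_Abs by simp
    then show ?thesis by (simp add: fps_eq_iff slice_nth)
  qed
  have slice_eq: "slice h F = slice h Gc" if h: "h $ Some w = 0" for h
  proof -
    let ?u = "\<chi> j. h $ Some j" and ?z = "h $ None"
    have sG: "slice h Gc = (fps_const ?z * fps_X) ^ k +
        (\<Sum>i=1..k. slice ?u (A i) * (fps_const ?z * fps_X) ^ (k - i))"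
      by (simp add: Gc_def slice_var slice_lift)
    have X: "(\<lambda>t. t * ?z) has_fps_expansion fps_const ?z * fps_X"
      using has_fps_expansion_cmult_left[OF has_fps_expansion_fps_X, of ?z] by (simp add: mult.commute)
    have Xn: "(\<lambda>t. (t * ?z) ^ n) has_fps_expansion (fps_const ?z * fps_X) ^ n" for n
      by (induction n) (auto intro: has_fps_expansion_mult X)
    have G: "(\<lambda>t. (t * ?z) ^ k + (\<Sum>i=1..k. a i (axis w c + t *s ?u) * (t * ?z) ^ (k - i))) has_fps_expansion slice h Gc"
      unfolding sG
      by (intro has_fps_expansion_add has_fps_expansion_sum has_fps_expansion_mult Xn A) (use h in auto)
    show ?thesis by (rule fps_expansion_unique_complex[OF F_line[of h, unfolded f_line] G])
  qed
  have restr_eq: "restr F = restr Gc"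
    by (rule mps_eqI_generic_slices[of "{}"]) (auto simp: slice_restr intro!: slice_eq)
  have poly_eq: "poly (weierstrass k A) b = mps_subst F (graph_map w b)" if b: "mps_coeff b 0 = 0" for b
  proof -
    interpret mps_substitution "graph_map w b" by (rule mps_substitution_graph_map[OF b])
    have pw0: "pw \<alpha> = 0" if "\<alpha> $ Some w \<noteq> 0" for \<alpha>
      unfolding pw_def using that by (intro prod_zero bexI[of _ "Some w"]) (simp_all add: graph_map_def power_0_left)
    have subst_restr: "mps_subst (restr G) (graph_map w b) = mps_subst G (graph_map w b)" for G
      by (rule mps_eqI) (auto simp: coeff_subst[OF order_refl] restr_def pw0 intro!: sum.cong)
    have "mps_subst F (graph_map w b) = mps_subst (restr F) (graph_map w b)"
      by (rule subst_restr[symmetric])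
    also have "\<dots> = mps_subst Gc (graph_map w b)"
      unfolding restr_eq by (rule subst_restr)
    also have "\<dots> = b ^ k + (\<Sum>i=1..k. A i * b ^ (k - i))"
      unfolding Gc_def subst_add subst_sum subst_mult subst_power subst_var
      using A_free b by (simp add: graph_subst_lift graph_map_def)
    finally show ?thesis by (simp add: poly_weierstrass)
  qed
  have "\<forall>i\<in>S. \<exists>b. mps_coeff b 0 = 0 \<and> mps_subst (y i) (graph_map w b) = 0"
  proof
    fix i assume "i \<in> S"
    then have "mps_coeff (y i) (axis None 1) \<noteq> 0" using z_coeff[of i] by (simp add: linear_part_def)
    from implicit_function[OF y0 this, of w]
    show "\<exists>b. mps_coeff b 0 = 0 \<and> mps_subst (y i) (graph_map w b) = 0" by blast
  qed
  from bchoice[OF this] obtain b where b0: "\<And>i. i \<in> S \<Longrightarrow> mps_coeff (b i) 0 = 0"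
    and b: "\<And>i. i \<in> S \<Longrightarrow> mps_subst (y i) (graph_map w (b i)) = 0" by blast
  have lin: "linear_part (y i) $ None * linear_part (b i) $ j = - linear_part (y i) $ Some j" if i: "i \<in> S" for i j
  proof -
    interpret mps_substitution "graph_map w (b i)" by (rule mps_substitution_graph_map[OF b0[OF i]])
    have "0 = (\<Sum>p\<in>UNIV. mps_coeff (y i) (axis p 1) * mps_coeff (graph_map w (b i) p) (axis j 1))"
      unfolding linear_coeff_subst[symmetric] b[OF i] by simp
    also have "\<dots> = linear_part (y i) $ None * linear_part (b i) $ j +
        (\<Sum>p\<in>UNIV. linear_part (y i) $ Some p * mps_coeff (graph_map w (b i) (Some p)) (axis j 1))"
      unfolding sum_UNIV_option by (simp add: linear_part_def graph_map_def)
    also have "(\<Sum>p\<in>UNIV. linear_part (y i) $ Some p * mps_coeff (graph_map w (b i) (Some p)) (axis j 1))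
        = (\<Sum>p\<in>UNIV. if p = j then linear_part (y i) $ Some j else 0)"
      using w_coeff[OF i]
      by (intro sum.cong) (auto simp: graph_map_def mps_coeff_var axis_eq_axis)
    finally show ?thesis by (simp add: eq_neg_iff_add_eq_0)
  qed
  have inj: "i = j" if ij: "i \<in> S" "j \<in> S" and eq: "linear_part (b i) = linear_part (b j)" for i j
  proof (rule ccontr)
    assume "i \<noteq> j"
    then show False
    proof (rule rows_not_proportional[OF ij])
      fix l
      show "linear_part (y i) $ l * linear_part (y j) $ None = linear_part (y j) $ l * linear_part (y i) $ None"
      proof (cases l)
        case (Some p)
        have "linear_part (y i) $ l = - (linear_part (y i) $ None * linear_part (b j) $ p)"
          "linear_part (y j) $ l = - (linear_part (y j) $ None * linear_part (b j) $ p)"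
          using lin[OF ij(1), of p] lin[OF ij(2), of p] eq Some by auto
        then show ?thesis by simp
      qed simp
    qed
  qed
  have fin: "finite S" using S k_pos card_gt_0_iff by blast
  define R where "R = b ` S"
  have R: "finite R" "card R = k" "inj_on linear_part R"
  proof -
    show "finite R" using fin by (simp add: R_def)
    have "inj_on b S" by (rule inj_onI) (rule inj, simp_all)
    then show "card R = k" using S by (simp add: R_def card_image)
    show "inj_on linear_part R"
    proof (rule inj_onI)
      fix p q assume "p \<in> R" "q \<in> R" "linear_part p = linear_part q"
      then show "p = q" unfolding R_def using inj by blast
    qed
  qed
  moreover have "mps_coeff b' 0 = 0" if "b' \<in> R" for b' using that b0 by (auto simp: R_def)
  moreover have "weierstrass k A = (\<Prod>b\<in>R. [:- b, 1:])"
  proof (rule monic_poly_factorization)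
    show "degree (weierstrass k A) = card R" "lead_coeff (weierstrass k A) = 1"
      by (simp_all add: degree_weierstrass R coeff_weierstrass)
    fix b' assume "b' \<in> R"
    then obtain i where i: "i \<in> S" "b' = b i" by (auto simp: R_def)
    interpret mps_substitution "graph_map w (b i)" by (rule mps_substitution_graph_map[OF b0[OF i(1)]])
    have "mps_subst F (graph_map w (b i)) = 0"
    proof -
      have "(\<Prod>j\<in>S. mps_subst (y j) (graph_map w (b i))) = 0"
        by (rule prod_zero[OF finite_S]) (use i b in blast)
      then show ?thesis by (simp add: F_eq subst_mult subst_prod)
    qed
    then show "poly (weierstrass k A) b' = 0" using poly_eq[OF b0[OF i(1)]] i by simp
  qed (use R in auto)
  ultimately show ?thesis by (rule that)
qed

end

end

lemma nc_at_imp_nc_point: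
  fixes f :: "complex ^ 'v::finite option \<Rightarrow> complex"
  assumes "CARD('v) = k"
    and "\<And>v. f v = (v $ None) ^ k + (\<Sum>i=1..k. a i (\<chi> j. v $ Some j) * (v $ None) ^ (k - i))"
    and "nc_at k f (axis (Some w) c)"
  obtains F g y S where "nc_point w k a f c F g y S"
proof -
  obtain F y S where *: "has_mps_expansion f (axis (Some w) c) F" "formal_coordinates y" "card S = k"
      "range (\<lambda>g. F * g) = range (\<lambda>g. (\<Prod>i\<in>S. y i) * g)"
    using assms(3) by (auto simp: nc_at_def)
  have "F * 1 \<in> range (\<lambda>g. F * g)" by blast
  then obtain g where "F = (\<Prod>i\<in>S. y i) * g" using *(4) by auto
  with * assms(1,2) have "nc_point w k a f c F g y S" by unfold_locales
  then show ?thesis by (rule that)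
qed

section \<open>Puiseux parametrization of the linear parts\<close>

text \<open>A family \<open>R c\<close> of sets of \<open>k\<close> vectors, for \<open>c\<close> in a punctured disc, whose values \<open>form l u\<close> in every
  direction \<open>u\<close> are the roots of a polynomial that depends holomorphically on \<open>c\<close> in the whole disc. The
  vectors are handled through their values in general directions, where these are simple roots.\<close>

locale root_family =
  fixes k :: nat and p :: "nat \<Rightarrow> complex \<Rightarrow> complex ^ 'v::finite \<Rightarrow> complex"
    and R :: "complex \<Rightarrow> (complex ^ 'v) set" and r M :: real
  assumes r: "r > 0" and card_UNIV: "CARD('v) = k"
    and p: "\<And>i u. i \<in> {1..k} \<Longrightarrow> (\<lambda>c. p i c u) holomorphic_on ball 0 r"
    and R: "\<And>c. c \<in> ball 0 r - {0} \<Longrightarrow> finite (R c)" "\<And>c. c \<in> ball 0 r - {0} \<Longrightarrow> card (R c) = k"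
    and roots: "\<And>c u z. c \<in> ball 0 r - {0} \<Longrightarrow>
      z ^ k + (\<Sum>i=1..k. p i c u * z ^ (k - i)) = (\<Prod>l\<in>R c. z - form l u)"
    and bound: "\<And>c l. c \<in> ball 0 r - {0} \<Longrightarrow> l \<in> R c \<Longrightarrow> norm l \<le> M"
begin

abbreviation "D \<equiv> ball (0::complex) r - {0}"

lemma open_D: "open D" by (intro open_Diff) auto

lemma enumerate_roots:
  assumes "c \<in> D" obtains e :: "'v \<Rightarrow> complex ^ 'v" where "bij_betw e UNIV (R c)"
  using R[OF assms] card_UNIV by (metis finite_same_card_bij finite_class.finite_UNIV)

lemma isCont_P:
  assumes "c \<in> D" shows "isCont (\<lambda>c. z ^ k + (\<Sum>i=1..k. p i c u * z ^ (k - i))) c"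
proof -
  have "isCont (\<lambda>c. p i c u) c" if "i \<in> {1..k}" for i
    using p[OF that, of u, THEN holomorphic_on_imp_continuous_on] assms
    by (auto simp: continuous_on_eq_continuous_at)
  then show ?thesis by (intro continuous_intros) auto
qed

lemma tendsto_form [tendsto_intros]:
  fixes l :: "'a \<Rightarrow> complex ^ 'v"
  assumes "(l \<longlongrightarrow> l') F" shows "((\<lambda>x. form (l x) u) \<longlongrightarrow> form l' u) F"
  unfolding form_def by (intro tendsto_intros assms)

text \<open>If the vectors over \<open>f n\<close> stayed away from \<open>l\<close>, a subsequence of them, suitably numbered, would
  converge to vectors \<open>L $ i\<close> other than \<open>l\<close>. In a direction \<open>u\<close> that separates \<open>l\<close> from all the \<open>L $ i\<close>,
  the limit of the polynomials then does not vanish at \<open>form l u\<close>, although \<open>l\<close> is in \<open>R c1\<close>.\<close>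

lemma roots_continuous_aux:
  assumes c1: "c1 \<in> D" and l: "l \<in> R c1" and "\<epsilon> > 0" and f: "f \<longlonglongrightarrow> c1"
    and f': "\<And>n. f n \<in> D \<and> (\<forall>l'\<in>R (f n). \<epsilon> \<le> dist l' l)"
  shows False
proof -
  have "\<exists>e :: 'v \<Rightarrow> complex ^ 'v. bij_betw e UNIV (R (f n))" for n
    using enumerate_roots[of "f n"] f'[of n] by metis
  then obtain e :: "nat \<Rightarrow> 'v \<Rightarrow> complex ^ 'v" where e: "\<And>n. bij_betw (e n) UNIV (R (f n))" by metis
  define E where "E n = (\<chi> i. e n i)" for n
  have "norm (E n) \<le> (\<Sum>i\<in>(UNIV :: 'v set). M)" for n
  proof -
    have "norm (E n) \<le> (\<Sum>i\<in>UNIV. norm (E n $ i))"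
      unfolding norm_vec_def[of "E n"] by (rule L2_set_le_sum) simp
    also have "\<dots> \<le> (\<Sum>i\<in>(UNIV :: 'v set). M)"
      using bound[of "f n"] f'[of n] e[of n] by (intro sum_mono) (auto simp: E_def bij_betw_def)
    finally show ?thesis .
  qed
  then have "bounded (range E)" by (auto intro: boundedI)
  then obtain L \<sigma> where \<sigma>: "strict_mono \<sigma>" and L: "(E \<circ> \<sigma>) \<longlonglongrightarrow> L"
    using bounded_imp_convergent_subsequence by blast
  have f\<sigma>: "(f \<circ> \<sigma>) \<longlonglongrightarrow> c1" by (rule LIMSEQ_subseq_LIMSEQ[OF f \<sigma>])
  have lim_i: "(\<lambda>n. e (\<sigma> n) i) \<longlonglongrightarrow> L $ i" for i
    using tendsto_vec_nth[OF L, of i] by (simp add: E_def o_def)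
  have prod_eq: "(\<Prod>i\<in>UNIV. z - form (L $ i) u) = (\<Prod>l\<in>R c1. z - form l u)" for z u
  proof (rule LIMSEQ_unique)
    show "(\<lambda>n. \<Prod>i\<in>UNIV. z - form (e (\<sigma> n) i) u) \<longlonglongrightarrow> (\<Prod>i\<in>UNIV. z - form (L $ i) u)"
      by (intro tendsto_intros lim_i)
    have "(\<Prod>i\<in>UNIV. z - form (e (\<sigma> n) i) u) = z ^ k + (\<Sum>i=1..k. p i (f (\<sigma> n)) u * z ^ (k - i))" for n
      using roots[of "f (\<sigma> n)" z u] f'[of "\<sigma> n"] prod.reindex_bij_betw[OF e[of "\<sigma> n"], of "\<lambda>l. z - form l u"]
      by simp
    moreover have "(\<lambda>n. z ^ k + (\<Sum>i=1..k. p i ((f \<circ> \<sigma>) n) u * z ^ (k - i))) \<longlonglongrightarrow> (\<Prod>l\<in>R c1. z - form l u)"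
      unfolding roots[OF c1, symmetric] by (rule isCont_tendsto_compose[OF isCont_P[OF c1] f\<sigma>])
    ultimately show "(\<lambda>n. \<Prod>i\<in>UNIV. z - form (e (\<sigma> n) i) u) \<longlonglongrightarrow> (\<Prod>l\<in>R c1. z - form l u)"
      by simp
  qed
  obtain u where u: "\<And>m. m \<in> range (\<lambda>i. l - L $ i) - {0} \<Longrightarrow> form m u \<noteq> 0"
    by (rule generic_direction[of "range (\<lambda>i. l - L $ i) - {0}"]) auto
  have "(\<Prod>l'\<in>R c1. form l u - form l' u) = 0"
    using R(1)[OF c1] l by (intro prod_zero) auto
  then have "(\<Prod>i\<in>UNIV. form l u - form (L $ i) u) = 0" by (simp add: prod_eq)
  then obtain i where "form (l - L $ i) u = 0" by auto
  then have "L $ i = l" using u[of "l - L $ i"] by auto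
  then have "\<forall>\<^sub>F n in sequentially. dist (e (\<sigma> n) i) l < \<epsilon>"
    using tendstoD[OF lim_i \<open>\<epsilon> > 0\<close>, of i] by simp
  then obtain n where "dist (e (\<sigma> n) i) l < \<epsilon>" by (auto simp: eventually_sequentially)
  moreover have "e (\<sigma> n) i \<in> R (f (\<sigma> n))" using e[of "\<sigma> n"] by (auto simp: bij_betw_def)
  ultimately show False using f'[of "\<sigma> n"] by (meson not_le)
qed

lemma roots_continuous:
  assumes c1: "c1 \<in> D" and l: "l \<in> R c1" and \<epsilon>: "\<epsilon> > 0"
  shows "\<forall>\<^sub>F c in nhds c1. c \<in> D \<longrightarrow> (\<exists>l'\<in>R c. dist l' l < \<epsilon>)"
proof -
  let ?P = "\<lambda>c. c \<in> D \<longrightarrow> (\<exists>l'\<in>R c. dist l' l < \<epsilon>)"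
  have "eventually ?P (inf (nhds c1) (principal UNIV))"
  proof (rule sequentially_imp_eventually_nhds_within, intro allI impI)
    fix f :: "nat \<Rightarrow> complex" assume "(\<forall>n. f n \<in> UNIV) \<and> f \<longlonglongrightarrow> c1"
    then have f: "f \<longlonglongrightarrow> c1" by simp
    show "\<forall>\<^sub>F n in sequentially. ?P (f n)"
    proof (rule ccontr)
      assume "\<not> ?thesis"
      from not_eventually_sequentiallyD[OF this] obtain s :: "nat \<Rightarrow> nat" where s: "strict_mono s"
        "\<And>n. \<not> ?P (f (s n))" by blast
      then have "f (s n) \<in> D \<and> (\<forall>l'\<in>R (f (s n)). \<epsilon> \<le> dist l' l)" for n by (meson not_le)
      then show False
        using roots_continuous_aux[OF c1 l \<epsilon> LIMSEQ_subseq_LIMSEQ[OF f s(1)]] by simp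
    qed
  qed
  then show ?thesis by simp
qed

text \<open>With \<open>\<epsilon>\<close> at most half the least distance between the vectors over \<open>c1\<close>, continuity gives a vector
  over \<open>c\<close> within \<open>\<epsilon>\<close> of each of them. There are \<open>k\<close> on both sides, so this is a bijection.\<close>

lemma local_root_labels:
  assumes c1: "c1 \<in> D"
  obtains T \<epsilon> where "open T" "c1 \<in> T" "T \<subseteq> D" "\<epsilon> > 0"
    "\<And>c l. c \<in> T \<Longrightarrow> l \<in> R c1 \<Longrightarrow> \<exists>!l'. l' \<in> R c \<and> dist l' l < \<epsilon>"
    "\<And>c l'. c \<in> T \<Longrightarrow> l' \<in> R c \<Longrightarrow> \<exists>!l. l \<in> R c1 \<and> dist l' l < \<epsilon>"
proof -
  define ds where "ds = insert 1 ((\<lambda>(l, l'). dist l l') ` {(l, l'). l \<in> R c1 \<and> l' \<in> R c1 \<and> l \<noteq> l'})"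
  have "finite {(l, l'). l \<in> R c1 \<and> l' \<in> R c1 \<and> l \<noteq> l'}"
    by (rule finite_subset[of _ "R c1 \<times> R c1"]) (use R(1)[OF c1] in auto)
  then have fin: "finite ds" by (simp add: ds_def)
  define \<epsilon> where "\<epsilon> = Min ds / 2"
  have "Min ds \<in> ds" using fin by (intro Min_in) (auto simp: ds_def)
  then have \<epsilon>: "\<epsilon> > 0" by (auto simp: ds_def \<epsilon>_def)
  have sep: "l = l'" if "l \<in> R c1" "l' \<in> R c1" "dist l l' < 2 * \<epsilon>" for l l'
  proof (rule ccontr)
    assume "l \<noteq> l'"
    then have "dist l l' \<in> ds" using that by (auto simp: ds_def)
    then have "Min ds \<le> dist l l'" using fin by simp
    with that show False by (simp add: \<epsilon>_def)
  qed
  have sep2: "l = l2" if "l \<in> R c1" "l2 \<in> R c1" "dist l' l < \<epsilon>" "dist l' l2 < \<epsilon>" for l l2 l'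
    using that sep[of l l2] dist_triangle2[of l l2 l'] by (auto simp: dist_commute)
  have "\<forall>\<^sub>F c in nhds c1. \<forall>l\<in>R c1. c \<in> D \<longrightarrow> (\<exists>l'\<in>R c. dist l' l < \<epsilon>)"
    by (intro eventually_ball_finite R(1)[OF c1] ballI roots_continuous c1 \<epsilon>)
  then obtain T0 where T0: "open T0" "c1 \<in> T0"
      "\<And>c l. c \<in> T0 \<Longrightarrow> l \<in> R c1 \<Longrightarrow> c \<in> D \<Longrightarrow> \<exists>l'\<in>R c. dist l' l < \<epsilon>"
    unfolding eventually_nhds by blast
  have ex: "(\<forall>l\<in>R c1. \<exists>!l'. l' \<in> R c \<and> dist l' l < \<epsilon>) \<and> (\<forall>l'\<in>R c. \<exists>!l. l \<in> R c1 \<and> dist l' l < \<epsilon>)"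
    if c: "c \<in> T0 \<inter> D" for c
  proof -
    have "\<forall>l\<in>R c1. \<exists>l'. l' \<in> R c \<and> dist l' l < \<epsilon>" using T0(3) c by blast
    from bchoice[OF this] obtain \<phi> where \<phi>: "\<And>l. l \<in> R c1 \<Longrightarrow> \<phi> l \<in> R c \<and> dist (\<phi> l) l < \<epsilon>" by blast
    have inj: "inj_on \<phi> (R c1)"
    proof (rule inj_onI)
      fix l l2 assume "l \<in> R c1" "l2 \<in> R c1" "\<phi> l = \<phi> l2"
      then show "l = l2" using sep2[of l l2 "\<phi> l"] \<phi>[of l] \<phi>[of l2] by simp
    qed
    have surj: "\<phi> ` R c1 = R c"
      using c c1 \<phi> R by (intro card_subset_eq) (auto simp: card_image[OF inj])
    show ?thesis
    proof (intro conjI ballI)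
      fix l assume l: "l \<in> R c1"
      show "\<exists>!l'. l' \<in> R c \<and> dist l' l < \<epsilon>"
      proof (rule ex1I[of _ "\<phi> l"])
        fix l' assume "l' \<in> R c \<and> dist l' l < \<epsilon>"
        moreover from this obtain l2 where "l2 \<in> R c1" "l' = \<phi> l2" using surj by blast
        ultimately show "l' = \<phi> l" using sep2[of l l2 l'] \<phi>[of l2] l by simp
      qed (use \<phi> l in auto)
    next
      fix l' assume "l' \<in> R c"
      then obtain l2 where l2: "l2 \<in> R c1" "l' = \<phi> l2" using surj by blast
      show "\<exists>!l. l \<in> R c1 \<and> dist l' l < \<epsilon>"
        by (rule ex1I[of _ l2]) (use l2 \<phi>[of l2] sep2[of _ l2 l'] in auto)
    qed
  qed
  show ?thesis
  proof (rule that[of "T0 \<inter> D" \<epsilon>])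
    show "open (T0 \<inter> D)" using T0 open_D by (intro open_Int) auto
  qed (use ex T0 c1 \<epsilon> in auto)
qed

abbreviation "E \<equiv> {(c, l). c \<in> D \<and> l \<in> R c}"

lemma k_pos: "k > 0" using card_UNIV by (metis zero_less_card_finite)

text \<open>The sheets over a neighbourhood of \<open>c1\<close> are labelled by the vectors over \<open>c1\<close>.\<close>

lemma covering_roots: "covering_space E fst D"
proof
  show "continuous_on E fst" by (intro continuous_intros)
  have "R c \<noteq> {}" if "c \<in> D" for c using R[OF that] k_pos by auto
  then show "fst ` E = D" by force
next
  fix c1 assume c1: "c1 \<in> D"
  show "\<exists>T. c1 \<in> T \<and> openin (top_of_set D) T \<and>
      (\<exists>v. \<Union> v = E \<inter> fst -` T \<and> (\<forall>u\<in>v. openin (top_of_set E) u) \<and>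
        pairwise disjnt v \<and> (\<forall>u\<in>v. \<exists>q. homeomorphism u T fst q))"
  proof (rule local_root_labels[OF c1])
  fix T \<epsilon> assume T: "open T" "c1 \<in> T" "T \<subseteq> D" "\<epsilon> > 0"
    and u1: "\<And>c l. c \<in> T \<Longrightarrow> l \<in> R c1 \<Longrightarrow> \<exists>!l'. l' \<in> R c \<and> dist l' l < \<epsilon>"
    and u2: "\<And>c l'. c \<in> T \<Longrightarrow> l' \<in> R c \<Longrightarrow> \<exists>!l. l \<in> R c1 \<and> dist l' l < \<epsilon>"
  define V where "V l = E \<inter> (T \<times> ball l \<epsilon>)" for l
  show "\<exists>T. c1 \<in> T \<and> openin (top_of_set D) T \<and>
      (\<exists>v. \<Union> v = E \<inter> fst -` T \<and> (\<forall>u\<in>v. openin (top_of_set E) u) \<and>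
        pairwise disjnt v \<and> (\<forall>u\<in>v. \<exists>q. homeomorphism u T fst q))"
  proof (intro exI[of _ T] exI[of _ "V ` R c1"] conjI ballI)
    show "c1 \<in> T" by fact
    show "openin (top_of_set D) T" using T by (simp add: openin_open_eq open_D)
    show "\<Union> (V ` R c1) = E \<inter> fst -` T"
      using u2 by (force simp: V_def dist_commute)
    show "openin (top_of_set E) u" if "u \<in> V ` R c1" for u
      using that T by (auto simp: V_def intro!: openin_open_Int open_Times)
    show "pairwise disjnt (V ` R c1)"
    proof (rule pairwiseI)
      fix x y assume "x \<in> V ` R c1" "y \<in> V ` R c1" "x \<noteq> y"
      then obtain l l' where l: "l \<in> R c1" "l' \<in> R c1" "x = V l" "y = V l'" "l \<noteq> l'" by blast
      show "disjnt x y" unfolding disjnt_def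
      proof (rule ccontr)
        assume "x \<inter> y \<noteq> {}"
        then obtain c m where "c \<in> T" "m \<in> R c" "dist m l < \<epsilon>" "dist m l' < \<epsilon>"
          using l by (auto simp: V_def dist_commute)
        with u2[of c m] l show False by auto
      qed
    qed
    fix u assume "u \<in> V ` R c1"
    then obtain l where l: "l \<in> R c1" "u = V l" by blast
    define q where "q c = (THE l'. l' \<in> R c \<and> dist l' l < \<epsilon>)" for c
    have q: "q c \<in> R c" "dist (q c) l < \<epsilon>" if "c \<in> T" for c
      using theI'[OF u1[OF that l(1)]] by (auto simp: q_def)
    have q_eq: "l' = q c" if "c \<in> T" "l' \<in> R c" "dist l' l < \<epsilon>" for c l'
      using u1[OF that(1) l(1)] q[OF that(1)] that by auto
    have cont: "continuous_on T q"
    proof (rule continuous_at_imp_continuous_on, rule ballI)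
      fix c2 assume c2: "c2 \<in> T"
      show "isCont q c2" unfolding isCont_def tendsto_iff
      proof (intro allI impI)
        fix \<eta> :: real assume "\<eta> > 0"
        define \<delta> where "\<delta> = min \<eta> (\<epsilon> - dist (q c2) l)"
        have "\<delta> > 0" using \<open>\<eta> > 0\<close> q[OF c2] by (simp add: \<delta>_def)
        have "\<forall>\<^sub>F c in nhds c2. c \<in> D \<longrightarrow> (\<exists>l'\<in>R c. dist l' (q c2) < \<delta>)"
          by (rule roots_continuous) (use c2 T q \<open>\<delta> > 0\<close> in auto)
        moreover have "\<forall>\<^sub>F c in nhds c2. c \<in> T" using T c2 by (intro eventually_nhds_in_open)
        ultimately have "\<forall>\<^sub>F c in nhds c2. dist (q c) (q c2) < \<eta>"
        proof eventually_elim
          case (elim c)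
          then obtain l' where l': "l' \<in> R c" "dist l' (q c2) < \<delta>" using T by blast
          then have "dist l' l < \<epsilon>"
            using dist_triangle[of l' l "q c2"] by (simp add: \<delta>_def)
          then have "l' = q c" using q_eq elim l' by blast
          with l' show ?case by (simp add: \<delta>_def)
        qed
        then show "\<forall>\<^sub>F c in at c2. dist (q c) (q c2) < \<eta>"
          by (simp add: eventually_at_filter eventually_mono)
      qed
    qed
    show "\<exists>q. homeomorphism u T fst q"
    proof (intro exI[of _ "\<lambda>c. (c, q c)"] homeomorphismI)
      show "continuous_on u fst" by (intro continuous_intros)
      show "continuous_on T (\<lambda>c. (c, q c))" by (intro continuous_intros cont)
      show "fst ` u \<subseteq> T" using l by (auto simp: V_def)
      show "(\<lambda>c. (c, q c)) ` T \<subseteq> u" using l q T by (auto simp: V_def dist_commute)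
      show "(fst x, q (fst x)) = x" if "x \<in> u" for x
        using that l q_eq by (auto simp: V_def dist_commute)
    qed auto
  qed
  qed
qed

text \<open>The exponential maps the half-plane \<open>H\<close> onto the punctured disc. As \<open>H\<close> is simply connected, the
  covering splits into global sections over it.\<close>

definition "H = {s. Re s < ln r}"

lemma exp_H: "s \<in> H \<Longrightarrow> exp s \<in> D"
  using r by (simp add: H_def) (metis exp_less_mono exp_ln)

lemma convex_H: "convex H" and open_H: "open H"
  unfolding H_def by (auto intro: convex_halfspace_Re_lt open_halfspace_Re_lt)

lemma H_shift: "s + of_real y * \<i> \<in> H \<longleftrightarrow> s \<in> H"
  by (simp add: H_def)

definition is_lift :: "(complex \<Rightarrow> complex ^ 'v) \<Rightarrow> bool" where
  "is_lift g \<longleftrightarrow> continuous_on H g \<and> (\<forall>s\<in>H. g s \<in> R (exp s))"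

lemma exists_lift:
  assumes "s0 \<in> H" "l \<in> R (exp s0)"
  obtains g where "is_lift g" "g s0 = l"
proof (rule covering_space_lift_strong[OF covering_roots, of "(exp s0, l)" s0 H exp])
  show "(exp s0, l) \<in> E" using assms exp_H by auto
  show "simply_connected H" by (rule convex_imp_simply_connected[OF convex_H])
  show "locally path_connected H" by (rule convex_imp_locally_path_connected[OF convex_H])
  show "continuous_on H exp" by (intro continuous_intros)
  show "exp \<in> H \<rightarrow> D" using exp_H by auto
  fix G assume G: "continuous_on H G" "G \<in> H \<rightarrow> E" "G s0 = (exp s0, l)" "\<And>s. s \<in> H \<Longrightarrow> fst (G s) = exp s"
  have "is_lift (\<lambda>s. snd (G s))" unfolding is_lift_def
  proof (intro conjI ballI)
    show "continuous_on H (\<lambda>s. snd (G s))" by (intro continuous_intros G)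
    fix s assume s: "s \<in> H"
    from G(2) s have "G s \<in> E" by (rule funcset_mem)
    then show "snd (G s) \<in> R (exp s)" using G(4)[OF s] by auto
  qed
  then show thesis using that G(3) by fastforce
qed (use assms in auto)

lemma lift_unique:
  assumes g: "is_lift g" "is_lift g'" and s1: "s1 \<in> H" "g s1 = g' s1" and s: "s \<in> H"
  shows "g s = g' s"
proof -
  have "(exp s, g s) = (exp s, g' s)"
  proof (rule covering_space_lift_unique[OF covering_roots, of "\<lambda>s. (exp s, g s)" s1 "\<lambda>s. (exp s, g' s)" H exp])
    show "exp \<in> H \<rightarrow> D" using exp_H by auto
    show "(\<lambda>s. (exp s, g s)) \<in> H \<rightarrow> E" "(\<lambda>s. (exp s, g' s)) \<in> H \<rightarrow> E"
      using g exp_H by (auto simp: is_lift_def)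
    show "connected H" by (rule convex_connected[OF convex_H])
  qed (use g s1 s in \<open>auto simp: is_lift_def intro!: continuous_intros\<close>)
  then show ?thesis by simp
qed

lemma exp_shift: "exp (s + of_real (2 * pi * of_nat m) * \<i>) = exp s"
proof -
  have "s + of_real (2 * pi * of_nat m) * \<i> = s + of_nat m * (2 * of_real pi * \<i>)" by simp
  then show ?thesis by (simp only: exp_add exp_of_nat_mult exp_two_pi_i power_one mult_1_right)
qed

lemma lift_shift:
  assumes "is_lift g" shows "is_lift (\<lambda>s. g (s + of_real (2 * pi * of_nat m) * \<i>))"
  unfolding is_lift_def
proof (intro conjI ballI)
  have cont: "continuous_on H g" and mem: "\<And>s. s \<in> H \<Longrightarrow> g s \<in> R (exp s)"
    using assms unfolding is_lift_def by blast+
  show "continuous_on H (\<lambda>s. g (s + of_real (2 * pi * of_nat m) * \<i>))"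
  proof (rule continuous_on_compose2[OF cont])
    show "continuous_on H (\<lambda>s. s + of_real (2 * pi * of_nat m) * \<i>)" by (intro continuous_intros)
    show "(\<lambda>s. s + of_real (2 * pi * of_nat m) * \<i>) ` H \<subseteq> H"
      by (rule image_subsetI) (simp only: H_shift)
  qed
  fix s assume "s \<in> H"
  then have "s + of_real (2 * pi * of_nat m) * \<i> \<in> H" by (simp only: H_shift)
  from mem[OF this] show "g (s + of_real (2 * pi * of_nat m) * \<i>) \<in> R (exp s)"
    unfolding exp_shift .
qed

text \<open>Among the \<open>k + 1\<close> translates of a lift by multiples of \<open>2 \<pi> \<i>\<close> up to \<open>k\<close>, two agree at a point, hence
  everywhere.\<close>

lemma lift_periodic:
  assumes g: "is_lift g"
  shows "\<exists>m::nat. m > 0 \<and> (\<forall>s\<in>H. g (s + of_real (2 * pi * of_nat m) * \<i>) = g s)"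
proof -
  define s0 :: complex where "s0 = of_real (ln r - 1)"
  have s0: "s0 \<in> H" by (simp add: s0_def H_def)
  define h where "h j s = g (s + of_real (2 * pi * of_nat j) * \<i>)" for j :: nat and s
  have h: "is_lift (h j)" for j unfolding h_def by (rule lift_shift[OF g])
  have "\<not> inj_on (\<lambda>j. h j s0) {..k}"
  proof
    assume inj: "inj_on (\<lambda>j. h j s0) {..k}"
    have "card ((\<lambda>j. h j s0) ` {..k}) \<le> card (R (exp s0))"
      using h s0 R(1)[OF exp_H[OF s0]] by (intro card_mono) (auto simp: is_lift_def)
    then show False using R(2)[OF exp_H[OF s0]] by (simp add: card_image[OF inj])
  qed
  then obtain i j where ij: "h i s0 = h j s0" "i < j"
    unfolding inj_on_def by (metis linorder_neqE_nat)
  have eq: "h i s = h j s" if "s \<in> H" for s by (rule lift_unique[OF h h s0 ij(1) that])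
  show ?thesis
  proof (intro exI[of _ "j - i"] conjI ballI)
    fix s assume s: "s \<in> H"
    let ?s = "s + of_real (2 * pi * - of_nat i) * \<i>"
    have "?s \<in> H" using s by (simp only: H_shift)
    from eq[OF this] have "g s = g (s + of_real (2 * pi * - of_nat i) * \<i> + of_real (2 * pi * of_nat j) * \<i>)"
      by (simp add: h_def)
    also have "s + of_real (2 * pi * - of_nat i) * \<i> + of_real (2 * pi * of_nat j) * \<i>
        = s + of_real (2 * pi * of_nat (j - i)) * \<i>"
      using ij(2) by (simp add: of_nat_diff algebra_simps)
    finally show "g (s + of_real (2 * pi * of_nat (j - i)) * \<i>) = g s" by simp
  qed (use ij in auto)
qed

lemma lift_periodic_mult:
  assumes per: "\<And>s. s \<in> H \<Longrightarrow> g (s + of_real (2 * pi * of_nat m) * \<i>) = g s" and s: "s \<in> H"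
  shows "g (s + of_real (2 * pi * of_nat (n * m)) * \<i>) = g s"
proof (induction n)
  case (Suc n)
  have "s + of_real (2 * pi * of_nat (n * m)) * \<i> \<in> H" using s by (simp only: H_shift)
  from per[OF this] Suc show ?case by (simp add: algebra_simps)
qed simp

lemma lift_periodic_int:
  assumes per: "\<And>s. s \<in> H \<Longrightarrow> g (s + of_real (2 * pi * of_nat m) * \<i>) = g s" and s: "s \<in> H"
  shows "g (s + of_real (2 * pi * of_int n * of_nat m) * \<i>) = g s"
proof (cases "n \<ge> 0")
  case True
  then obtain j :: nat where "n = of_nat j" by (metis nonneg_int_cases)
  then show ?thesis using lift_periodic_mult[of g m s j, OF per s] by (simp add: mult.assoc)
next
  case False
  then have "n = - of_nat (nat (- n))" by simp
  then obtain j :: nat where j: "n = - of_nat j" by blast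
  let ?s = "s + of_real (2 * pi * of_int n * of_nat m) * \<i>"
  have "?s \<in> H" using s by (simp only: H_shift)
  from lift_periodic_mult[of g m ?s j, OF per this] j show ?thesis by (simp add: mult.assoc)
qed

lemma all_lifts:
  "\<exists>g :: 'v \<Rightarrow> complex \<Rightarrow> complex ^ 'v. (\<forall>i. is_lift (g i)) \<and>
    (\<forall>s\<in>H. bij_betw (\<lambda>i. g i s) UNIV (R (exp s)))"
proof -
  define s0 :: complex where "s0 = of_real (ln r - 1)"
  have s0: "s0 \<in> H" by (simp add: s0_def H_def)
  obtain e :: "'v \<Rightarrow> complex ^ 'v" where e: "bij_betw e UNIV (R (exp s0))"
    using enumerate_roots[OF exp_H[OF s0]] by blast
  have "\<exists>g. is_lift g \<and> g s0 = e i" for i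
  proof -
    have "e i \<in> R (exp s0)" using e by (auto simp: bij_betw_def)
    from exists_lift[OF s0 this] show ?thesis by blast
  qed
  then obtain g where g: "\<And>i. is_lift (g i)" "\<And>i. g i s0 = e i" by metis
  have "bij_betw (\<lambda>i. g i s) UNIV (R (exp s))" if s: "s \<in> H" for s
  proof -
    have inj: "inj (\<lambda>i. g i s)"
    proof (rule injI)
      fix i j assume "g i s = g j s"
      from lift_unique[OF g(1) g(1) s this s0] have "e i = e j" by (simp add: g(2))
      then show "i = j" using e by (auto simp: bij_betw_def inj_def)
    qed
    moreover have "range (\<lambda>i. g i s) = R (exp s)"
      using g(1) s R[OF exp_H[OF s]] card_image[OF inj] card_UNIV
      by (intro card_subset_eq) (auto simp: is_lift_def)
    ultimately show ?thesis by (simp add: bij_betw_def)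
  qed
  with g(1) show ?thesis by (intro exI[of _ g]) simp
qed

text \<open>Where \<open>q s = form (g i s) u\<close> is a simple root, divide: with \<open>z = q s1\<close> fixed, the polynomial evaluated
  at \<open>z\<close> is \<open>F s = (z - q s) * W s\<close>, where \<open>F\<close> is differentiable and \<open>W\<close> is continuous and nonzero at \<open>s1\<close>. So
  the difference quotient of \<open>q\<close> is minus that of \<open>F\<close>, divided by \<open>W s\<close>, and converges.\<close>

lemma lift_form_differentiable:
  fixes g :: "'v \<Rightarrow> complex \<Rightarrow> complex ^ 'v"
  assumes g: "\<And>i. is_lift (g i)" "\<And>s. s \<in> H \<Longrightarrow> bij_betw (\<lambda>i. g i s) UNIV (R (exp s))"
    and s1: "s1 \<in> H" and u: "\<And>j. j \<noteq> i \<Longrightarrow> form (g i s1) u \<noteq> form (g j s1) u"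
  shows "(\<lambda>s. form (g i s) u) field_differentiable at s1"
proof -
  define q where "q s = form (g i s) u" for s
  define z where "z = q s1"
  define F where "F s = z ^ k + (\<Sum>j=1..k. p j (exp s) u * z ^ (k - j))" for s
  define W where "W s = (\<Prod>j\<in>UNIV - {i}. z - form (g j s) u)" for s
  have F_eq: "F s = (z - q s) * W s" if "s \<in> H" for s
  proof -
    have "F s = (\<Prod>l\<in>R (exp s). z - form l u)" unfolding F_def by (rule roots[OF exp_H[OF that]])
    also have "\<dots> = (\<Prod>j\<in>UNIV. z - form (g j s) u)"
      by (rule prod.reindex_bij_betw[OF g(2)[OF that], symmetric])
    also have "\<dots> = (z - q s) * W s" unfolding W_def q_def by (rule prod.remove) simp_all
    finally show ?thesis .
  qed
  have "(\<lambda>c. p j c u) field_differentiable at (exp s1)" if "j \<in> {1..k}" for j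
    using p[OF that, of u] exp_H[OF s1] holomorphic_on_imp_differentiable_at[of _ "ball 0 r" "exp s1"] by auto
  then have "(\<lambda>s. p j (exp s) u) field_differentiable at s1" if "j \<in> {1..k}" for j
    using field_differentiable_compose[of exp s1 "\<lambda>c. p j c u"] that
    by (simp add: o_def field_differentiable_within_exp)
  then have "F field_differentiable at s1"
    unfolding F_def by (intro derivative_intros field_differentiable_add field_differentiable_sum field_differentiable_mult) auto
  then obtain d where d: "(F has_field_derivative d) (at s1)" by (auto simp: field_differentiable_def)
  have cont: "isCont (g j) s1" for j
    using g(1)[of j] s1 open_H by (auto simp: is_lift_def continuous_on_eq_continuous_at)
  have W: "W \<midarrow>s1\<rightarrow> W s1"
    unfolding W_def using cont by (intro tendsto_intros) (auto simp: isCont_def)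
  have W1: "W s1 \<noteq> 0" using u by (auto simp: W_def z_def q_def)
  have ev_W: "\<forall>\<^sub>F s in at s1. W s \<noteq> 0" using tendsto_imp_eventually_ne[OF W W1] .
  have ev_H: "\<forall>\<^sub>F s in at s1. s \<in> H" using open_H s1 by (intro eventually_at_in_open') auto
  have "((\<lambda>s. - ((F s - F s1) / (s - s1)) / W s) \<longlongrightarrow> - d / W s1) (at s1)"
    using d unfolding has_field_derivative_iff by (intro tendsto_intros W W1)
  moreover have "\<forall>\<^sub>F s in at s1. - ((F s - F s1) / (s - s1)) / W s = (q s - q s1) / (s - s1)"
    using ev_W ev_H
  proof eventually_elim
    case (elim s)
    have "F s1 = 0" using F_eq[OF s1] by (simp add: z_def)
    then have "F s - F s1 = - ((q s - q s1) * W s)"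
      using F_eq[OF elim(2)] by (simp add: z_def algebra_simps)
    then show ?case using elim(1) by simp
  qed
  ultimately have "((\<lambda>s. (q s - q s1) / (s - s1)) \<longlongrightarrow> - d / W s1) (at s1)"
    by (rule Lim_transform_eventually)
  then have "(q has_field_derivative (- d / W s1)) (at s1)" by (simp add: has_field_derivative_iff)
  then show ?thesis unfolding q_def field_differentiable_def by blast
qed

text \<open>The \<open>j\<close>-th component is a difference of values in the two directions \<open>u\<close> and \<open>u + axis j \<epsilon>\<close>, both of which
  separate the vectors for a suitable \<open>\<epsilon>\<close>.\<close>

lemma lift_holomorphic:
  fixes g :: "'v \<Rightarrow> complex \<Rightarrow> complex ^ 'v"
  assumes g: "\<And>i. is_lift (g i)" "\<And>s. s \<in> H \<Longrightarrow> bij_betw (\<lambda>i. g i s) UNIV (R (exp s))"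
  shows "(\<lambda>s. g i s $ j) holomorphic_on H"
proof (rule holomorphic_on_open[OF open_H, THEN iffD2], intro ballI)
  fix s1 assume s1: "s1 \<in> H"
  define \<Lambda> where "\<Lambda> = (\<lambda>j. g i s1 - g j s1) ` (UNIV - {i})"
  have "j = i" if "g i s1 = g j s1" for j
    using g(2)[OF s1] that by (auto simp: bij_betw_def inj_def)
  then have \<Lambda>: "finite \<Lambda>" "0 \<notin> \<Lambda>" by (auto simp: \<Lambda>_def)
  obtain u where u: "\<And>l. l \<in> \<Lambda> \<Longrightarrow> form l u \<noteq> 0" by (rule generic_direction[OF \<Lambda>]) auto
  have "finite (insert 0 ((\<lambda>l. - form l u / l $ j) ` \<Lambda>))" using \<Lambda> by simp
  then obtain \<epsilon> where \<epsilon>: "\<epsilon> \<notin> insert 0 ((\<lambda>l. - form l u / l $ j) ` \<Lambda>)"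
    using ex_new_if_finite[OF infinite_UNIV_char_0] by blast
  have u': "form l (u + axis j \<epsilon>) \<noteq> 0" if "l \<in> \<Lambda>" for l
  proof
    assume "form l (u + axis j \<epsilon>) = 0"
    then have eq: "form l u + l $ j * \<epsilon> = 0" by simp
    then have "l $ j \<noteq> 0" using u[OF that] by auto
    with eq have "\<epsilon> = - form l u / l $ j" by (simp add: field_simps eq_neg_iff_add_eq_0)
    with \<epsilon> that show False by blast
  qed
  have ne: "form (g i s1) v \<noteq> form (g j s1) v" if "\<And>l. l \<in> \<Lambda> \<Longrightarrow> form l v \<noteq> 0" "j \<noteq> i" for v j
    using that(1)[of "g i s1 - g j s1"] that(2) by (auto simp: \<Lambda>_def)
  have "(\<lambda>s. (form (g i s) (u + axis j \<epsilon>) - form (g i s) u) / \<epsilon>) field_differentiable at s1"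
    by (intro field_differentiable_divide field_differentiable_diff lift_form_differentiable[OF g s1] ne u u')
       (use \<epsilon> in auto)
  moreover have "(form (g i s) (u + axis j \<epsilon>) - form (g i s) u) / \<epsilon> = g i s $ j" for s
    using \<epsilon> by simp
  ultimately show "\<exists>f'. ((\<lambda>s. g i s $ j) has_field_derivative f') (at s1)"
    by (simp add: field_differentiable_def)
qed

text \<open>A common period \<open>2 \<pi> \<i> q\<close> of all the lifts makes them functions of \<open>t = exp (s / q)\<close>. These are bounded
  and holomorphic near \<open>t = 0\<close> outside that point, so the singularity is removable.\<close>

lemma puiseux_parametrization:
  obtains q :: nat and L :: "'v \<Rightarrow> 'v \<Rightarrow> complex fps" where "q > 0"
    "\<And>i j. fps_conv_radius (L i j) > 0"
    "\<forall>\<^sub>F t in at 0. t ^ q \<in> D \<and> bij_betw (\<lambda>i. \<chi> j. eval_fps (L i j) t) UNIV (R (t ^ q))"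
proof -
  from all_lifts obtain g :: "'v \<Rightarrow> complex \<Rightarrow> complex ^ 'v" where
    "(\<forall>i. is_lift (g i)) \<and> (\<forall>s\<in>H. bij_betw (\<lambda>i. g i s) UNIV (R (exp s)))" ..
  then have g: "\<And>i. is_lift (g i)" "\<And>s. s \<in> H \<Longrightarrow> bij_betw (\<lambda>i. g i s) UNIV (R (exp s))" by simp_all
  have "\<exists>m::nat. m > 0 \<and> (\<forall>s\<in>H. g i (s + of_real (2 * pi * of_nat m) * \<i>) = g i s)" for i
    by (rule lift_periodic[OF g(1)])
  then obtain m :: "'v \<Rightarrow> nat" where m: "\<And>i. m i > 0"
    "\<And>i s. s \<in> H \<Longrightarrow> g i (s + of_real (2 * pi * of_nat (m i)) * \<i>) = g i s" by metis
  define q where "q = (\<Prod>i\<in>UNIV. m i)"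
  have q: "q > 0" using m by (simp add: q_def prod_pos)
  have per: "g i (s + of_real (2 * pi * of_int n * of_nat q) * \<i>) = g i s" if s: "s \<in> H" for i s n
  proof -
    have "m i dvd q" unfolding q_def by (rule dvd_prodI) auto
    then obtain d where "q = m i * d" ..
    then have "q = d * m i" by (simp add: mult.commute)
    then have "g i (s + of_real (2 * pi * of_nat q) * \<i>) = g i s" if "s \<in> H" for s
      using lift_periodic_mult[of "g i" "m i" s d, OF m(2) that] by simp
    from lift_periodic_int[of "g i" q s n, OF this s] show ?thesis .
  qed
  define \<rho> where "\<rho> = min 1 r"
  have \<rho>: "\<rho> > 0" using r by (simp add: \<rho>_def)
  have inH: "of_nat q * s \<in> H" if "exp s = t" "t \<in> ball 0 \<rho> - {0}" for s t
  proof -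
    have "norm t = exp (Re s)" using that(1) by (metis norm_exp_eq_Re)
    then have lt: "exp (Re s) < 1" "exp (Re s) < r" using that(2) by (auto simp: \<rho>_def)
    then have "Re s < ln r" by (metis exp_less_cancel_iff exp_ln r)
    moreover have "real q * Re s \<le> 1 * Re s" using lt(1) q by (intro mult_right_mono_neg) auto
    ultimately show ?thesis by (simp add: H_def)
  qed
  (* single-valued and holomorphic across the branch cut of Ln because g has period 2 pi i q *)
  define \<zeta> where "\<zeta> i j t = g i (of_nat q * Ln t) $ j" for i j t
  have deriv: "\<exists>d. (\<zeta> i j has_field_derivative d) (at t1)" if t1: "t1 \<in> ball 0 \<rho> - {0}" for i j t1
  proof -
    have nz: "t1 \<noteq> 0" using t1 by auto
    (* a branch of the logarithm that is holomorphic near t1 *)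
    define B where "B t = Ln (t / t1) + Ln t1" for t
    have expB: "exp (B t) = t" if "t \<noteq> 0" for t using that nz by (simp add: B_def exp_add)
    have eq: "g i (of_nat q * B t) $ j = \<zeta> i j t" if t: "t \<in> ball 0 \<rho> - {0}" for t
    proof -
      have "exp (B t) = exp (Ln t)" using t expB by auto
      then obtain n :: int where n: "B t = Ln t + (of_int (2 * n) * pi) * \<i>" by (auto simp: exp_eq)
      have "of_nat q * B t = of_nat q * Ln t + of_real (2 * pi * of_int n * of_nat q) * \<i>"
        unfolding n by (simp add: algebra_simps)
      moreover have "of_nat q * Ln t \<in> H" using t by (intro inH) auto
      ultimately show ?thesis unfolding \<zeta>_def using per by simp
    qed
    have dg: "(\<lambda>s. g i s $ j) field_differentiable at (of_nat q * B t1)"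
      using lift_holomorphic[OF g, of i j] open_H inH[OF expB[OF nz] t1]
      by (rule holomorphic_on_imp_differentiable_at)
    have "(\<lambda>t. of_nat q * B t) holomorphic_on ((\<lambda>t. t / t1) -` ball 1 1)"
      unfolding B_def using nz
      by (intro holomorphic_intros) (auto simp: complex_nonpos_Reals_iff dist_norm
        dest!: order.strict_trans1[OF abs_Re_le_cmod])
    moreover have "open ((\<lambda>t. t / t1) -` ball 1 1)"
      by (intro open_vimage continuous_intros) (use nz in auto)
    ultimately have "(\<lambda>t. of_nat q * B t) field_differentiable at t1"
      by (rule holomorphic_on_imp_differentiable_at) (use nz in simp)
    from field_differentiable_compose[OF this dg] obtain d where "((\<lambda>t. g i (of_nat q * B t) $ j) has_field_derivative d) (at t1)"
      by (auto simp: field_differentiable_def o_def)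
    then have "(\<zeta> i j has_field_derivative d) (at t1)"
      by (rule has_field_derivative_transform_within_open[of _ _ _ "ball 0 \<rho> - {0}"])
         (use t1 eq in \<open>auto intro!: open_Diff\<close>)
    then show ?thesis by blast
  qed
  have R_\<zeta>: "bij_betw (\<lambda>i. \<chi> j. \<zeta> i j t) UNIV (R (t ^ q)) \<and> t ^ q \<in> D" if t: "t \<in> ball 0 \<rho> - {0}" for t
  proof -
    have "exp (Ln t) = t" using t by auto
    then have "of_nat q * Ln t \<in> H" "exp (of_nat q * Ln t) = t ^ q"
      using t inH by (auto simp: exp_of_nat_mult)
    then show ?thesis using g(2)[of "of_nat q * Ln t"] exp_H by (fastforce simp: \<zeta>_def)
  qed
  have "\<exists>h. h holomorphic_on ball 0 \<rho> \<and> (\<forall>t\<in>ball 0 \<rho> - {0}. h t = \<zeta> i j t)" for i j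
  proof (rule holomorphic_on_extend_bounded[THEN iffD2])
    show "\<zeta> i j holomorphic_on ball 0 \<rho> - {0}"
      by (rule holomorphic_on_open[THEN iffD2]) (use deriv in \<open>auto intro!: open_Diff\<close>)
    show "0 \<in> interior (ball 0 \<rho>)" using \<rho> by simp
    have "norm (\<zeta> i j t) \<le> M" if t: "t \<in> ball 0 \<rho> - {0}" for t
    proof -
      have "(\<chi> j. \<zeta> i j t) \<in> R (t ^ q)" using R_\<zeta>[OF t] by (auto simp: bij_betw_def)
      then have "norm (\<chi> j. \<zeta> i j t) \<le> M" using R_\<zeta>[OF t] bound by blast
      then show ?thesis using Finite_Cartesian_Product.norm_nth_le[of "\<chi> j. \<zeta> i j t" j] by simp
    qed
    moreover have "\<forall>\<^sub>F t in at 0. t \<in> ball 0 \<rho> - {0}"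
      using \<rho> by (intro eventually_at_in_open) auto
    ultimately show "\<exists>B. \<forall>\<^sub>F t in at 0. norm (\<zeta> i j t) \<le> B"
      by (intro exI[of _ M]) (auto elim: eventually_mono)
  qed
  then obtain h where h: "\<And>i j. h i j holomorphic_on ball 0 \<rho>"
    "\<And>i j t. t \<in> ball 0 \<rho> - {0} \<Longrightarrow> h i j t = \<zeta> i j t" by metis
  define L where "L i j = fps_expansion (h i j) 0" for i j
  have L: "h i j has_fps_expansion L i j" for i j
    unfolding L_def by (rule has_fps_expansion_fps_expansion[of "ball 0 \<rho>"]) (use \<rho> h in auto)
  show ?thesis
  proof (rule that[OF q])
    show "fps_conv_radius (L i j) > 0" for i j using L by (simp add: has_fps_expansion_def)
    have "\<forall>\<^sub>F t in nhds 0. \<forall>i j. eval_fps (L i j) t = h i j t"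
      using L by (intro eventually_all_finite) (simp add: has_fps_expansion_def)
    then have "\<forall>\<^sub>F t in at 0. \<forall>i j. eval_fps (L i j) t = h i j t"
      by (simp add: eventually_nhds_conv_at)
    moreover have "\<forall>\<^sub>F t in at 0. t \<in> ball 0 \<rho> - {0}"
      using \<rho> by (intro eventually_at_in_open) auto
    ultimately show "\<forall>\<^sub>F t in at 0. t ^ q \<in> D \<and> bij_betw (\<lambda>i. \<chi> j. eval_fps (L i j) t) UNIV (R (t ^ q))"
    proof eventually_elim
      case (elim t)
      then show ?case using R_\<zeta>[OF elim(2)] h(2)[OF elim(2)] by simp
    qed
  qed
qed

end

section \<open>Functions regular at the origin\<close>

text \<open>\<open>F\<close> is the Taylor series at \<open>0\<close> of \<open>g\<close> after removal of a singularity; the value \<open>g 0\<close> is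
  irrelevant. Functions of \<open>t\<close> below are only meaningful for \<open>t \<noteq> 0\<close>.\<close>

definition has_germ :: "(complex \<Rightarrow> complex) \<Rightarrow> complex fps \<Rightarrow> bool" where
  "has_germ g F \<longleftrightarrow> g has_laurent_expansion fps_to_fls F"

lemma has_germI: "g has_fps_expansion F \<Longrightarrow> has_germ g F"
  unfolding has_germ_def by (rule has_laurent_expansion_fps)

lemma has_germ_eval_fps: "fps_conv_radius F > 0 \<Longrightarrow> has_germ (eval_fps F) F"
  by (intro has_germI eval_fps_has_fps_expansion)

lemma has_germ_cong: "has_germ g F \<Longrightarrow> \<forall>\<^sub>F t in at 0. g t = g' t \<Longrightarrow> has_germ g' F"
  unfolding has_germ_def using has_laurent_expansion_cong by blast

lemma has_germ_unique: "has_germ g F \<Longrightarrow> has_germ g G \<Longrightarrow> F = G"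
  unfolding has_germ_def using has_laurent_expansion_unique fps_to_fls_eq_iff by blast

lemma has_germ_const [intro]: "has_germ (\<lambda>_. c) (fps_const c)"
  and has_germ_0 [intro]: "has_germ (\<lambda>_. 0) 0" and has_germ_1 [intro]: "has_germ (\<lambda>_. 1) 1"
  by (rule has_germI, simp)+

lemma has_germ_power_ident: "has_germ (\<lambda>t. t ^ n) (fps_X ^ n)"
  by (rule has_germI) (rule has_fps_expansion_fps_X_power)

lemma has_germ_add: "has_germ g F \<Longrightarrow> has_germ g' F' \<Longrightarrow> has_germ (\<lambda>t. g t + g' t) (F + F')"
  and has_germ_mult: "has_germ g F \<Longrightarrow> has_germ g' F' \<Longrightarrow> has_germ (\<lambda>t. g t * g' t) (F * F')"
  and has_germ_uminus: "has_germ g F \<Longrightarrow> has_germ (\<lambda>t. - g t) (- F)"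
  unfolding has_germ_def fps_to_fls_plus fls_times_fps_to_fls fps_to_fls_uminus
  by (rule has_laurent_expansion_add has_laurent_expansion_mult has_laurent_expansion_minus; assumption)+

lemma has_germ_diff: "has_germ g F \<Longrightarrow> has_germ g' F' \<Longrightarrow> has_germ (\<lambda>t. g t - g' t) (F - F')"
  using has_germ_add[OF _ has_germ_uminus, of g F g' F'] by simp

lemma has_germ_sum: "(\<And>i. i \<in> I \<Longrightarrow> has_germ (g i) (F i)) \<Longrightarrow> has_germ (\<lambda>t. \<Sum>i\<in>I. g i t) (\<Sum>i\<in>I. F i)"
  by (induction I rule: infinite_finite_induct) (auto intro: has_germ_add)

lemma has_germ_prod: "(\<And>i. i \<in> I \<Longrightarrow> has_germ (g i) (F i)) \<Longrightarrow> has_germ (\<lambda>t. \<Prod>i\<in>I. g i t) (\<Prod>i\<in>I. F i)"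
  by (induction I rule: infinite_finite_induct) (auto intro: has_germ_mult)

lemma has_germ_inverse:
  assumes "has_germ g F" "fps_nth F 0 \<noteq> 0"
  shows "has_germ (\<lambda>t. inverse (g t)) (inverse F)"
proof -
  have "inverse (fps_to_fls F) = fps_to_fls (inverse F)"
    using assms(2) by (intro fls_inverse_fps_to_fls) simp
  then show ?thesis using has_laurent_expansion_inverse assms(1) unfolding has_germ_def by metis
qed

lemma has_germ_nonzero: "has_germ g F \<Longrightarrow> fps_nth F 0 \<noteq> 0 \<Longrightarrow> \<forall>\<^sub>F t in at 0. g t \<noteq> 0"
  unfolding has_germ_def by (rule has_laurent_expansion_nonzero_imp_eventually_nonzero) auto

lemma has_germ_0D: "has_germ g 0 \<Longrightarrow> \<forall>\<^sub>F t in at 0. g t = 0"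
  unfolding has_germ_def by (auto simp: has_laurent_expansion_def elim: eventually_mono)

lemma has_germ_divide_power:
  assumes "has_germ g (fps_X ^ e * F)" shows "has_germ (\<lambda>t. g t / t ^ e) F"
proof -
  have "(\<lambda>t. g t / t ^ e) has_laurent_expansion fps_to_fls (fps_X ^ e * F) / fps_to_fls (fps_X ^ e)"
    using assms has_germ_power_ident[of e] unfolding has_germ_def by (rule has_laurent_expansion_divide)
  then show ?thesis by (simp add: has_germ_def fls_times_fps_to_fls)
qed

definition regular :: "(complex \<Rightarrow> complex) \<Rightarrow> bool" where
  "regular g \<longleftrightarrow> (\<exists>F. has_germ g F)"

lemma regular_const: "regular (\<lambda>_. c)" and regular_power_ident: "regular (\<lambda>t. t ^ n)"
  and regular_add: "regular g \<Longrightarrow> regular g' \<Longrightarrow> regular (\<lambda>t. g t + g' t)"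
  and regular_mult: "regular g \<Longrightarrow> regular g' \<Longrightarrow> regular (\<lambda>t. g t * g' t)"
  and regular_uminus: "regular g \<Longrightarrow> regular (\<lambda>t. - g t)"
  using has_germ_const has_germ_power_ident has_germ_add has_germ_mult has_germ_uminus unfolding regular_def by blast+

lemma regular_sum: "(\<And>i. i \<in> I \<Longrightarrow> regular (g i)) \<Longrightarrow> regular (\<lambda>t. \<Sum>i\<in>I. g i t)"
  by (induction I rule: infinite_finite_induct) (auto intro: regular_add regular_const)

lemma regular_cong: "regular g \<Longrightarrow> \<forall>\<^sub>F t in at 0. g t = g' t \<Longrightarrow> regular g'"
  using has_germ_cong unfolding regular_def by blast

text \<open>Regularity of the first \<open>n\<close> coefficients only: the coefficients of a root are determined
  recursively, and this is the form of the induction hypothesis.\<close>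

definition regular_below :: "nat \<Rightarrow> (complex \<Rightarrow> complex fps) \<Rightarrow> bool" where
  "regular_below n G \<longleftrightarrow> (\<forall>j<n. regular (\<lambda>t. fps_nth (G t) j))"

lemma regular_belowD: "regular_below n G \<Longrightarrow> j < n \<Longrightarrow> regular (\<lambda>t. fps_nth (G t) j)"
  by (simp add: regular_below_def)

lemma regular_below_mono: "regular_below n G \<Longrightarrow> m \<le> n \<Longrightarrow> regular_below m G"
  by (auto simp: regular_below_def)

lemma regular_below_add: "regular_below n G \<Longrightarrow> regular_below n G' \<Longrightarrow> regular_below n (\<lambda>t. G t + G' t)"
  by (auto simp: regular_below_def intro: regular_add)

lemma regular_below_mult: "regular_below n G \<Longrightarrow> regular_below n G' \<Longrightarrow> regular_below n (\<lambda>t. G t * G' t)"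
  unfolding regular_below_def fps_mult_nth by (intro allI impI regular_sum regular_mult) auto

lemma regular_below_const: "regular g \<Longrightarrow> regular_below n (\<lambda>t. fps_const (g t))"
  unfolding regular_below_def
proof (intro allI impI)
  fix j assume "regular g"
  then show "regular (\<lambda>t. fps_nth (fps_const (g t)) j)" using regular_const[of 0] by (cases "j = 0") auto
qed

lemma regular_below_fixed: "regular_below n (\<lambda>t. F)"
  by (simp add: regular_below_def regular_const)

lemma regular_below_power: "regular_below n G \<Longrightarrow> regular_below n (\<lambda>t. G t ^ m)"
  by (induction m) (auto intro: regular_below_mult regular_below_fixed)

lemma regular_below_sum: "(\<And>i. i \<in> I \<Longrightarrow> regular_below n (G i)) \<Longrightarrow> regular_below n (\<lambda>t. \<Sum>i\<in>I. G i t)"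
  by (induction I rule: infinite_finite_induct) (auto intro: regular_below_add regular_below_fixed)

lemma regular_below_shift: "regular_below n G \<Longrightarrow> regular_below (n - m) (\<lambda>t. fps_shift m (G t))"
  by (auto simp: regular_below_def)

lemma regular_below_mult_X: "regular_below n G \<Longrightarrow> regular_below (n + m) (\<lambda>t. fps_X ^ m * G t)"
  unfolding regular_below_def fps_X_power_mult_nth
proof (intro allI impI)
  fix j assume "\<forall>j<n. regular (\<lambda>t. fps_nth (G t) j)" "j < n + m"
  then show "regular (\<lambda>t. if j < m then 0 else fps_nth (G t) (j - m))"
    using regular_const[of 0] by (cases "j < m") auto
qed

definition regular_poly :: "(complex \<Rightarrow> complex fps poly) \<Rightarrow> bool" where
  "regular_poly Q \<longleftrightarrow> (\<forall>l n. regular_below n (\<lambda>t. coeff (Q t) l))"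

lemma regular_poly_add: "regular_poly P \<Longrightarrow> regular_poly Q \<Longrightarrow> regular_poly (\<lambda>t. P t + Q t)"
  by (auto simp: regular_poly_def intro: regular_below_add)

lemma regular_poly_mult: "regular_poly P \<Longrightarrow> regular_poly Q \<Longrightarrow> regular_poly (\<lambda>t. P t * Q t)"
  unfolding regular_poly_def coeff_mult by (intro allI regular_below_sum regular_below_mult) auto

lemma regular_poly_fixed: "regular_poly (\<lambda>t. P)"
  by (simp add: regular_poly_def regular_below_fixed)

lemma regular_poly_power: "regular_poly P \<Longrightarrow> regular_poly (\<lambda>t. P t ^ n)"
  by (induction n) (auto intro: regular_poly_mult regular_poly_fixed)

lemma regular_poly_sum: "(\<And>i. i \<in> I \<Longrightarrow> regular_poly (P i)) \<Longrightarrow> regular_poly (\<lambda>t. \<Sum>i\<in>I. P i t)"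
  by (induction I rule: infinite_finite_induct) (auto intro: regular_poly_add regular_poly_fixed)

lemma regular_poly_smult: "(\<And>n. regular_below n G) \<Longrightarrow> regular_poly P \<Longrightarrow> regular_poly (\<lambda>t. smult (G t) (P t))"
  unfolding regular_poly_def coeff_smult by (auto intro: regular_below_mult)

lemma regular_poly_linear: "regular g \<Longrightarrow> regular_poly (\<lambda>t. [:fps_const (g t), 1:])"
  unfolding regular_poly_def
proof (intro allI)
  fix l n assume "regular g"
  then show "regular_below n (\<lambda>t. coeff [:fps_const (g t), 1:] l)"
    by (cases l) (auto simp: regular_below_const coeff_pCons regular_below_fixed split: nat.splits)
qed

lemma pcompose_weierstrass:
  "pcompose (weierstrass k A) q = q ^ k + (\<Sum>i=1..k. smult (A i) (q ^ (k - i)))"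
proof -
  have "pcompose (monom a n) q = smult a (q ^ n)" for a n
    by (induction n) (auto simp: monom_0 monom_Suc pcompose_pCons)
  then show ?thesis by (simp add: weierstrass_def pcompose_add pcompose_sum)
qed

text \<open>Let \<open>\<beta>\<close> be a root of a monic polynomial over \<open>\<complex>[[s]]\<close> depending on \<open>t\<close>, let \<open>z0\<close> be its constant term
  and \<open>\<Psi>\<close> the polynomial expanded at \<open>z0\<close>. The derivative of the polynomial at the root is a unit times
  \<open>t ^ e\<close> at \<open>s = 0\<close>, so for \<open>t \<noteq> 0\<close> the root is simple there. Replace \<open>s\<close> by \<open>t ^ M s\<close> and write the root as
  \<open>z0 + t ^ e y\<close>. Each power of \<open>s\<close> now carries \<open>t ^ M\<close>, and \<open>M \<ge> 2 e\<close>, so the equation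
  \<open>\<Psi>(t ^ e y) = 0\<close> can be divided by \<open>t ^ (2 e)\<close>, which gives \<open>d y = - (K 0 + t ^ e (K 1) y + y\<^sup>2 Q)\<close> with
  all coefficients regular at \<open>t = 0\<close> and \<open>d\<close> a unit there. As \<open>y\<close> and the \<open>K l\<close> have no constant term in
  \<open>s\<close>, this determines the coefficients of \<open>y\<close> recursively and shows that they are regular.\<close>

lemma simple_root_rescaled_regular:
  fixes a :: "nat \<Rightarrow> complex \<Rightarrow> complex fps" and \<beta> :: "complex \<Rightarrow> complex fps"
  assumes a: "\<And>i n. i \<in> {1..k} \<Longrightarrow> regular_below n (a i)"
    and root: "\<forall>\<^sub>F t in at 0. poly (weierstrass k (\<lambda>i. a i t)) (\<beta> t) = 0"
    and z0: "regular (\<lambda>t. fps_nth (\<beta> t) 0)"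
    and d: "\<forall>\<^sub>F t in at 0. fps_nth (coeff (pcompose (weierstrass k (\<lambda>i. a i t)) [:fps_const (fps_nth (\<beta> t) 0), 1:]) 1) 0
      = t ^ e * d t"
    and U: "has_germ d U" "fps_nth U 0 \<noteq> 0" and M: "M \<ge> 2 * e"
  shows "regular (\<lambda>t. t ^ (M * m) * fps_nth (\<beta> t) m)"
proof -
  define \<Psi> where "\<Psi> t = pcompose (weierstrass k (\<lambda>i. a i t)) [:fps_const (fps_nth (\<beta> t) 0), 1:]" for t
  define C where "C l t = coeff (\<Psi> t) l" for l t
  have "regular_poly \<Psi>"
    unfolding \<Psi>_def pcompose_weierstrass
    by (intro regular_poly_add regular_poly_sum regular_poly_smult regular_poly_power regular_poly_linear z0 a)
  then have C: "regular_below n (C l)" for n l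
  proof -
    have "C l = (\<lambda>t. coeff (\<Psi> t) l)" by (rule ext) (simp add: C_def)
    with \<open>regular_poly \<Psi>\<close> show ?thesis by (simp add: regular_poly_def)
  qed
  have degC: "C l t = 0" if "l > k" for l t
  proof -
    have "degree (\<Psi> t) \<le> degree (weierstrass k (\<lambda>i. a i t)) * degree [:fps_const (fps_nth (\<beta> t) 0), 1:]"
      unfolding \<Psi>_def by (rule degree_pcompose_le)
    then have "degree (\<Psi> t) \<le> k" by (simp add: degree_weierstrass)
    with that show ?thesis unfolding C_def by (intro coeff_eq_0) simp
  qed
  (* K l is t^(-2e) times the part of positive degree of the l-th coefficient of \<Psi> with
    t^M s in place of s. *)
  define K where "K l t = (Abs_fps (\<lambda>n. if n = 0 then 0 else t ^ (M * n - 2 * e) * fps_nth (C l t) n) :: complex fps)" for l t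
  have K: "regular_below n (K l)" for n l
    unfolding regular_below_def
  proof (intro allI impI)
    fix j assume "j < n"
    show "regular (\<lambda>t. fps_nth (K l t) j)"
      using regular_const[of 0] by (cases "j = 0") (auto simp: K_def intro!: regular_mult regular_power_ident regular_belowD[OF C[of "Suc j"]])
  qed
  (* Cs l is the l-th coefficient of \<Psi> after the rescaling of s. *)
  define Cs where "Cs l t = C l t oo (fps_const (t ^ M) * fps_X)" for l t
  have Cs_nth: "fps_nth (Cs l t) n = t ^ (M * n) * fps_nth (C l t) n" for l t n
    by (simp add: Cs_def power_mult)
  have Cs: "regular_below n (Cs l)" for n l
    unfolding regular_below_def Cs_nth by (auto intro!: regular_mult regular_power_ident regular_belowD[OF C])
  define y where "y t = (Abs_fps (\<lambda>n. if n = 0 then 0 else t ^ (M * n) * fps_nth (\<beta> t) n / t ^ e) :: complex fps)" for t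
  (* The summation runs to Suc k, beyond the degree, so that it splits off the terms 0 and 1
    for every k. *)
  define Q where "Q t = (\<Sum>l=2..Suc k. Cs l t * (fps_const (t ^ e) * y t) ^ (l - 2))" for t
  have main: "\<forall>\<^sub>F t in at 0. fps_const (d t) * y t =
      - (K 0 t + fps_const (t ^ e) * K 1 t * y t + y t ^ 2 * Q t)"
  proof -
    have nz: "\<forall>\<^sub>F t in at (0::complex). t \<noteq> 0" by (simp add: eventually_at_filter)
    from root d nz show ?thesis
    proof eventually_elim
      case (elim t)
      define s where "s = fps_const (t ^ M) * fps_X"
      have s0: "fps_nth s 0 = 0" by (simp add: s_def)
      let ?z = "fps_const (fps_nth (\<beta> t) 0)"
      let ?\<delta> = "fps_const (t ^ e) * y t"
      have \<delta>: "(\<beta> t - ?z) oo s = ?\<delta>"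
        using elim(3) by (auto simp: fps_eq_iff s_def y_def power_mult)
      have "poly (\<Psi> t) (\<beta> t - ?z) = 0"
        using elim(1) by (simp add: \<Psi>_def poly_pcompose)
      moreover have "poly (\<Psi> t) (\<beta> t - ?z) = (\<Sum>l\<le>Suc k. C l t * (\<beta> t - ?z) ^ l)"
      proof -
        have "degree (\<Psi> t) \<le> Suc k"
          by (rule degree_le) (use degC in \<open>auto simp: C_def\<close>)
        then show ?thesis unfolding poly_altdef C_def
          by (intro sum.mono_neutral_left) (simp_all add: coeff_eq_0)
      qed
      ultimately have "(\<Sum>l\<le>Suc k. C l t * (\<beta> t - ?z) ^ l) oo s = 0" by simp
      then have sum0: "(\<Sum>l\<le>Suc k. Cs l t * ?\<delta> ^ l) = 0"
        by (simp only: fps_compose_sum_distrib fps_compose_mult_distrib[OF s0]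
            fps_compose_power[OF s0, symmetric] \<delta> Cs_def s_def[symmetric])
      have split: "{..Suc k} = insert 0 (insert 1 {2..Suc k})" by auto
      have "(\<Sum>l=2..Suc k. Cs l t * ?\<delta> ^ l) = (\<Sum>l=2..Suc k. ?\<delta> ^ 2 * (Cs l t * ?\<delta> ^ (l - 2)))"
      proof (rule sum.cong[OF refl])
        fix l assume "l \<in> {2..Suc k}"
        then have "2 + (l - 2) = l" unfolding atLeastAtMost_iff by arith
        then have "?\<delta> ^ l = ?\<delta> ^ 2 * ?\<delta> ^ (l - 2)" by (simp only: power_add[symmetric])
        then show "Cs l t * ?\<delta> ^ l = ?\<delta> ^ 2 * (Cs l t * ?\<delta> ^ (l - 2))" by (simp add: mult_ac)
      qed
      also have "\<dots> = ?\<delta> ^ 2 * Q t" unfolding Q_def by (rule sum_distrib_left[symmetric])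
      finally have eq: "Cs 0 t + Cs 1 t * ?\<delta> + ?\<delta> ^ 2 * Q t = 0"
        using sum0 unfolding split by (simp add: add.assoc del: sum.cl_ivl_Suc)
      have pow: "t ^ (M * n) = t ^ (2 * e) * t ^ (M * n - 2 * e)" if "n > 0" for n
      proof -
        have "2 * e \<le> M * n" using M that by (metis le_trans mult.right_neutral mult_le_mono2 Suc_leI One_nat_def)
        then show ?thesis by (simp flip: power_add)
      qed
      have "fps_nth (y t) 0 = 0" by (simp add: y_def)
      then have "fps_nth (Cs 0 t) 0 = 0"
        using arg_cong[OF eq, of "\<lambda>F. fps_nth F 0"] by (simp add: power2_eq_square)
      then have Cs0: "Cs 0 t = fps_const (t ^ (2 * e)) * K 0 t"
        using pow by (auto simp: fps_eq_iff K_def Cs_nth)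
      have Cs1: "Cs 1 t = fps_const (t ^ e * d t) + fps_const (t ^ (2 * e)) * K 1 t"
      proof (rule fps_ext)
        fix n
        show "fps_nth (Cs 1 t) n = fps_nth (fps_const (t ^ e * d t) + fps_const (t ^ (2 * e)) * K 1 t) n"
          using pow[of n] elim(2) by (cases "n = 0") (auto simp: K_def Cs_nth C_def \<Psi>_def)
      qed
      let ?c = "fps_const (t ^ e)"
      have c2: "fps_const (t ^ (2 * e)) = ?c * ?c" by (simp add: power_add mult_2)
      have "?c * ?c * (fps_const (d t) * y t + (K 0 t + ?c * K 1 t * y t + y t ^ 2 * Q t)) =
          Cs 0 t + Cs 1 t * ?\<delta> + ?\<delta> ^ 2 * Q t"
        unfolding Cs0 Cs1 c2 fps_const_mult[symmetric] by (simp only: power2_eq_square algebra_simps)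
      also have "\<dots> = 0" by (rule eq)
      finally have "fps_const (d t) * y t + (K 0 t + ?c * K 1 t * y t + y t ^ 2 * Q t) = 0"
        using elim(3) by (simp del: fps_const_mult)
      then show ?case by (simp only: eq_neg_iff_add_eq_0)
    qed
  qed
  have "regular_below (Suc n) y" for n
  proof (induction n)
    case 0
    then show ?case by (simp add: regular_below_def y_def regular_const)
  next
    case (Suc n)
    (* Both K 1 * y and y^2 are divisible by s^2, which is where the index is gained. *)
    define y' where "y' t = fps_shift 1 (y t)" for t
    have y_eq: "y t = fps_X ^ 1 * y' t" for t
      by (auto simp: fps_eq_iff y'_def y_def)
    define K' where "K' t = fps_shift 1 (K 1 t)" for t
    have K_eq: "K 1 t = fps_X ^ 1 * K' t" for t
      by (auto simp: fps_eq_iff K'_def K_def)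
    have y': "regular_below n y'" unfolding y'_def using regular_below_shift[OF Suc, of 1] by simp
    have K': "regular_below n K'" unfolding K'_def using regular_below_shift[OF K[of "Suc n"], of 1] by simp
    have Q: "regular_below n Q" unfolding Q_def
      by (intro regular_below_sum regular_below_mult regular_below_power Cs regular_below_const regular_power_ident regular_below_mono[OF Suc]) simp
    have eq: "K 0 t + fps_const (t ^ e) * K 1 t * y t + y t ^ 2 * Q t =
        K 0 t + fps_X ^ 2 * (fps_const (t ^ e) * K' t * y' t + y' t ^ 2 * Q t)" for t
      unfolding K_eq y_eq power_one_right by (simp add: power2_eq_square algebra_simps)
    have rhs: "regular_below (n + 2) (\<lambda>t. K 0 t + fps_const (t ^ e) * K 1 t * y t + y t ^ 2 * Q t)"
      unfolding eq
      by (intro regular_below_add K regular_below_mult_X regular_below_mult regular_below_power regular_below_const regular_power_ident K' y' Q)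
    show ?case unfolding regular_below_def
    proof (intro allI impI)
      fix j assume "j < Suc (Suc n)"
      let ?r = "\<lambda>t. fps_nth (K 0 t + fps_const (t ^ e) * K 1 t * y t + y t ^ 2 * Q t) j"
      have "regular (\<lambda>t. inverse (d t) * - ?r t)"
        using has_germ_inverse[OF U] \<open>j < Suc (Suc n)\<close>
        by (intro regular_mult regular_uminus regular_belowD[OF rhs]) (auto simp: regular_def)
      moreover have "\<forall>\<^sub>F t in at 0. inverse (d t) * - ?r t = fps_nth (y t) j"
        using main has_germ_nonzero[OF U]
      proof eventually_elim
        case (elim t)
        then have "d t * fps_nth (y t) j = - ?r t"
          by (metis fps_mult_left_const_nth fps_neg_nth)
        with elim(2) show ?case by (metis mult.assoc left_inverse mult_1)
      qed
      ultimately show "regular (\<lambda>t. fps_nth (y t) j)" by (rule regular_cong)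
    qed
  qed
  from regular_belowD[OF this[of m], of m] have y_reg: "regular (\<lambda>t. fps_nth (y t) m)" by simp
  show ?thesis
  proof (cases "m = 0")
    case True
    then show ?thesis using z0 by simp
  next
    case False
    have nz: "\<forall>\<^sub>F t in at (0::complex). t \<noteq> 0" by (simp add: eventually_at_filter)
    have "regular (\<lambda>t. t ^ e * fps_nth (y t) m)" by (intro regular_mult regular_power_ident y_reg)
    moreover have "\<forall>\<^sub>F t in at 0. t ^ e * fps_nth (y t) m = t ^ (M * m) * fps_nth (\<beta> t) m"
      using nz by eventually_elim (use False in \<open>simp add: y_def\<close>)
    ultimately show ?thesis by (rule regular_cong)
  qed
qed

section \<open>Regularity of the roots after rescaling\<close>

text \<open>The coefficient is a sum of products of \<open>card I - j\<close> of the roots.\<close>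

lemma ordge_coeff_prod:
  assumes "finite I" "\<And>i. i \<in> I \<Longrightarrow> mps_coeff (b i) 0 = 0"
  shows "ordge (card I - j) (coeff (\<Prod>i\<in>I. [:- b i, 1:]) j)"
  using assms
proof (induction I arbitrary: j rule: finite_induct)
  case (insert i I)
  let ?P = "\<Prod>i\<in>I. [:- b i, 1:]"
  have IH: "ordge (card I - j) (coeff ?P j)" for j using insert by simp
  have "ordge (1 + (card I - j)) (- b i * coeff ?P j)"
    by (intro ordge_mult IH ordge_uminus) (use insert in \<open>auto simp: ordge_1_iff\<close>)
  then have 1: "ordge (Suc (card I) - j) (- b i * coeff ?P j)" by (rule ordge_mono) simp
  have 2: "ordge (Suc (card I) - j) (case j of 0 \<Rightarrow> 0 | Suc i \<Rightarrow> coeff ?P i)"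
    using IH by (cases j) auto
  show ?case
    unfolding prod.insert[OF insert.hyps] card_insert_disjoint[OF insert.hyps] coeff_linear_mult
    by (rule ordge_add[OF 1 2])
qed simp

text \<open>The series \<open>F(q x) / q ^ n\<close>. If roots of a monic polynomial are rescaled with \<open>n = 1\<close>, the \<open>i\<close>-th
  coefficient is rescaled with \<open>n = i\<close>.\<close>

definition rescale :: "complex \<Rightarrow> nat \<Rightarrow> (complex, 'v::finite) mps \<Rightarrow> (complex, 'v) mps" where
  "rescale q n F = Abs_mps (\<lambda>\<beta>. q ^ mdeg \<beta> / q ^ n * mps_coeff F \<beta>)"

lemma rescale_mult: "rescale q (m + n) (F * G) = rescale q m F * rescale q n G"
proof (rule mps_eqI)
  fix \<beta>
  show "mps_coeff (rescale q (m + n) (F * G)) \<beta> = mps_coeff (rescale q m F * rescale q n G) \<beta>"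
    unfolding mps_coeff_mult rescale_def mps_coeff_Abs sum_distrib_left
    by (rule sum.cong) (auto simp: mdeg_add power_add)
qed

lemma rescale_add: "rescale q n (F + G) = rescale q n F + rescale q n G"
  and rescale_uminus: "rescale q n (- F) = - rescale q n F"
  and rescale_0: "rescale q n 0 = 0"
  by (rule mps_eqI, simp add: rescale_def ring_distribs add_divide_distrib)+

lemma coeff_prod_rescale:
  assumes "finite I" "j \<le> card I"
  shows "coeff (\<Prod>i\<in>I. [:- rescale q 1 (b i), 1:]) j = rescale q (card I - j) (coeff (\<Prod>i\<in>I. [:- b i, 1:]) j)"
  using assms
proof (induction I arbitrary: j rule: finite_induct)
  case empty
  have "rescale q 0 1 = 1" by (rule mps_eqI) (simp add: rescale_def mps_coeff_1)
  with empty show ?case by simp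
next
  case (insert i I)
  let ?P = "\<Prod>i\<in>I. [:- b i, 1:]" and ?P' = "\<Prod>i\<in>I. [:- rescale q 1 (b i), 1:]"
  have 1: "- rescale q 1 (b i) * coeff ?P' j = rescale q (Suc (card I) - j) (- b i * coeff ?P j)"
  proof (cases "j \<le> card I")
    case True
    then have "rescale q (Suc (card I) - j) (- b i * coeff ?P j) = rescale q 1 (- b i) * rescale q (card I - j) (coeff ?P j)"
      by (subst rescale_mult[symmetric]) (simp add: Suc_diff_le)
    with True insert.IH show ?thesis by (simp add: rescale_uminus)
  next
    case False
    then show ?thesis using coeff_prod_above[of I j b] coeff_prod_above[of I j "\<lambda>i. rescale q 1 (b i)"] insert.hyps
      by (simp add: rescale_0)
  qed
  have 2: "(case j of 0 \<Rightarrow> 0 | Suc i \<Rightarrow> coeff ?P' i) = rescale q (Suc (card I) - j) (case j of 0 \<Rightarrow> 0 | Suc i \<Rightarrow> coeff ?P i)"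
    using insert by (cases j) (auto simp: rescale_0)
  show ?case
    unfolding prod.insert[OF insert.hyps] card_insert_disjoint[OF insert.hyps] coeff_linear_mult rescale_add 1 2 ..
qed

lemma slice_rescale:
  assumes "q \<noteq> 0"
  shows "fps_nth (slice u (rescale q 1 F)) (Suc m) = q ^ m * fps_nth (slice u F) (Suc m)"
  unfolding slice_nth sum_distrib_left using assms by (intro sum.cong) (auto simp: rescale_def)

lemma map_poly_slice_prod:
  "map_poly (slice u) (\<Prod>i\<in>I. [:- b i, 1:]) = (\<Prod>i\<in>I. [:- slice u (b i), 1:])"
proof (induction I rule: infinite_finite_induct)
  case (insert i I)
  show ?case
  proof (rule poly_eqI)
    fix j
    have "coeff (map_poly (slice u) ([:- b i, 1:] * (\<Prod>i\<in>I. [:- b i, 1:]))) j =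
        slice u (coeff ([:- b i, 1:] * (\<Prod>i\<in>I. [:- b i, 1:])) j)"
      by (simp add: coeff_map_poly)
    also have "\<dots> = - slice u (b i) * coeff (map_poly (slice u) (\<Prod>i\<in>I. [:- b i, 1:])) j +
        (case j of 0 \<Rightarrow> 0 | Suc l \<Rightarrow> coeff (map_poly (slice u) (\<Prod>i\<in>I. [:- b i, 1:])) l)"
      unfolding coeff_linear_mult by (cases j) (simp_all add: coeff_map_poly)
    also have "\<dots> = coeff ([:- slice u (b i), 1:] * (\<Prod>i\<in>I. [:- slice u (b i), 1:])) j"
      unfolding insert.IH coeff_linear_mult ..
    finally show "coeff (map_poly (slice u) (\<Prod>i\<in>insert i I. [:- b i, 1:])) j =
        coeff (\<Prod>i\<in>insert i I. [:- slice u (b i), 1:]) j"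
      unfolding prod.insert[OF insert.hyps] .
  qed
qed (simp_all add: map_poly_1')

lemma map_poly_slice_weierstrass:
  "map_poly (slice u) (weierstrass k A) = weierstrass k (\<lambda>i. slice u (A i))"
  by (rule poly_eqI) (simp add: coeff_map_poly coeff_weierstrass)

lemma coeff_pcompose_scale: "coeff (pcompose P [:0, a:]) j = a ^ j * coeff P j"
  for a :: "'a::comm_ring_1"
proof (induction P arbitrary: j)
  case (pCons c P)
  then show ?case by (cases j) (simp_all add: pcompose_pCons mult.assoc)
qed simp

lemma pcompose_prod': "pcompose (\<Prod>i\<in>I. F i) q = (\<Prod>i\<in>I. pcompose (F i) q)"
  by (induction I rule: infinite_finite_induct) (auto simp: pcompose_mult pcompose_1)

lemma ordge_of_splitting:
  assumes I: "finite I" "card I = k" and b0: "\<And>i. i \<in> I \<Longrightarrow> mps_coeff (b i) 0 = 0"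
    and split: "weierstrass k A = (\<Prod>i\<in>I. [:- b i, 1:])" and i: "i \<in> {1..k}"
  shows "ordge i (A i)"
proof -
  have "A i = coeff (weierstrass k A) (k - i)" using i by (auto simp: coeff_weierstrass)
  then show ?thesis using ordge_coeff_prod[of I b "k - i"] I b0 i by (simp add: split)
qed

text \<open>On the line \<open>x = s u\<close> put \<open>z = s z'\<close>. All roots vanish at \<open>s = 0\<close>, so the polynomial becomes divisible by
  \<open>s ^ k\<close>, and the quotient has the roots divided by \<open>s\<close>. At \<open>s = 0\<close> these new roots are the values at \<open>u\<close> of the
  linear parts.\<close>

lemma slices_split:
  fixes b :: "'i \<Rightarrow> (complex, 'v::finite) mps"
  assumes I: "finite I" "card I = k" and b0: "\<And>i. i \<in> I \<Longrightarrow> mps_coeff (b i) 0 = 0"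
    and split: "weierstrass k A = (\<Prod>i\<in>I. [:- b i, 1:])"
  shows "weierstrass k (\<lambda>i. fps_shift i (slice u (A i))) = (\<Prod>i\<in>I. [:- fps_shift 1 (slice u (b i)), 1:])"
    (is "?W = ?P")
proof -
  have ordA: "ordge i (A i)" if "i \<in> {1..k}" for i
    by (rule ordge_of_splitting[OF I b0 split that])
  have A: "slice u (A i) = fps_X ^ i * fps_shift i (slice u (A i))" if "i \<in> {1..k}" for i
  proof -
    have "fps_nth (slice u (A i)) n = 0" if "n < i" for n
      unfolding slice_nth using ordge_D[OF ordA[OF \<open>i \<in> {1..k}\<close>]] that by simp
    then show ?thesis by (auto simp: fps_eq_iff fps_X_power_mult_nth)
  qed
  have b: "slice u (b i) = fps_X * fps_shift 1 (slice u (b i))" if "i \<in> I" for i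
    using b0[OF that] by (auto simp: fps_eq_iff)
  have "smult (fps_X ^ k) ?W = pcompose (weierstrass k (\<lambda>i. slice u (A i))) [:0, fps_X:]"
  proof (rule poly_eqI)
    fix j
    have "fps_X ^ j * slice u (A (k - j)) = fps_X ^ k * fps_shift (k - j) (slice u (A (k - j)))" if "j < k"
      using A[of "k - j"] that by (metis (no_types) add_diff_inverse_nat atLeastAtMost_iff diff_le_self
          less_imp_le_nat mult.assoc not_less power_add zero_less_diff Suc_leI One_nat_def)
    then show "coeff (smult (fps_X ^ k) ?W) j = coeff (pcompose (weierstrass k (\<lambda>i. slice u (A i))) [:0, fps_X:]) j"
      by (simp add: coeff_pcompose_scale coeff_weierstrass)
  qed
  also have "weierstrass k (\<lambda>i. slice u (A i)) = (\<Prod>i\<in>I. [:- slice u (b i), 1:])"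
    unfolding map_poly_slice_weierstrass[symmetric] split by (rule map_poly_slice_prod)
  also have "pcompose \<dots> [:0, fps_X:] = (\<Prod>i\<in>I. smult fps_X [:- fps_shift 1 (slice u (b i)), 1:])"
    unfolding pcompose_prod'
  proof (rule prod.cong[OF refl])
    fix i assume "i \<in> I"
    have "pcompose [:- slice u (b i), 1:] [:0, fps_X:] = [:- slice u (b i), fps_X:]"
      by (simp add: pcompose_pCons)
    also have "\<dots> = [:- (fps_X * fps_shift 1 (slice u (b i))), fps_X:]"
      using b[OF \<open>i \<in> I\<close>] by metis
    also have "\<dots> = smult fps_X [:- fps_shift 1 (slice u (b i)), 1:]" by simp
    finally show "pcompose [:- slice u (b i), 1:] [:0, fps_X:] = smult fps_X [:- fps_shift 1 (slice u (b i)), 1:]" .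
  qed
  also have "\<dots> = smult (fps_X ^ k) ?P" unfolding prod_smult by (simp add: I)
  finally have eq: "smult (fps_X ^ k) ?W = smult (fps_X ^ k) ?P" .
  show ?thesis
  proof (rule poly_eqI)
    fix j
    from arg_cong[OF eq, of "\<lambda>p. coeff p j"]
    have "fps_X ^ k * coeff ?W j = fps_X ^ k * coeff ?P j" unfolding coeff_smult .
    then show "coeff ?W j = coeff ?P j" unfolding mult_cancel_left by simp
  qed
qed

lemma fps_nth_0_prod: "fps_nth (prod F J) 0 = (\<Prod>j\<in>J. fps_nth (F j) 0)"
  for F :: "'i \<Rightarrow> 'a::comm_ring_1 fps"
  by (induction J rule: infinite_finite_induct) auto

lemma coeff_1_prod_linear:
  fixes c :: "'i \<Rightarrow> 'a::comm_ring_1 fps"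
  assumes "finite I" "i \<in> I" "fps_nth (c i) 0 = 0"
  shows "fps_nth (coeff (\<Prod>j\<in>I. [:c j, 1:]) 1) 0 = (\<Prod>j\<in>I - {i}. fps_nth (c j) 0)"
proof -
  let ?P = "\<Prod>j\<in>I - {i}. [:c j, 1:]"
  have "(\<Prod>j\<in>I. [:c j, 1:]) = [:c i, 1:] * ?P" using assms by (simp add: prod.remove)
  then have "fps_nth (coeff (\<Prod>j\<in>I. [:c j, 1:]) 1) 0 = fps_nth (coeff ?P 0) 0"
    using assms(3) by simp
  also have "coeff ?P 0 = (\<Prod>j\<in>I - {i}. c j)"
    by (simp add: poly_0_coeff_0[symmetric] poly_prod)
  also have "fps_nth \<dots> 0 = (\<Prod>j\<in>I - {i}. fps_nth (c j) 0)"
    by (rule fps_nth_0_prod)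
  finally show ?thesis .
qed

text \<open>Apply \<open>simple_root_rescaled_regular\<close> to the roots divided by \<open>s\<close> on the lines \<open>x = s u\<close>. The derivative
  of the polynomial at such a root is, at \<open>s = 0\<close>, the product of the differences of the values at \<open>u\<close> of the
  linear parts, and vanishes at \<open>t = 0\<close> to an order that is the same for all directions \<open>u\<close> outside
  finitely many hyperplanes. The coefficients of the roots are then recovered from these lines.\<close>

lemma rescaled_roots_regular:
  fixes A :: "nat \<Rightarrow> complex \<Rightarrow> (complex, 'v::finite) mps" and b :: "'v \<Rightarrow> complex \<Rightarrow> (complex, 'v) mps"
    and L :: "'v \<Rightarrow> 'v \<Rightarrow> complex fps"
  assumes k: "CARD('v) = k"
    and A: "\<And>i \<beta>. i \<in> {1..k} \<Longrightarrow> regular (\<lambda>t. mps_coeff (A i t) \<beta>)"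
    and split: "\<forall>\<^sub>F t in at 0. weierstrass k (\<lambda>i. A i t) = (\<Prod>i\<in>UNIV. [:- b i t, 1:])"
    and b0: "\<forall>\<^sub>F t in at 0. \<forall>i. mps_coeff (b i t) 0 = 0"
    and inj: "\<forall>\<^sub>F t in at 0. inj (\<lambda>i. linear_part (b i t))"
    and L: "\<And>i j. has_germ (\<lambda>t. linear_part (b i t) $ j) (L i j)"
  shows "\<exists>N. \<forall>M\<ge>N. \<forall>i \<beta>. regular (\<lambda>t. mps_coeff (rescale (t ^ M) 1 (b i t)) \<beta>)"
proof -
  have nz: "\<forall>\<^sub>F t in at (0::complex). t \<noteq> 0" by (simp add: eventually_at_filter)
  (* The difference of the i-th and j-th linear parts is t^(e i j) times a family of vectors whose
    value at t = 0 is l i j, a nonzero vector. *)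
  define e where "e i j = (LEAST n. \<exists>m. fps_nth (L i m - L j m) n \<noteq> 0)" for i j
  define l where "l i j = (\<chi> m. fps_nth (L i m - L j m) (e i j))" for i j
  have ne: "\<exists>n m. fps_nth (L i m - L j m) n \<noteq> 0" if "i \<noteq> j" for i j
  proof (rule ccontr)
    assume "\<not> ?thesis"
    then have "L i m - L j m = 0" for m by (auto simp: fps_eq_iff)
    then have "has_germ (\<lambda>t. linear_part (b i t) $ m - linear_part (b j t) $ m) 0" for m
      using has_germ_diff[OF L[of i m] L[of j m]] by simp
    then have "\<forall>\<^sub>F t in at 0. \<forall>m. linear_part (b i t) $ m - linear_part (b j t) $ m = 0"
      by (intro eventually_all_finite has_germ_0D)
    with inj have "\<forall>\<^sub>F t in at (0::complex). False"
      by eventually_elim (use that in \<open>auto simp: inj_def vec_eq_iff\<close>)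
    then show False by (simp add: trivial_limit_def[symmetric])
  qed
  have l_nz: "l i j \<noteq> 0" if "i \<noteq> j" for i j
  proof -
    have "\<exists>m. fps_nth (L i m - L j m) (e i j) \<noteq> 0" unfolding e_def by (rule LeastI_ex[OF ne[OF that]])
    then show ?thesis by (auto simp: l_def vec_eq_iff)
  qed
  have L_shift: "L i m - L j m = fps_X ^ e i j * fps_shift (e i j) (L i m - L j m)" for i j m
  proof -
    have "fps_nth (L i m - L j m) n = 0" if "n < e i j" for n
      using not_less_Least[OF that[unfolded e_def]] by blast
    then show ?thesis by (auto simp: fps_eq_iff fps_X_power_mult_nth)
  qed
  define V where "V u i j = (\<Sum>m\<in>UNIV. fps_shift (e i j) (L i m - L j m) * fps_const (u $ m))" for u i j
  have V0: "fps_nth (V u i j) 0 = form (l i j) u" for u i j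
    by (simp add: V_def fps_sum_nth form_def l_def)
  define \<delta> where "\<delta> u i j t = form (linear_part (b i t) - linear_part (b j t)) u" for u i j t
  have \<delta>: "has_germ (\<lambda>t. \<delta> u i j t / t ^ e i j) (V u i j)" for u i j
  proof (rule has_germ_divide_power)
    have "has_germ (\<delta> u i j) (\<Sum>m\<in>UNIV. (L i m - L j m) * fps_const (u $ m))"
      unfolding \<delta>_def form_def vector_minus_component
      by (intro has_germ_sum has_germ_mult has_germ_diff L has_germ_const)
    also have "(\<Sum>m\<in>UNIV. (L i m - L j m) * fps_const (u $ m)) = fps_X ^ e i j * V u i j"
      unfolding V_def sum_distrib_left by (intro sum.cong refl) (subst L_shift, simp add: mult.assoc)
    finally show "has_germ (\<delta> u i j) (fps_X ^ e i j * V u i j)" .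
  qed
  define E where "E i = (\<Sum>j\<in>UNIV - {i}. e i j)" for i
  have slices: "regular (\<lambda>t. fps_nth (slice u (rescale (t ^ M) 1 (b i t))) (Suc m))"
    if M: "M \<ge> 2 * E i" and u: "\<And>j. j \<noteq> i \<Longrightarrow> form (l i j) u \<noteq> 0" for M i u m
  proof -
    let ?a = "\<lambda>i t. fps_shift i (slice u (A i t))"
    let ?\<beta> = "\<lambda>i t. fps_shift 1 (slice u (b i t))"
    have \<beta>0: "fps_nth (?\<beta> j t) 0 = form (linear_part (b j t)) u" for j t
      using slice_nth_1[of u "b j t"] by simp
    have W: "\<forall>\<^sub>F t in at 0. weierstrass k (\<lambda>i. ?a i t) = (\<Prod>j\<in>UNIV. [:- ?\<beta> j t, 1:])"
      using split b0 by eventually_elim (rule slices_split, use k in auto)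
    have "regular (\<lambda>t. t ^ (M * m) * fps_nth (?\<beta> i t) m)"
    proof (rule simple_root_rescaled_regular[where a = ?a and e = "E i" and
          d = "\<lambda>t. \<Prod>j\<in>UNIV - {i}. \<delta> u i j t / t ^ e i j" and U = "\<Prod>j\<in>UNIV - {i}. V u i j"])
      show "regular_below n (?a i)" if "i \<in> {1..k}" for i n
        unfolding regular_below_def fps_shift_nth slice_nth
        by (intro allI impI regular_sum regular_mult A that regular_const)
      show "\<forall>\<^sub>F t in at 0. poly (weierstrass k (\<lambda>i. ?a i t)) (?\<beta> i t) = 0"
        using W
      proof eventually_elim
        case (elim t)
        show ?case unfolding elim poly_prod by (rule prod_zero) auto
      qed
      have "has_germ (\<lambda>t. form (linear_part (b i t)) u) (\<Sum>m\<in>UNIV. L i m * fps_const (u $ m))"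
        unfolding form_def by (intro has_germ_sum has_germ_mult L has_germ_const)
      then show "regular (\<lambda>t. fps_nth (?\<beta> i t) 0)" unfolding \<beta>0 regular_def by blast
      show "\<forall>\<^sub>F t in at 0. fps_nth (coeff (pcompose (weierstrass k (\<lambda>i. ?a i t))
          [:fps_const (fps_nth (?\<beta> i t) 0), 1:]) 1) 0 = t ^ E i * (\<Prod>j\<in>UNIV - {i}. \<delta> u i j t / t ^ e i j)"
        using W nz
      proof eventually_elim
        case (elim t)
        let ?z = "fps_const (fps_nth (?\<beta> i t) 0)"
        have "pcompose (weierstrass k (\<lambda>i. ?a i t)) [:?z, 1:] = (\<Prod>j\<in>UNIV. [:?z - ?\<beta> j t, 1:])"
          unfolding elim(1) pcompose_prod' by (simp add: pcompose_pCons)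
        then have "fps_nth (coeff (pcompose (weierstrass k (\<lambda>i. ?a i t)) [:?z, 1:]) 1) 0
            = (\<Prod>j\<in>UNIV - {i}. fps_nth (?z - ?\<beta> j t) 0)"
          by (simp only:) (rule coeff_1_prod_linear, simp_all)
        also have "\<dots> = (\<Prod>j\<in>UNIV - {i}. t ^ e i j * (\<delta> u i j t / t ^ e i j))"
        proof (rule prod.cong[OF refl])
          fix j
          have "fps_nth (?z - ?\<beta> j t) 0 = \<delta> u i j t"
            using \<beta>0[of i t] \<beta>0[of j t] by (simp add: \<delta>_def)
          then show "fps_nth (?z - ?\<beta> j t) 0 = t ^ e i j * (\<delta> u i j t / t ^ e i j)"
            using elim(2) by simp
        qed
        also have "\<dots> = t ^ E i * (\<Prod>j\<in>UNIV - {i}. \<delta> u i j t / t ^ e i j)"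
          unfolding prod.distrib E_def power_sum ..
        finally show ?case .
      qed
      show "has_germ (\<lambda>t. \<Prod>j\<in>UNIV - {i}. \<delta> u i j t / t ^ e i j) (\<Prod>j\<in>UNIV - {i}. V u i j)"
        by (intro has_germ_prod \<delta>)
      show "fps_nth (\<Prod>j\<in>UNIV - {i}. V u i j) 0 \<noteq> 0"
        unfolding fps_nth_0_prod V0 using u by simp
      show "2 * E i \<le> M" by (rule M)
    qed
    moreover have "\<forall>\<^sub>F t in at 0. t ^ (M * m) * fps_nth (?\<beta> i t) m = fps_nth (slice u (rescale (t ^ M) 1 (b i t))) (Suc m)"
      using nz by eventually_elim (subst slice_rescale, simp_all add: power_mult)
    ultimately show ?thesis by (rule regular_cong)
  qed
  show ?thesis
  proof (intro exI[of _ "2 * (\<Sum>i\<in>UNIV. E i)"] allI impI)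
    fix M i \<beta> assume M: "M \<ge> 2 * (\<Sum>i\<in>UNIV. E i)"
    have "E i \<le> (\<Sum>i\<in>UNIV. E i)" by (rule member_le_sum) auto
    with M have M: "M \<ge> 2 * E i" by linarith
    show "regular (\<lambda>t. mps_coeff (rescale (t ^ M) 1 (b i t)) \<beta>)"
    proof (cases "\<beta> = 0")
      case True
      have "\<forall>\<^sub>F t in at 0. 0 = mps_coeff (rescale (t ^ M) 1 (b i t)) \<beta>"
        using b0 by eventually_elim (simp add: True rescale_def)
      then show ?thesis by (rule regular_cong[OF regular_const])
    next
      case False
      then obtain m where m: "mdeg \<beta> = Suc m" by (metis mdeg_eq_0_iff not0_implies_Suc)
      let ?\<Lambda> = "(\<lambda>j. l i j) ` (UNIV - {i})"
      have "finite ?\<Lambda>" "0 \<notin> ?\<Lambda>" using l_nz[of i] by force+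
      from coeff_from_generic_slices[OF this, of \<beta>] obtain G \<mu> where
        G: "\<forall>u\<in>G. \<forall>l\<in>?\<Lambda>. form l u \<noteq> 0"
        "\<forall>F. mps_coeff F \<beta> = (\<Sum>u\<in>G. \<mu> u * fps_nth (slice u F) (mdeg \<beta>))" by blast
      show ?thesis unfolding G(2)[rule_format] m
        by (intro regular_sum regular_mult regular_const slices M) (use G(1) in auto)
    qed
  qed
qed

section \<open>Strict transforms on coefficients\<close>

definition setw :: "'v::finite \<Rightarrow> nat \<Rightarrow> nat ^ 'v \<Rightarrow> nat ^ 'v" where
  "setw w m \<gamma> = (\<chi> i. if i = w then m else \<gamma> $ i)"

definition xdeg :: "'v::finite \<Rightarrow> nat ^ 'v \<Rightarrow> nat" where
  "xdeg w \<gamma> = (\<Sum>i\<in>UNIV - {w}. \<gamma> $ i)"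

lemma setw_simps [simp]: "setw w m \<gamma> $ w = m" "setw w m (setw w n \<gamma>) = setw w m \<gamma>" "xdeg w (setw w m \<gamma>) = xdeg w \<gamma>"
  "setw w (\<gamma> $ w) \<gamma> = \<gamma>"
  by (auto simp: setw_def xdeg_def vec_eq_iff)

lemma mdeg_xdeg: "mdeg \<gamma> = \<gamma> $ w + xdeg w \<gamma>"
  unfolding mdeg_def xdeg_def by (subst sum.remove[of _ w]) auto

lemma blowup_subst_coeff:
  fixes A :: "('a::comm_ring_1, 'v::finite) mps" and w :: 'v
  defines "S \<equiv> \<lambda>i. if i = w then mps_var w else mps_var w * mps_var i"
  shows "mps_coeff (mps_subst A S) \<gamma> = (if xdeg w \<gamma> \<le> \<gamma> $ w then mps_coeff A (setw w (\<gamma> $ w - xdeg w \<gamma>) \<gamma>) else 0)"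
proof -
  define g where "g i = (if i = w then axis w 1 else axis w 1 + axis i (1::nat))" for i :: 'v
  have sum: "(\<Sum>i\<in>UNIV. \<chi> j. \<alpha> $ i * g i $ j) = setw w (mdeg \<alpha>) \<alpha>" for \<alpha>
  proof -
    have "(\<Sum>i\<in>UNIV. \<alpha> $ i * g i $ j) = setw w (mdeg \<alpha>) \<alpha> $ j" for j
    proof (cases "j = w")
      case True
      have "(\<Sum>i\<in>UNIV. \<alpha> $ i * g i $ j) = (\<Sum>i\<in>UNIV. \<alpha> $ i)"
        by (rule sum.cong) (auto simp: g_def True axis_def)
      then show ?thesis by (simp add: True mdeg_def)
    next
      case False
      have "(\<Sum>i\<in>UNIV. \<alpha> $ i * g i $ j) = (\<Sum>i\<in>UNIV. if i = j then \<alpha> $ j else 0)"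
        by (rule sum.cong) (use False in \<open>auto simp: g_def axis_def\<close>)
      then show ?thesis using False by (simp add: setw_def)
    qed
    then show ?thesis by (simp add: vec_eq_iff)
  qed
  show ?thesis
  proof (rule coeff_monomial_subst[OF _ sum])
    show "S i = mps_monom (g i)" for i
      by (simp add: S_def g_def mps_var_eq_monom mps_monom_add)
    show "setw w (mdeg \<alpha>) \<alpha> = \<gamma> \<longleftrightarrow> xdeg w \<gamma> \<le> \<gamma> $ w \<and> \<alpha> = setw w (\<gamma> $ w - xdeg w \<gamma>) \<gamma>" for \<alpha>
      by (auto simp: mdeg_xdeg[of _ w])
    show "mdeg (setw w (\<gamma> $ w - xdeg w \<gamma>) \<gamma>) \<le> mdeg \<gamma>" by (simp add: mdeg_xdeg[of _ w])
  qed
qed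

lemma root_subst_coeff:
  fixes A :: "('a::comm_ring_1, 'v::finite) mps" and w :: 'v
  assumes p: "p > 0"
  defines "S \<equiv> \<lambda>i. if i = w then mps_var w ^ p else mps_var i"
  shows "mps_coeff (mps_subst A S) \<gamma> = (if p dvd \<gamma> $ w then mps_coeff A (setw w (\<gamma> $ w div p) \<gamma>) else 0)"
proof -
  define g where "g i = (if i = w then axis w p else axis i (1::nat))" for i :: 'v
  have sum: "(\<Sum>i\<in>UNIV. \<chi> j. \<alpha> $ i * g i $ j) = setw w (p * \<alpha> $ w) \<alpha>" for \<alpha>
  proof -
    have "(\<Sum>i\<in>UNIV. \<alpha> $ i * g i $ j) = (\<Sum>i\<in>UNIV. if i = j then setw w (p * \<alpha> $ w) \<alpha> $ j else 0)" for j
      by (rule sum.cong) (auto simp: g_def axis_def setw_def)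
    then show ?thesis by (simp add: vec_eq_iff)
  qed
  show ?thesis
  proof (rule coeff_monomial_subst[OF _ sum])
    have "(\<chi> j. p * axis w 1 $ j) = axis w p" by (simp add: vec_eq_iff axis_def)
    then show "S i = mps_monom (g i)" for i
      by (simp add: S_def g_def mps_var_eq_monom mps_monom_power)
    show "setw w (p * \<alpha> $ w) \<alpha> = \<gamma> \<longleftrightarrow> p dvd \<gamma> $ w \<and> \<alpha> = setw w (\<gamma> $ w div p) \<gamma>" for \<alpha>
      using p by auto
    show "mdeg (setw w (\<gamma> $ w div p) \<gamma>) \<le> mdeg \<gamma>" by (simp add: mdeg_xdeg[of _ w])
  qed
qed

text \<open>The series \<open>A(w, w ^ N x) / w ^ (N i)\<close>, where \<open>A\<close> is meant to have order at least \<open>i\<close> in \<open>x\<close>, so that no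
  negative power of \<open>w\<close> occurs: the monomial \<open>w ^ m x ^ \<beta>\<close> goes to \<open>w ^ (m + N (\<bar>\<beta>\<bar> - i)) x ^ \<beta>\<close>.
  This is the effect of \<open>N\<close> blowings-up on the \<open>i\<close>-th coefficient.\<close>

definition blowup :: "'v::finite \<Rightarrow> nat \<Rightarrow> nat \<Rightarrow> ('a::comm_ring_1, 'v) mps \<Rightarrow> ('a, 'v) mps" where
  "blowup w N i A = Abs_mps (\<lambda>\<gamma>. if i \<le> xdeg w \<gamma> \<and> N * (xdeg w \<gamma> - i) \<le> \<gamma> $ w
     then mps_coeff A (setw w (\<gamma> $ w - N * (xdeg w \<gamma> - i)) \<gamma>) else 0)"

lemma map_poly_weierstrass:
  assumes "h 0 = 0" "h 1 = 1"
  shows "map_poly h (weierstrass k A) = weierstrass k (\<lambda>i. h (A i))"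
  by (rule poly_eqI) (simp add: coeff_map_poly coeff_weierstrass assms)

lemma mps_coeff_var_power_mult:
  fixes F :: "('a::comm_ring_1, 'v::finite) mps"
  shows "mps_coeff (mps_var w ^ n * F) \<gamma> = (if n \<le> \<gamma> $ w then mps_coeff F (setw w (\<gamma> $ w - n) \<gamma>) else 0)"
proof -
  have "mps_var w ^ n = (mps_monom (axis w n) :: ('a, 'v) mps)"
    unfolding mps_var_eq_monom mps_monom_power by (intro arg_cong[of _ _ mps_monom]) (simp add: vec_eq_iff axis_def)
  moreover have "\<gamma> = axis w n + setw w (\<gamma> $ w - n) \<gamma>" if "n \<le> \<gamma> $ w"
    using that by (auto simp: vec_eq_iff axis_def setw_def)
  moreover have "\<gamma> \<noteq> axis w n + \<eta>" if "\<not> n \<le> \<gamma> $ w" for \<eta>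
    using that by (auto simp: axis_def)
  ultimately show ?thesis
    using mps_coeff_monom_mult_add[of "axis w n" F "setw w (\<gamma> $ w - n) \<gamma>"]
      mps_coeff_monom_mult_not[of \<gamma> "axis w n" F] by (cases "n \<le> \<gamma> $ w") auto
qed

lemma strict_transform_blowup:
  fixes A :: "nat \<Rightarrow> (complex, 'v::finite) mps"
  shows "strict_transform w k (weierstrass k (\<lambda>i. blowup w N i (A i))) (weierstrass k (\<lambda>i. blowup w (Suc N) i (A i)))"
proof -
  let ?S = "\<lambda>c :: (complex, 'v) mps. mps_subst c (\<lambda>i. if i = w then mps_var w else mps_var w * mps_var i)"
  interpret mps_substitution "\<lambda>i. if i = w then mps_var w else mps_var w * mps_var i :: (complex, 'v) mps"
    by unfold_locales (auto simp: mps_coeff_var mps_coeff_mult_0)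
  (* The substitution (w, w x) for (w, x) turns A(w, w^N x) / w^(N i) into A(w, w^(N+1) x) / w^(N i). *)
  have main: "?S (blowup w N i B) = mps_var w ^ i * blowup w (Suc N) i B" for i and B :: "(complex, 'v) mps"
  proof (rule mps_eqI)
    fix \<gamma> :: "nat ^ 'v"
    show "mps_coeff (?S (blowup w N i B)) \<gamma> = mps_coeff (mps_var w ^ i * blowup w (Suc N) i B) \<gamma>"
    proof (cases "i \<le> xdeg w \<gamma>")
      case True
      then obtain d where d: "xdeg w \<gamma> = i + d" using le_Suc_ex by blast
      have "(i + d \<le> \<gamma> $ w \<and> N * d \<le> \<gamma> $ w - (i + d)) \<longleftrightarrow> (i \<le> \<gamma> $ w \<and> Suc N * d \<le> \<gamma> $ w - i)"
        by auto
      moreover have "\<gamma> $ w - (i + d) - N * d = \<gamma> $ w - i - Suc N * d" by simp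
      ultimately show ?thesis
        unfolding blowup_subst_coeff mps_coeff_var_power_mult blowup_def mps_coeff_Abs setw_simps d
        by auto
    qed (simp add: blowup_subst_coeff mps_coeff_var_power_mult blowup_def)
  qed
  show ?thesis
    unfolding strict_transform_def
  proof (subst map_poly_weierstrass, rule subst_0, rule subst_1, rule poly_eqI)
    fix j
    show "coeff (pcompose (weierstrass k (\<lambda>i. ?S (blowup w N i (A i)))) [:0, mps_var w:]) j =
      coeff (smult (mps_var w ^ k) (weierstrass k (\<lambda>i. blowup w (Suc N) i (A i)))) j"
    proof (cases "j < k")
      case True
      then have "mps_var w ^ j * mps_var w ^ (k - j) = (mps_var w ^ k :: (complex, 'v) mps)"
        by (simp flip: power_add)
      then show ?thesis using True
        by (simp add: coeff_pcompose_scale coeff_weierstrass main flip: mult.assoc)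
    qed (simp add: coeff_pcompose_scale coeff_weierstrass)
  qed
qed

lemma iterated_strict_transform:
  assumes "\<And>i \<gamma>. i \<in> {1..k} \<Longrightarrow> xdeg w \<gamma> < i \<Longrightarrow> mps_coeff (A i) \<gamma> = 0"
  shows "(strict_transform w k ^^ N) (weierstrass k A) (weierstrass k (\<lambda>i. blowup w N i (A i)))"
proof (induction N)
  case 0
  have "blowup w 0 i (A i) = A i" if "i \<in> {1..k}" for i
    by (rule mps_eqI) (use assms[OF that] in \<open>simp add: blowup_def\<close>)
  then have "weierstrass k (\<lambda>i. blowup w 0 i (A i)) = weierstrass k A"
    by (intro poly_eqI) (auto simp: coeff_weierstrass)
  then show ?case by simp
next
  case (Suc N)
  then show ?case using strict_transform_blowup[of w k N A] by auto
qed

text \<open>The coefficients of the series \<open>G t\<close> in \<open>x\<close> are regular functions of \<open>t\<close>, and \<open>H\<close> collects their Taylor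
  series: the variable \<open>w\<close> of \<open>H\<close> stands for \<open>t\<close>. This is how identities that hold for each \<open>t \<noteq> 0\<close>
  become identities of formal power series.\<close>

definition mps_has_germ :: "'v::finite \<Rightarrow> (complex \<Rightarrow> (complex, 'v) mps) \<Rightarrow> (complex, 'v) mps \<Rightarrow> bool" where
  "mps_has_germ w G H \<longleftrightarrow> (\<forall>\<beta>. \<beta> $ w = 0 \<longrightarrow> has_germ (\<lambda>t. mps_coeff (G t) \<beta>) (axis_coeffs w H \<beta>))"

lemma axis_coeffs_nth: "fps_nth (axis_coeffs w H \<beta>) m = mps_coeff H (\<beta> + axis w m)"
  by (simp add: axis_coeffs_def)

lemma add_axis_eq_setw: "\<beta> $ w = 0 \<Longrightarrow> \<beta> + axis w m = setw w m \<beta>"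
  by (auto simp: vec_eq_iff axis_def setw_def)

text \<open>A series in \<open>(w, x)\<close> is a series in \<open>x\<close> with coefficients in the series in \<open>w\<close>, also as regards
  multiplication.\<close>

lemma axis_coeffs_mult:
  fixes F G :: "('a::comm_ring_1, 'v::finite) mps"
  assumes "\<beta> $ w = 0"
  shows "axis_coeffs w (F * G) \<beta> = (\<Sum>p | fst p + snd p = \<beta>. axis_coeffs w F (fst p) * axis_coeffs w G (snd p))"
proof (rule fps_ext)
  fix m
  let ?P = "{p. fst p + snd p = \<beta>}"
  have w0: "fst p $ w = 0" "snd p $ w = 0" if "p \<in> ?P" for p
  proof -
    have "(fst p + snd p) $ w = 0" using that assms by simp
    then show "fst p $ w = 0" "snd p $ w = 0" by simp_all
  qed
  have "fps_nth (\<Sum>p\<in>?P. axis_coeffs w F (fst p) * axis_coeffs w G (snd p)) m =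
      (\<Sum>p\<in>?P. \<Sum>i=0..m. mps_coeff F (fst p + axis w i) * mps_coeff G (snd p + axis w (m - i)))"
    by (simp add: fps_sum_nth fps_mult_nth axis_coeffs_nth)
  also have "\<dots> = (\<Sum>(p, i)\<in>?P \<times> {0..m}. mps_coeff F (fst p + axis w i) * mps_coeff G (snd p + axis w (m - i)))"
    by (rule sum.cartesian_product)
  also have "\<dots> = (\<Sum>p | fst p + snd p = \<beta> + axis w m. mps_coeff F (fst p) * mps_coeff G (snd p))"
  proof (rule sum.reindex_bij_witness[where i = "\<lambda>q. ((setw w 0 (fst q), setw w 0 (snd q)), fst q $ w)"
        and j = "\<lambda>(p, i). (fst p + axis w i, snd p + axis w (m - i))"])
    fix a assume a: "a \<in> ?P \<times> {0..m}"
    obtain p i where pi: "a = (p, i)" by (rule prod.exhaust)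
    with a have p: "p \<in> ?P" and i: "i \<le> m" by auto
    show "(case case a of (p, i) \<Rightarrow> (fst p + axis w i, snd p + axis w (m - i)) of
        q \<Rightarrow> ((setw w 0 (fst q), setw w 0 (snd q)), fst q $ w)) = a"
      using w0[OF p] by (auto simp: pi prod_eq_iff vec_eq_iff setw_def axis_def)
    have "fst p + axis w i + (snd p + axis w (m - i)) = (fst p + snd p) + axis w m"
      using i by (auto simp: vec_eq_iff axis_def)
    then show "(case a of (p, i) \<Rightarrow> (fst p + axis w i, snd p + axis w (m - i))) \<in> {p. fst p + snd p = \<beta> + axis w m}"
      using p by (simp add: pi)
  next
    fix q assume "q \<in> {p. fst p + snd p = \<beta> + axis w m}"
    then have q': "fst q + snd q = \<beta> + axis w m" by simp
    have q: "fst q $ j + snd q $ j = \<beta> $ j + axis w m $ j" for j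
      using arg_cong[OF q', of "\<lambda>v. v $ j"] by simp
    have qw: "fst q $ w + snd q $ w = m" using q[of w] assms by (simp add: axis_def)
    have split: "setw w 0 \<gamma> + axis w (\<gamma> $ w) = \<gamma>" for \<gamma> :: "nat ^ 'v"
      by (simp add: vec_eq_iff setw_def axis_def)
    have "m - fst q $ w = snd q $ w" using qw by simp
    then show "(case ((setw w 0 (fst q), setw w 0 (snd q)), fst q $ w) of (p, i) \<Rightarrow> (fst p + axis w i, snd p + axis w (m - i))) = q"
      by (simp add: split)
    have "setw w 0 (fst q) + setw w 0 (snd q) = \<beta>"
      unfolding vec_eq_iff
    proof
      fix j
      show "(setw w 0 (fst q) + setw w 0 (snd q)) $ j = \<beta> $ j"
        using q[of j] assms by (cases "j = w") (simp_all add: setw_def axis_def)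
    qed
    then show "((setw w 0 (fst q), setw w 0 (snd q)), fst q $ w) \<in> ?P \<times> {0..m}"
      using qw by simp
  qed auto
  also have "\<dots> = fps_nth (axis_coeffs w (F * G) \<beta>) m"
    by (simp add: axis_coeffs_nth mps_coeff_mult)
  finally show "fps_nth (axis_coeffs w (F * G) \<beta>) m =
      fps_nth (\<Sum>p\<in>?P. axis_coeffs w F (fst p) * axis_coeffs w G (snd p)) m" by simp
qed

lemma mps_has_germ_mult: "mps_has_germ w G H \<Longrightarrow> mps_has_germ w G' H' \<Longrightarrow> mps_has_germ w (\<lambda>t. G t * G' t) (H * H')"
  unfolding mps_has_germ_def
proof (intro allI impI)
  fix \<beta> :: "nat ^ 'a"
  assume *: "\<forall>\<beta>. \<beta> $ w = 0 \<longrightarrow> has_germ (\<lambda>t. mps_coeff (G t) \<beta>) (axis_coeffs w H \<beta>)"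
    "\<forall>\<beta>. \<beta> $ w = 0 \<longrightarrow> has_germ (\<lambda>t. mps_coeff (G' t) \<beta>) (axis_coeffs w H' \<beta>)" and \<beta>: "\<beta> $ w = 0"
  show "has_germ (\<lambda>t. mps_coeff (G t * G' t) \<beta>) (axis_coeffs w (H * H') \<beta>)"
    unfolding axis_coeffs_mult[OF \<beta>] mps_coeff_mult
    by (intro has_germ_sum has_germ_mult) (use * \<beta> in auto)
qed

lemma mps_has_germ_add: "mps_has_germ w G H \<Longrightarrow> mps_has_germ w G' H' \<Longrightarrow> mps_has_germ w (\<lambda>t. G t + G' t) (H + H')"
proof -
  assume *: "mps_has_germ w G H" "mps_has_germ w G' H'"
  have "axis_coeffs w (H + H') \<beta> = axis_coeffs w H \<beta> + axis_coeffs w H' \<beta>" for \<beta>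
    by (simp add: fps_eq_iff axis_coeffs_nth)
  with * show ?thesis by (auto simp: mps_has_germ_def intro: has_germ_add)
qed

lemma mps_has_germ_uminus: "mps_has_germ w G H \<Longrightarrow> mps_has_germ w (\<lambda>t. - G t) (- H)"
proof -
  assume *: "mps_has_germ w G H"
  have "axis_coeffs w (- H) \<beta> = - axis_coeffs w H \<beta>" for \<beta>
    by (simp add: fps_eq_iff axis_coeffs_nth)
  with * show ?thesis by (auto simp: mps_has_germ_def intro: has_germ_uminus)
qed

lemma mps_has_germ_0: "mps_has_germ w (\<lambda>t. 0) 0"
proof -
  have "axis_coeffs w 0 \<beta> = (0 :: complex fps)" for \<beta> by (simp add: fps_eq_iff axis_coeffs_nth)
  then show ?thesis by (auto simp: mps_has_germ_def)
qed

lemma mps_has_germ_1: "mps_has_germ w (\<lambda>t. 1) 1"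
proof -
  have "axis_coeffs w 1 \<beta> = (if \<beta> = 0 then 1 else 0 :: complex fps)" if "\<beta> $ w = 0" for \<beta>
  proof -
    have "\<beta> + axis w m = 0 \<longleftrightarrow> \<beta> = 0 \<and> m = 0" for m
      using that by (auto simp: vec_eq_iff axis_def split: if_splits)
    then show ?thesis by (auto simp: fps_eq_iff axis_coeffs_nth mps_coeff_1)
  qed
  then show ?thesis by (auto simp: mps_has_germ_def mps_coeff_1)
qed

lemma mps_has_germ_sum: "(\<And>i. i \<in> I \<Longrightarrow> mps_has_germ w (G i) (H i)) \<Longrightarrow> mps_has_germ w (\<lambda>t. \<Sum>i\<in>I. G i t) (\<Sum>i\<in>I. H i)"
  by (induction I rule: infinite_finite_induct) (auto intro: mps_has_germ_add mps_has_germ_0)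

lemma mps_has_germ_unique:
  assumes "mps_has_germ w G H" "mps_has_germ w G' H'" "\<forall>\<^sub>F t in at 0. G t = G' t" shows "H = H'"
proof (rule mps_eqI)
  fix \<gamma>
  let ?\<beta> = "setw w 0 \<gamma>"
  have ev: "\<forall>\<^sub>F t in at 0. mps_coeff (G t) ?\<beta> = mps_coeff (G' t) ?\<beta>"
    using assms(3) by eventually_elim simp
  have p: "has_germ (\<lambda>t. mps_coeff (G t) ?\<beta>) (axis_coeffs w H ?\<beta>)"
    "has_germ (\<lambda>t. mps_coeff (G' t) ?\<beta>) (axis_coeffs w H' ?\<beta>)"
    using assms(1,2) by (simp_all add: mps_has_germ_def)
  have "axis_coeffs w H ?\<beta> = axis_coeffs w H' ?\<beta>"
    by (rule has_germ_unique[OF has_germ_cong[OF p(1) ev] p(2)])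
  then have "fps_nth (axis_coeffs w H ?\<beta>) (\<gamma> $ w) = fps_nth (axis_coeffs w H' ?\<beta>) (\<gamma> $ w)" by simp
  then show "mps_coeff H \<gamma> = mps_coeff H' \<gamma>"
    by (simp add: axis_coeffs_nth add_axis_eq_setw)
qed

definition poly_has_germ :: "'v::finite \<Rightarrow> (complex \<Rightarrow> (complex, 'v) mps poly) \<Rightarrow> (complex, 'v) mps poly \<Rightarrow> bool" where
  "poly_has_germ w P Q \<longleftrightarrow> (\<forall>j. mps_has_germ w (\<lambda>t. coeff (P t) j) (coeff Q j))"

lemma poly_has_germ_mult: "poly_has_germ w P Q \<Longrightarrow> poly_has_germ w P' Q' \<Longrightarrow> poly_has_germ w (\<lambda>t. P t * P' t) (Q * Q')"
  unfolding poly_has_germ_def coeff_mult by (intro allI mps_has_germ_sum mps_has_germ_mult) auto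

lemma poly_has_germ_linear: "mps_has_germ w b B \<Longrightarrow> poly_has_germ w (\<lambda>t. [:- b t, 1:]) [:- B, 1:]"
  unfolding poly_has_germ_def
proof
  fix j assume "mps_has_germ w b B"
  then show "mps_has_germ w (\<lambda>t. coeff [:- b t, 1:] j) (coeff [:- B, 1:] j)"
    by (auto simp: coeff_pCons mps_has_germ_uminus mps_has_germ_1 mps_has_germ_0 split: nat.split)
qed

lemma poly_has_germ_1: "poly_has_germ w (\<lambda>t. 1) 1" for w :: "'v::finite"
  unfolding poly_has_germ_def
proof
  fix j
  show "mps_has_germ w (\<lambda>t. coeff 1 j) (coeff 1 j)"
    using mps_has_germ_0[of w] mps_has_germ_1[of w] by (cases "j = 0") simp_all
qed

lemma poly_has_germ_prod_linear:
  "(\<And>i. i \<in> I \<Longrightarrow> mps_has_germ w (b i) (B i)) \<Longrightarrow> poly_has_germ w (\<lambda>t. \<Prod>i\<in>I. [:- b i t, 1:]) (\<Prod>i\<in>I. [:- B i, 1:])"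
  by (induction I rule: infinite_finite_induct) (auto intro!: poly_has_germ_mult poly_has_germ_linear poly_has_germ_1 simp del: mult_pCons_left)

lemma poly_has_germ_weierstrass:
  assumes "\<And>i. i \<in> {1..k} \<Longrightarrow> mps_has_germ w (A i) (B i)"
  shows "poly_has_germ w (\<lambda>t. weierstrass k (\<lambda>i. A i t)) (weierstrass k B)"
  unfolding poly_has_germ_def coeff_weierstrass
proof
  fix j
  have "mps_has_germ w (A (k - j)) (B (k - j))" if "j < k" using that by (intro assms) auto
  then show "mps_has_germ w (\<lambda>t. if j < k then A (k - j) t else if j = k then 1 else 0)
      (if j < k then B (k - j) else if j = k then 1 else 0)"
    using mps_has_germ_0 mps_has_germ_1 by (cases j k rule: linorder_cases) auto
qed

lemma poly_has_germ_unique: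
  assumes "poly_has_germ w P Q" "poly_has_germ w P' Q'" "\<forall>\<^sub>F t in at 0. P t = P' t" shows "Q = Q'"
proof (rule poly_eqI)
  fix j
  show "coeff Q j = coeff Q' j"
  proof (rule mps_has_germ_unique)
    show "mps_has_germ w (\<lambda>t. coeff (P t) j) (coeff Q j)" "mps_has_germ w (\<lambda>t. coeff (P' t) j) (coeff Q' j)"
      using assms by (auto simp: poly_has_germ_def)
    show "\<forall>\<^sub>F t in at 0. coeff (P t) j = coeff (P' t) j" using assms(3) by eventually_elim simp
  qed
qed

section \<open>Splitting of the strict transform\<close>

lemma weierstrass_rescale:
  fixes b :: "'i \<Rightarrow> (complex, 'v::finite) mps"
  assumes I: "finite I" "card I = k" and split: "weierstrass k A = (\<Prod>i\<in>I. [:- b i, 1:])"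
  shows "weierstrass k (\<lambda>i. rescale q i (A i)) = (\<Prod>i\<in>I. [:- rescale q 1 (b i), 1:])"
proof (rule poly_eqI)
  fix j
  have 1: "rescale q 0 1 = (1 :: (complex, 'v) mps)"
    by (rule mps_eqI) (simp add: rescale_def mps_coeff_1)
  show "coeff (weierstrass k (\<lambda>i. rescale q i (A i))) j = coeff (\<Prod>i\<in>I. [:- rescale q 1 (b i), 1:]) j"
  proof (cases "j \<le> k")
    case True
    then have "coeff (\<Prod>i\<in>I. [:- rescale q 1 (b i), 1:]) j = rescale q (k - j) (coeff (weierstrass k A) j)"
      using I by (simp only: coeff_prod_rescale split)
    then show ?thesis using True 1 by (auto simp: coeff_weierstrass)
  next
    case False
    then show ?thesis using I coeff_prod_above[of I j "\<lambda>i. rescale q 1 (b i)"] by (simp add: coeff_weierstrass)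
  qed
qed

lemma has_germ_eval_power:
  assumes "fps_conv_radius F > 0" "p > 0"
  shows "has_germ (\<lambda>t. eval_fps F (t ^ p)) (fps_compose F (fps_X ^ p))"
proof -
  have "(eval_fps F \<circ> (\<lambda>t. t ^ p)) has_fps_expansion fps_compose F (fps_X ^ p)"
    using assms by (intro has_fps_expansion_compose eval_fps_has_fps_expansion has_fps_expansion_fps_X_power) auto
  then show ?thesis by (intro has_germI) (simp add: o_def)
qed

lemma setw_0_eq: "\<beta> $ w = 0 \<Longrightarrow> setw w 0 \<beta> = \<beta>"
  by (metis setw_simps(4))

text \<open>With \<open>w = t ^ p\<close>, rescaling by \<open>q = t ^ (p N)\<close> on the slice \<open>w = t ^ p\<close> amounts to \<open>N\<close> blowings-up,
  because \<open>q = w ^ N\<close>.\<close>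

lemma mps_has_germ_blowup:
  fixes A :: "(complex, 'v::finite) mps"
  assumes radius: "\<And>\<beta>. fps_conv_radius (axis_coeffs w A \<beta>) > 0" and p: "p > 0"
    and ord: "\<And>\<gamma>. xdeg w \<gamma> < i \<Longrightarrow> mps_coeff A \<gamma> = 0"
  shows "mps_has_germ w (\<lambda>t. rescale (t ^ (p * N)) i (restrict_at w A (t ^ p)))
    (mps_subst (blowup w N i A) (\<lambda>j. if j = w then mps_var w ^ p else mps_var j))"
    (is "mps_has_germ w ?G ?H")
  unfolding mps_has_germ_def
proof (intro allI impI)
  fix \<beta> :: "nat ^ 'v" assume \<beta>: "\<beta> $ w = 0"
  have deg: "mdeg \<beta> = xdeg w \<beta>" using mdeg_xdeg[of \<beta> w] \<beta> by simp
  let ?F = "axis_coeffs w A \<beta>"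
  have H: "fps_nth (axis_coeffs w ?H \<beta>) m = (if p dvd m \<and> i \<le> xdeg w \<beta> \<and> N * (xdeg w \<beta> - i) \<le> m div p
      then fps_nth ?F (m div p - N * (xdeg w \<beta> - i)) else 0)" for m
    using \<beta> by (auto simp: axis_coeffs_nth add_axis_eq_setw root_subst_coeff[OF p] blowup_def)
  show "has_germ (\<lambda>t. mps_coeff (?G t) \<beta>) (axis_coeffs w ?H \<beta>)"
  proof (cases "i \<le> xdeg w \<beta>")
    case True
    define d where "d = xdeg w \<beta> - i"
    have "axis_coeffs w ?H \<beta> = fps_X ^ (p * N * d) * fps_compose ?F (fps_X ^ p)"
    proof (rule fps_ext)
      fix m
      show "fps_nth (axis_coeffs w ?H \<beta>) m = fps_nth (fps_X ^ (p * N * d) * fps_compose ?F (fps_X ^ p)) m"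
      proof (cases "p dvd m")
        case dvd: True
        then obtain n where n: "m = p * n" ..
        have "p * n - p * N * d = p * (n - N * d)" by (simp add: diff_mult_distrib2 mult.assoc)
        moreover have "p * n < p * N * d \<longleftrightarrow> n < N * d" using p by (simp add: mult.assoc)
        ultimately show ?thesis
          using p True unfolding H d_def[symmetric] n
          by (auto simp: fps_X_power_mult_nth fps_nth_compose_X_power not_less)
      next
        case False
        have "\<not> p dvd m - p * N * d" if "p * N * d \<le> m"
        proof
          assume "p dvd m - p * N * d"
          then have "p dvd (m - p * N * d) + p * N * d" by (intro dvd_add) (simp_all add: mult.assoc)
          with that False show "False" by simp
        qed
        then show ?thesis using False unfolding H
          by (auto simp: fps_X_power_mult_nth fps_nth_compose_X_power)
      qed
    qed
    moreover have pe: "has_germ (\<lambda>t. t ^ (p * N * d) * eval_fps ?F (t ^ p)) (fps_X ^ (p * N * d) * fps_compose ?F (fps_X ^ p))"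
      by (intro has_germ_mult has_germ_power_ident has_germ_eval_power radius p)
    moreover have ev: "\<forall>\<^sub>F t in at 0. t ^ (p * N * d) * eval_fps ?F (t ^ p) = mps_coeff (?G t) \<beta>"
    proof -
      have nz: "\<forall>\<^sub>F t in at (0::complex). t \<noteq> 0" by (simp add: eventually_at_filter)
      then show ?thesis
      proof eventually_elim
        case (elim t)
        have "(t ^ (p * N)) ^ mdeg \<beta> / (t ^ (p * N)) ^ i = (t ^ (p * N)) ^ d"
          using elim True by (simp add: deg d_def power_diff)
        moreover have "mps_coeff (?G t) \<beta> = (t ^ (p * N)) ^ mdeg \<beta> / (t ^ (p * N)) ^ i * eval_fps ?F (t ^ p)"
          using \<beta> by (simp add: rescale_def restrict_at_def)
        ultimately have "mps_coeff (?G t) \<beta> = (t ^ (p * N)) ^ d * eval_fps ?F (t ^ p)"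
          by (simp only:)
        then show ?case by (simp only: power_mult)
      qed
    qed
    ultimately show ?thesis using has_germ_cong[OF pe ev] by simp
  next
    case False
    then have "?F = 0" using ord \<beta> by (auto simp: fps_eq_iff axis_coeffs_nth add_axis_eq_setw)
    moreover have "axis_coeffs w ?H \<beta> = 0" using False by (simp add: fps_eq_iff H)
    ultimately show ?thesis using \<beta> has_germ_0 by (simp add: rescale_def restrict_at_def)
  qed
qed

lemma polynomial_root_bound:
  fixes z :: complex
  assumes "k > 0" and "z ^ k + (\<Sum>i=1..k. a i * z ^ (k - i)) = 0" and B: "(\<Sum>i=1..k. norm (a i)) \<le> B"
  shows "norm z \<le> 1 + B"
proof (cases "norm z \<le> 1")
  case True
  have "0 \<le> (\<Sum>i=1..k. norm (a i))" by (intro sum_nonneg) simp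
  with True B show ?thesis by linarith
next
  case False
  have "norm z * norm z ^ (k - 1) = norm (z ^ k)" using assms(1) by (cases k) (simp_all add: norm_power norm_mult)
  also have "z ^ k = - (\<Sum>i=1..k. a i * z ^ (k - i))" using assms(2) by (simp add: eq_neg_iff_add_eq_0)
  also have "norm \<dots> \<le> (\<Sum>i=1..k. norm (a i) * norm z ^ (k - 1))"
    unfolding norm_minus_cancel
  proof (rule order.trans[OF norm_sum sum_mono])
    fix i assume "i \<in> {1..k}"
    then have "norm z ^ (k - i) \<le> norm z ^ (k - 1)" using False by (intro power_increasing) auto
    then show "norm (a i * z ^ (k - i)) \<le> norm (a i) * norm z ^ (k - 1)"
      by (simp add: norm_mult norm_power mult_left_mono)
  qed
  also have "\<dots> \<le> B * norm z ^ (k - 1)"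
    unfolding sum_distrib_right[symmetric] by (intro mult_right_mono B) simp
  finally have "norm z * norm z ^ (k - 1) \<le> B * norm z ^ (k - 1)" .
  moreover have "norm z ^ (k - 1) > 0" using False by (intro zero_less_power) linarith
  ultimately have "norm z \<le> B" by (simp only: mult_le_cancel_right_pos)
  then show ?thesis by simp
qed

text \<open>The case \<open>s = 0\<close> of \<open>slices_split\<close>.\<close>

lemma linear_parts_are_roots:
  fixes R :: "(complex, 'v::finite) mps set"
  assumes "finite R" "card R = k" "inj_on linear_part R" "\<And>b. b \<in> R \<Longrightarrow> mps_coeff b 0 = 0"
    and split: "weierstrass k A = (\<Prod>b\<in>R. [:- b, 1:])"
  shows "z ^ k + (\<Sum>i=1..k. fps_nth (slice u (A i)) i * z ^ (k - i)) = (\<Prod>l\<in>linear_part ` R. z - form l u)"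
proof -
  have "weierstrass k (\<lambda>i. fps_shift i (slice u (A i))) = (\<Prod>b\<in>R. [:- fps_shift 1 (slice u b), 1:])"
    using slices_split[of R k "\<lambda>b. b" A u] assms by simp
  from arg_cong[OF this, of "\<lambda>P. fps_nth (poly P (fps_const z)) 0"]
  have "z ^ k + (\<Sum>i=1..k. fps_nth (slice u (A i)) i * z ^ (k - i)) = (\<Prod>b\<in>R. z - fps_nth (slice u b) 1)"
    by (simp add: poly_weierstrass poly_prod fps_nth_0_prod fps_sum_nth)
  also have "\<dots> = (\<Prod>b\<in>R. z - form (linear_part b) u)" by (simp only: slice_nth_1)
  also have "\<dots> = (\<Prod>l\<in>linear_part ` R. z - form l u)"
    by (simp add: prod.reindex[OF assms(3)])
  finally show ?thesis .
qed

text \<open>The bound required by \<open>root_family\<close> comes from the coefficients: on a smaller disc they are bounded in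
  the directions of the coordinate axes, and so are the components of the vectors, which are the roots in these
  directions.\<close>

lemma puiseux_parametrization_of_root_vectors:
  fixes p :: "nat \<Rightarrow> complex \<Rightarrow> complex ^ 'v::finite \<Rightarrow> complex" and R :: "complex \<Rightarrow> (complex ^ 'v) set"
  assumes r: "r > 0" and card_UNIV: "CARD('v) = k"
    and p: "\<And>i u. i \<in> {1..k} \<Longrightarrow> (\<lambda>c. p i c u) holomorphic_on ball 0 r"
    and R: "\<And>c. c \<in> ball 0 r - {0} \<Longrightarrow> finite (R c) \<and> card (R c) = k"
    and roots: "\<And>c u z. c \<in> ball 0 r - {0} \<Longrightarrow>
      z ^ k + (\<Sum>i=1..k. p i c u * z ^ (k - i)) = (\<Prod>l\<in>R c. z - form l u)"
  shows "\<exists>(q :: nat) (L :: 'v \<Rightarrow> 'v \<Rightarrow> complex fps). q > 0 \<and> (\<forall>i j. fps_conv_radius (L i j) > 0) \<and>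
    (\<forall>\<^sub>F t in at 0. t ^ q \<in> ball 0 r - {0} \<and> bij_betw (\<lambda>i. \<chi> j. eval_fps (L i j) t) UNIV (R (t ^ q)))"
proof -
  have k: "k > 0" using card_UNIV by (metis zero_less_card_finite)
  have sub: "cball (0::complex) (r / 2) \<subseteq> ball 0 r" "ball (0::complex) (r / 2) \<subseteq> ball 0 r" using r by auto
  have "\<exists>B. \<forall>c\<in>cball 0 (r / 2). (\<Sum>i=1..k. norm (p i c u)) \<le> B" for u
  proof -
    have "continuous_on (cball 0 (r / 2)) (\<lambda>c. p i c u)" if "i \<in> {1..k}" for i
      by (rule continuous_on_subset[OF holomorphic_on_imp_continuous_on[OF p[OF that]] sub(1)])
    then have "continuous_on (cball 0 (r / 2)) (\<lambda>c. \<Sum>i=1..k. norm (p i c u))"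
      by (intro continuous_intros) auto
    then have "compact ((\<lambda>c. \<Sum>i=1..k. norm (p i c u)) ` cball 0 (r / 2))"
      by (intro compact_continuous_image) auto
    then have "bdd_above ((\<lambda>c. \<Sum>i=1..k. norm (p i c u)) ` cball 0 (r / 2))"
      by (intro bounded_imp_bdd_above compact_imp_bounded)
    then show ?thesis by (auto simp: bdd_above_def)
  qed
  then obtain B where B: "\<And>u c. c \<in> cball 0 (r / 2) \<Longrightarrow> (\<Sum>i=1..k. norm (p i c u)) \<le> B u" by metis
  define M where "M = (\<Sum>j\<in>(UNIV :: 'v set). 1 + B (axis j 1))"
  have bound: "norm l \<le> M" if c: "c \<in> ball 0 (r / 2) - {0}" and l: "l \<in> R c" for c l
  proof -
    have cD: "c \<in> ball 0 r - {0}" using c sub(2) by auto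
    have "norm (l $ j) \<le> 1 + B (axis j 1)" for j
    proof (rule polynomial_root_bound[OF k])
      have "(l $ j) ^ k + (\<Sum>i=1..k. p i c (axis j 1) * (l $ j) ^ (k - i)) = (\<Prod>l'\<in>R c. l $ j - form l' (axis j 1))"
        by (rule roots[OF cD])
      also have "\<dots> = 0" by (rule prod_zero) (use R[OF cD] l in auto)
      finally show "(l $ j) ^ k + (\<Sum>i=1..k. p i c (axis j 1) * (l $ j) ^ (k - i)) = 0" .
      show "(\<Sum>i=1..k. norm (p i c (axis j 1))) \<le> B (axis j 1)"
        by (rule B) (use c in auto)
    qed
    then have "(\<Sum>j\<in>UNIV. norm (l $ j)) \<le> M" unfolding M_def by (rule sum_mono)
    moreover have "norm l \<le> (\<Sum>j\<in>UNIV. norm (l $ j))" unfolding norm_vec_def by (rule L2_set_le_sum) simp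
    ultimately show ?thesis by linarith
  qed
  have "root_family k p R (r / 2) M"
  proof
    show "(\<lambda>c. p i c u) holomorphic_on ball 0 (r / 2)" if "i \<in> {1..k}" for i u
      by (rule holomorphic_on_subset[OF p[OF that] sub(2)])
    fix c :: complex assume c: "c \<in> ball 0 (r / 2) - {0}"
    then have cD: "c \<in> ball 0 r - {0}" using sub(2) by auto
    show "finite (R c)" "card (R c) = k" using R[OF cD] by auto
    show "z ^ k + (\<Sum>i=1..k. p i c u * z ^ (k - i)) = (\<Prod>l\<in>R c. z - form l u)" for u z by (rule roots[OF cD])
    show "norm l \<le> M" if "l \<in> R c" for l by (rule bound[OF c that])
  qed (use r card_UNIV in auto)
  then show ?thesis
  proof (rule root_family.puiseux_parametrization)
    fix q :: nat and L :: "'v \<Rightarrow> 'v \<Rightarrow> complex fps"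
    assume q: "q > 0" and L: "\<And>i j. fps_conv_radius (L i j) > 0"
      and ev: "\<forall>\<^sub>F t in at 0. t ^ q \<in> ball 0 (r / 2) - {0} \<and> bij_betw (\<lambda>i. \<chi> j. eval_fps (L i j) t) UNIV (R (t ^ q))"
    have "\<forall>\<^sub>F t in at 0. t ^ q \<in> ball 0 r - {0} \<and> bij_betw (\<lambda>i. \<chi> j. eval_fps (L i j) t) UNIV (R (t ^ q))"
      using ev
    proof eventually_elim
      case (elim t)
      then have "t ^ q \<in> ball 0 r - {0}" using sub(2) by blast
      with elim show ?case by blast
    qed
    with q L show ?thesis by blast
  qed
qed

text \<open>Near a point \<open>c\<close> of the punctured axis all other points of the axis are normal crossings points too, so
  that the coefficients vanish along the axis around \<open>c\<close>, as \<open>nc_point.splits\<close> requires.\<close>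

lemma splitting_along_punctured_axis:
  fixes w :: "'v::finite" and k :: nat
    and a :: "nat \<Rightarrow> complex ^ 'v \<Rightarrow> complex" and f :: "complex ^ 'v option \<Rightarrow> complex"
    and U :: "(complex ^ 'v) set" and A :: "nat \<Rightarrow> (complex, 'v) mps"
  assumes k: "CARD('v) = k" and U: "open U" "0 \<in> U"
    and A: "\<And>i. i \<in> {1..k} \<Longrightarrow> has_mps_expansion (a i) 0 (A i)"
    and f: "\<And>v. f v = (v $ None) ^ k + (\<Sum>i=1..k. a i (\<chi> j. v $ Some j) * (v $ None) ^ (k - i))"
    and nc: "\<And>c. c \<noteq> 0 \<Longrightarrow> axis w c \<in> U \<Longrightarrow> nc_at k f (axis (Some w) c)"
  shows "\<exists>r>0. (\<forall>i\<in>{1..k}. \<forall>\<beta>. fps_conv_radius (axis_coeffs w (A i) \<beta>) \<ge> ereal r) \<and>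
    (\<forall>c\<in>ball 0 r - {0}. \<exists>R. finite R \<and> card R = k \<and> inj_on linear_part R \<and> (\<forall>b\<in>R. mps_coeff b 0 = 0) \<and>
      weierstrass k (\<lambda>i. restrict_at w (A i) c) = (\<Prod>b\<in>R. [:- b, 1:]))"
proof -
  have "\<exists>r>0. (\<forall>\<beta>. fps_conv_radius (axis_coeffs w (A i) \<beta>) \<ge> ereal r) \<and>
    (\<forall>c u. norm c < r \<longrightarrow> u $ w = 0 \<longrightarrow>
      (\<lambda>t. a i (axis w c + t *s u)) has_fps_expansion slice u (restrict_at w (A i) c))" if "i \<in> {1..k}" for i
    by (rule restrict_at_expansion[OF A[OF that], of w]) blast
  then have "\<forall>i\<in>{1..k}. \<exists>r>0. (\<forall>\<beta>. fps_conv_radius (axis_coeffs w (A i) \<beta>) \<ge> ereal r) \<and>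
    (\<forall>c u. norm c < r \<longrightarrow> u $ w = 0 \<longrightarrow>
      (\<lambda>t. a i (axis w c + t *s u)) has_fps_expansion slice u (restrict_at w (A i) c))" by blast
  from bchoice[OF this] obtain rr where rr: "\<And>i. i \<in> {1..k} \<Longrightarrow> rr i > 0"
    "\<And>i \<beta>. i \<in> {1..k} \<Longrightarrow> fps_conv_radius (axis_coeffs w (A i) \<beta>) \<ge> ereal (rr i)"
    "\<And>i c u. i \<in> {1..k} \<Longrightarrow> norm c < rr i \<Longrightarrow> u $ w = 0 \<Longrightarrow>
      (\<lambda>t. a i (axis w c + t *s u)) has_fps_expansion slice u (restrict_at w (A i) c)" by blast
  obtain r0 where r0: "r0 > 0" "ball 0 r0 \<subseteq> U" using U open_contains_ball by blast
  define r where "r = Min (insert r0 (rr ` {1..k}))"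
  have r: "r > 0" "r \<le> r0" "\<And>i. i \<in> {1..k} \<Longrightarrow> r \<le> rr i"
  proof -
    show "r > 0" using rr(1) r0 by (auto simp: r_def)
    show "r \<le> r0" "\<And>i. i \<in> {1..k} \<Longrightarrow> r \<le> rr i" unfolding r_def by (rule Min_le; simp)+
  qed
  have nc': "nc_at k f (axis (Some w) c)" if "c \<in> ball 0 r - {0}" for c
  proof (rule nc)
    have "axis w c \<in> ball 0 r0" using that r by (simp add: norm_axis_complex)
    then show "axis w c \<in> U" using r0 by blast
  qed (use that in auto)
  have vanish: "a i (axis w c) = 0" if c: "c \<in> ball 0 r - {0}" and i: "i \<in> {1..k}" for c i
    by (rule nc_at_imp_nc_point[OF k f nc'[OF c]]) (rule nc_point.vanishes[OF _ i])
  have main: "\<exists>R. finite R \<and> card R = k \<and> inj_on linear_part R \<and> (\<forall>b\<in>R. mps_coeff b 0 = 0) \<and>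
      weierstrass k (\<lambda>i. restrict_at w (A i) c) = (\<Prod>b\<in>R. [:- b, 1:])" if c: "c \<in> ball 0 r - {0}" for c
  proof (rule nc_at_imp_nc_point[OF k f nc'[OF c]])
    fix F g y S assume np: "nc_point w k a f c F g y S"
    have "\<forall>\<^sub>F c' in nhds c. c' \<in> ball 0 r - {0}"
      using c by (intro eventually_nhds_in_open) auto
    then have van: "\<forall>\<^sub>F c' in nhds c. \<forall>i\<in>{1..k}. a i (axis w c') = 0"
      by eventually_elim (use vanish in blast)
    show ?thesis
    proof (rule nc_point.splits[OF np van, of "\<lambda>i. restrict_at w (A i) c"])
      show "mps_coeff (restrict_at w (A i) c) \<beta> = 0" if "\<beta> $ w \<noteq> 0" for i \<beta>
        using that by (simp add: restrict_at_def)
      show "(\<lambda>t. a i (axis w c + t *s u)) has_fps_expansion slice u (restrict_at w (A i) c)"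
        if "i \<in> {1..k}" "u $ w = 0" for i u
        by (rule rr(3)) (use that c r(3)[OF that(1)] in auto)
    qed blast
  qed
  have "fps_conv_radius (axis_coeffs w (A i) \<beta>) \<ge> ereal r" if "i \<in> {1..k}" for i \<beta>
    using rr(2)[OF that, of \<beta>] r(3)[OF that] by (meson ereal_less_eq(3) order_trans)
  with r(1) main show ?thesis by blast
qed

theorem theorem1p13:
  fixes w :: "'v::finite" and k :: nat
    and a :: "nat \<Rightarrow> complex ^ 'v \<Rightarrow> complex" and f :: "complex ^ 'v option \<Rightarrow> complex"
    and U :: "(complex ^ 'v) set"
  assumes "CARD('v) = k"
    and "open U" and "0 \<in> U"
    and "\<And>i. i \<in> {1..k} \<Longrightarrow> mv_analytic_on (a i) U"
    and "\<And>v. f v = (v $ None) ^ k + (\<Sum>i=1..k. a i (\<chi> j. v $ Some j) * (v $ None) ^ (k - i))"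
    and "\<And>c. c \<noteq> 0 \<Longrightarrow> axis w c \<in> U \<Longrightarrow> nc_at k f (axis (Some w) c)"
  shows "\<exists>N g p. (strict_transform w k ^^ N)
             (monom 1 k + (\<Sum>i=1..k. monom (mps_expansion (a i) 0) (k - i))) g
           \<and> p > 0 \<and> splits_over_root w p k g"
proof -
  define A where "A i = mps_expansion (a i) 0" for i
  have hasA: "has_mps_expansion (a i) 0 (A i)" if "i \<in> {1..k}" for i
  proof -
    have "\<exists>F. has_mps_expansion (a i) 0 F" using assms(3,4) that by (auto simp: mv_analytic_on_def)
    then show ?thesis unfolding A_def mps_expansion_def by (rule someI_ex)
  qed
  obtain r where r: "r > 0" and radius: "\<And>i \<beta>. i \<in> {1..k} \<Longrightarrow> fps_conv_radius (axis_coeffs w (A i) \<beta>) \<ge> ereal r"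
    and ex_R: "\<forall>c\<in>ball 0 r - {0}. \<exists>R. finite R \<and> card R = k \<and> inj_on linear_part R \<and> (\<forall>b\<in>R. mps_coeff b 0 = 0) \<and>
      weierstrass k (\<lambda>i. restrict_at w (A i) c) = (\<Prod>b\<in>R. [:- b, 1:])"
    using splitting_along_punctured_axis[OF assms(1-3) hasA assms(5,6)] by blast
  from bchoice[OF ex_R] obtain Bs where Bs: "\<And>c. c \<in> ball 0 r - {0} \<Longrightarrow> finite (Bs c)"
    "\<And>c. c \<in> ball 0 r - {0} \<Longrightarrow> card (Bs c) = k" "\<And>c. c \<in> ball 0 r - {0} \<Longrightarrow> inj_on linear_part (Bs c)"
    "\<And>c b. c \<in> ball 0 r - {0} \<Longrightarrow> b \<in> Bs c \<Longrightarrow> mps_coeff b 0 = 0"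
    "\<And>c. c \<in> ball 0 r - {0} \<Longrightarrow> weierstrass k (\<lambda>i. restrict_at w (A i) c) = (\<Prod>b\<in>Bs c. [:- b, 1:])"
    by blast
  have radius_pos: "fps_conv_radius (axis_coeffs w (A i) \<beta>) > 0" if "i \<in> {1..k}" for i \<beta>
    using radius[OF that, of \<beta>] r by (metis ereal_less(2) less_le_trans)
  (* The order in x of the i-th coefficient is at least i for each w = c \<noteq> 0, hence identically in w. *)
  have ord: "mps_coeff (A i) \<gamma> = 0" if i: "i \<in> {1..k}" and \<gamma>: "xdeg w \<gamma> < i" for i \<gamma>
  proof -
    let ?\<beta> = "setw w 0 \<gamma>"
    have "mdeg ?\<beta> < i" using \<gamma> mdeg_xdeg[of ?\<beta> w] by simp
    have "eval_fps (axis_coeffs w (A i) ?\<beta>) c = 0" if c: "c \<in> ball 0 r - {0}" for c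
    proof -
      have "ordge i (restrict_at w (A i) c)"
        using ordge_of_splitting[OF Bs(1)[OF c] Bs(2)[OF c] _ Bs(5)[OF c] i] Bs(4)[OF c] by blast
      from ordge_D[OF this \<open>mdeg ?\<beta> < i\<close>] show ?thesis by (simp add: restrict_at_def)
    qed
    moreover have "\<forall>\<^sub>F c in at 0. c \<in> ball 0 r - {0}" using r by (intro eventually_at_in_open) auto
    ultimately have "\<forall>\<^sub>F c in at 0. eval_fps (axis_coeffs w (A i) ?\<beta>) c = 0"
      by (auto elim: eventually_mono)
    from has_germ_unique[OF has_germ_cong[OF has_germ_eval_fps[OF radius_pos[OF i]] this] has_germ_0]
    have "fps_nth (axis_coeffs w (A i) ?\<beta>) (\<gamma> $ w) = 0" by simp
    then show ?thesis by (simp add: axis_coeffs_nth add_axis_eq_setw)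
  qed
  (* the part of degree i in x of the i-th coefficient, at u *)
  define P where "P i c u = fps_nth (slice u (restrict_at w (A i) c)) i" for i c u
  have hol: "(\<lambda>c. P i c u) holomorphic_on ball 0 r" if "i \<in> {1..k}" for i u
  proof -
    have "(\<lambda>c. mps_coeff (restrict_at w (A i) c) \<beta>) holomorphic_on ball 0 r" for \<beta>
    proof (cases "\<beta> $ w = 0")
      case True
      have "eval_fps (axis_coeffs w (A i) \<beta>) holomorphic_on ball 0 r"
      proof (rule holomorphic_on_subset[OF holomorphic_on_eval_fps[OF subset_refl]])
        show "ball (0 :: complex) r \<subseteq> eball 0 (fps_conv_radius (axis_coeffs w (A i) \<beta>))"
        proof
          fix x :: complex assume "x \<in> ball 0 r"
          then have "ereal (norm x) < ereal r" by simp
          also note radius[OF that, of \<beta>]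
          finally show "x \<in> eball 0 (fps_conv_radius (axis_coeffs w (A i) \<beta>))" by (simp add: in_eball_iff)
        qed
      qed
      with True show ?thesis by (simp add: restrict_at_def)
    qed (simp add: restrict_at_def)
    then show ?thesis unfolding P_def slice_nth by (intro holomorphic_intros)
  qed
  have "\<exists>(q :: nat) (L :: 'v \<Rightarrow> 'v \<Rightarrow> complex fps). q > 0 \<and> (\<forall>i j. fps_conv_radius (L i j) > 0) \<and>
    (\<forall>\<^sub>F t in at 0. t ^ q \<in> ball 0 r - {0} \<and>
      bij_betw (\<lambda>i. \<chi> j. eval_fps (L i j) t) UNIV (linear_part ` Bs (t ^ q)))"
  proof (rule puiseux_parametrization_of_root_vectors[OF r assms(1) hol])
    fix c :: complex assume c: "c \<in> ball 0 r - {0}"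
    show "finite (linear_part ` Bs c) \<and> card (linear_part ` Bs c) = k"
      using Bs(1-3)[OF c] by (simp add: card_image)
    show "z ^ k + (\<Sum>i=1..k. P i c u * z ^ (k - i)) = (\<Prod>l\<in>linear_part ` Bs c. z - form l u)" for u z
      unfolding P_def by (rule linear_parts_are_roots[OF Bs(1-3)[OF c] Bs(4)[OF c] Bs(5)[OF c]])
  qed
  then obtain p and L :: "'v \<Rightarrow> 'v \<Rightarrow> complex fps" where p: "p > 0" and L: "\<And>i j. fps_conv_radius (L i j) > 0"
    and par: "\<forall>\<^sub>F t in at 0. t ^ p \<in> ball 0 r - {0} \<and>
      bij_betw (\<lambda>i. \<chi> j. eval_fps (L i j) t) UNIV (linear_part ` Bs (t ^ p))" by blast
  (* the root over t^p whose linear part is the i-th branch; unique, as linear parts are distinct *)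
  define b where "b i t = (SOME b. b \<in> Bs (t ^ p) \<and> linear_part b = (\<chi> j. eval_fps (L i j) t))" for i t
  have good: "\<forall>\<^sub>F t in at 0. weierstrass k (\<lambda>i. restrict_at w (A i) (t ^ p)) = (\<Prod>i\<in>UNIV. [:- b i t, 1:]) \<and>
      (\<forall>i. mps_coeff (b i t) 0 = 0) \<and> inj (\<lambda>i. linear_part (b i t)) \<and>
      (\<forall>i. linear_part (b i t) = (\<chi> j. eval_fps (L i j) t))"
    using par
  proof eventually_elim
    case (elim t)
    then have c: "t ^ p \<in> ball 0 r - {0}"
      and bij: "bij_betw (\<lambda>i. \<chi> j. eval_fps (L i j) t) UNIV (linear_part ` Bs (t ^ p))" by auto
    have b: "b i t \<in> Bs (t ^ p) \<and> linear_part (b i t) = (\<chi> j. eval_fps (L i j) t)" for i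
    proof -
      have "(\<chi> j. eval_fps (L i j) t) \<in> linear_part ` Bs (t ^ p)" using bij by (auto simp: bij_betw_def)
      then have "\<exists>b. b \<in> Bs (t ^ p) \<and> linear_part b = (\<chi> j. eval_fps (L i j) t)" by auto
      then show ?thesis unfolding b_def by (rule someI_ex)
    qed
    have inj: "inj (\<lambda>i. linear_part (b i t))" using b bij by (simp add: bij_betw_def)
    have "bij_betw (\<lambda>i. b i t) UNIV (Bs (t ^ p))"
    proof (rule bij_betw_imageI)
      show "inj (\<lambda>i. b i t)" by (rule inj_on_imageI2[of linear_part]) (use inj in \<open>simp add: o_def\<close>)
      then have "card (range (\<lambda>i. b i t)) = card (Bs (t ^ p))"
        using Bs(2)[OF c] assms(1) by (simp add: card_image)
      then show "range (\<lambda>i. b i t) = Bs (t ^ p)"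
        using b Bs(1)[OF c] by (intro card_subset_eq) auto
    qed
    then have "(\<Prod>i\<in>UNIV. [:- b i t, 1:]) = (\<Prod>b\<in>Bs (t ^ p). [:- b, 1:])"
      by (rule prod.reindex_bij_betw)
    then show ?case using Bs(5)[OF c] Bs(4)[OF c] b inj by auto
  qed
  have lin: "has_germ (\<lambda>t. linear_part (b i t) $ j) (L i j)" for i j
  proof (rule has_germ_cong[OF has_germ_eval_fps[OF L]])
    show "\<forall>\<^sub>F t in at 0. eval_fps (L i j) t = linear_part (b i t) $ j"
      using good by eventually_elim simp
  qed
  have A_reg: "regular (\<lambda>t. mps_coeff (restrict_at w (A i) (t ^ p)) \<beta>)" if "i \<in> {1..k}" for i \<beta>
  proof (cases "\<beta> $ w = 0")
    case True
    then show ?thesis using has_germ_eval_power[OF radius_pos[OF that] p] by (auto simp: restrict_at_def regular_def)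
  qed (simp add: restrict_at_def regular_const)
  have "\<exists>N. \<forall>M\<ge>N. \<forall>i \<beta>. regular (\<lambda>t. mps_coeff (rescale (t ^ M) 1 (b i t)) \<beta>)"
    by (rule rescaled_roots_regular[OF assms(1) A_reg _ _ _ lin]) (use good in \<open>auto elim: eventually_mono\<close>)
  then obtain N where N: "\<And>M i \<beta>. M \<ge> N \<Longrightarrow> regular (\<lambda>t. mps_coeff (rescale (t ^ M) 1 (b i t)) \<beta>)" by blast
  (* The exponent must be a multiple of p for t^M to be a power of w = t^p. *)
  have "p * N \<ge> N" using p by simp
  from N[OF this] have "\<forall>i \<beta>. \<exists>F. has_germ (\<lambda>t. mps_coeff (rescale (t ^ (p * N)) 1 (b i t)) \<beta>) F"
    by (simp add: regular_def)
  then obtain F where F: "\<And>i \<beta>. has_germ (\<lambda>t. mps_coeff (rescale (t ^ (p * N)) 1 (b i t)) \<beta>) (F i \<beta>)" by metis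
  (* F i \<beta> is the Taylor series in t of the coefficient of x^\<beta> in the rescaled i-th root. *)
  define B where "B i = Abs_mps (\<lambda>\<gamma>. fps_nth (F i (setw w 0 \<gamma>)) (\<gamma> $ w))" for i
  have B: "mps_has_germ w (\<lambda>t. rescale (t ^ (p * N)) 1 (b i t)) (B i)" for i
    unfolding mps_has_germ_def
  proof (intro allI impI)
    fix \<beta> :: "nat ^ 'v" assume \<beta>: "\<beta> $ w = 0"
    have "axis_coeffs w (B i) \<beta> = F i \<beta>"
      by (simp add: fps_eq_iff axis_coeffs_nth add_axis_eq_setw[OF \<beta>] B_def setw_0_eq[OF \<beta>])
    with F show "has_germ (\<lambda>t. mps_coeff (rescale (t ^ (p * N)) 1 (b i t)) \<beta>) (axis_coeffs w (B i) \<beta>)" by simp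
  qed
  have B0: "mps_coeff (B i) 0 = 0" for i
  proof -
    have "\<forall>\<^sub>F t in at 0. mps_coeff (rescale (t ^ (p * N)) 1 (b i t)) 0 = 0"
      using good by eventually_elim (simp add: rescale_def)
    from has_germ_unique[OF has_germ_cong[OF F this] has_germ_0] have "F i 0 = 0" .
    then show ?thesis by (simp add: B_def setw_0_eq)
  qed
  define g where "g = weierstrass k (\<lambda>i. blowup w N i (A i))"
  let ?S = "\<lambda>j :: 'v. if j = w then mps_var w ^ p else mps_var j :: (complex, 'v) mps"
  have "weierstrass k (\<lambda>i. mps_subst (blowup w N i (A i)) ?S) = (\<Prod>i\<in>UNIV. [:- B i, 1:])"
  proof (rule poly_has_germ_unique)
    show "poly_has_germ w (\<lambda>t. weierstrass k (\<lambda>i. rescale (t ^ (p * N)) i (restrict_at w (A i) (t ^ p))))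
        (weierstrass k (\<lambda>i. mps_subst (blowup w N i (A i)) ?S))"
      by (intro poly_has_germ_weierstrass mps_has_germ_blowup radius_pos ord p)
    show "poly_has_germ w (\<lambda>t. \<Prod>i\<in>UNIV. [:- rescale (t ^ (p * N)) 1 (b i t), 1:]) (\<Prod>i\<in>UNIV. [:- B i, 1:])"
      by (intro poly_has_germ_prod_linear B)
    show "\<forall>\<^sub>F t in at 0. weierstrass k (\<lambda>i. rescale (t ^ (p * N)) i (restrict_at w (A i) (t ^ p))) =
        (\<Prod>i\<in>UNIV. [:- rescale (t ^ (p * N)) 1 (b i t), 1:])"
      using good
    proof eventually_elim
      case (elim t)
      then show ?case using assms(1) by (intro weierstrass_rescale) auto
    qed
  qed
  moreover have "map_poly (\<lambda>c. mps_subst c ?S) g = weierstrass k (\<lambda>i. mps_subst (blowup w N i (A i)) ?S)"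
  proof -
    interpret mps_substitution ?S
    proof
      fix i
      have "mps_coeff (mps_var w ^ p) 0 = (0 :: complex)"
        using mps_coeff_var_power_mult[of w p 1 0] p by simp
      then show "mps_coeff (?S i) 0 = 0" by (simp add: mps_coeff_var)
    qed
    show ?thesis unfolding g_def by (rule map_poly_weierstrass) (rule subst_0 subst_1)+
  qed
  moreover obtain e :: "nat \<Rightarrow> 'v" where e: "bij_betw e {..<k} UNIV"
    using assms(1) by (metis card_lessThan finite_class.finite_UNIV finite_lessThan finite_same_card_bij)
  ultimately have "map_poly (\<lambda>c. mps_subst c ?S) g = (\<Prod>j<k. [:- B (e j), 1:])"
    using prod.reindex_bij_betw[OF e, of "\<lambda>i. [:- B i, 1:]"] by simp
  then have "splits_over_root w p k g"
    unfolding splits_over_root_def using B0 by (intro exI[of _ "\<lambda>j. B (e j)"]) simp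
  moreover have "(strict_transform w k ^^ N) (weierstrass k A) g"
    unfolding g_def by (rule iterated_strict_transform) (rule ord)
  ultimately show ?thesis
    using p unfolding weierstrass_def A_def by blast
qed

end
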